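(* Let $k,n\in\mathbb{N}$ be coprime and let $u,v$ be a pair of unitaries with $uv=e^{2\pi i k/n}vu$. Let $q$ be a complex number of modulus $1$ and let $\tilde u,\tilde v$ be a pair of unitaries with $\tilde u\tilde v=q\tilde v\tilde u$ (where $q=e^{2\pi i\theta}$ with $\theta$ possibly irrational). Assume that the mapping $\tilde u\mapsto u$, $\tilde v\mapsto v$ defines a unital and $n$-positive map $\mathcal{S}(\tilde u,\tilde v)\to\mathcal{S}(u,v)$. Then $q=e^{2\pi i k/n}$ and this map is completely positive. If moreover this mapping is an $n$-order isomorphism, then it extends to a $*$-isomorphism of $C^*(\tilde u,\tilde v)$ and $C^*(u,v)$.
   Context: $\mathcal{S}(u,v)$ denotes the operator system (unital self-adjoint linear subspace) generated by $u,v$, and $C^*(u,v)$ the unital $C^*$-algebra generated by $u,v$; the two pairs may live in different $C^*$-algebras. A linear map is $n$-positive if its entrywise amplification to $n\times n$ matrices is positive. A unital linear bijection between operator systems is an $n$-order isomorphism if it and its inverse are $n$-positive. *)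

theory Defs
  imports "HOL-Analysis.Analysis"
begin

text \<open>
  Unital C*-algebras. The real scalar multiplication inherited from \<^class>\<open>banach\<close> is required
  to be the restriction of the complex one. By \<^class>\<open>real_normed_algebra_1\<close> the algebra is
  nonzero; in the zero algebra every commutation relation holds.
\<close>

class unital_cstar_algebra = banach + real_normed_algebra_1 +
  fixes scaleC :: "complex \<Rightarrow> 'a \<Rightarrow> 'a"  (infixr "*\<^sub>C" 75)
    and star :: "'a \<Rightarrow> 'a"
  assumes scaleC_add_right: "c *\<^sub>C (x + y) = c *\<^sub>C x + c *\<^sub>C y"
    and scaleC_add_left: "(c + d) *\<^sub>C x = c *\<^sub>C x + d *\<^sub>C x"
    and scaleC_scaleC: "c *\<^sub>C d *\<^sub>C x = (c * d) *\<^sub>C x"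
    and scaleR_scaleC: "r *\<^sub>R x = complex_of_real r *\<^sub>C x"
    and mult_scaleC_left: "(c *\<^sub>C x) * y = c *\<^sub>C (x * y)"
    and mult_scaleC_right: "x * (c *\<^sub>C y) = c *\<^sub>C (x * y)"
    and norm_scaleC: "norm (c *\<^sub>C x) = cmod c * norm x"
    and star_star: "star (star x) = x"
    and star_add: "star (x + y) = star x + star y"
    and star_scaleC: "star (c *\<^sub>C x) = cnj c *\<^sub>C star x"
    and star_mult: "star (x * y) = star y * star x"
    and cstar_identity: "norm (star x * x) = (norm x)\<^sup>2"

definition unitary :: "'a::unital_cstar_algebra \<Rightarrow> bool" where
  "unitary u \<longleftrightarrow> star u * u = 1 \<and> u * star u = 1"

definition operator_system :: "'a::unital_cstar_algebra set \<Rightarrow> bool" where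
  "operator_system S \<longleftrightarrow>
     1 \<in> S \<and> (\<forall>x\<in>S. \<forall>y\<in>S. x + y \<in> S) \<and> (\<forall>c. \<forall>x\<in>S. c *\<^sub>C x \<in> S) \<and> (\<forall>x\<in>S. star x \<in> S)"

definition unital_cstar_subalgebra :: "'a::unital_cstar_algebra set \<Rightarrow> bool" where
  "unital_cstar_subalgebra A \<longleftrightarrow>
     operator_system A \<and> (\<forall>x\<in>A. \<forall>y\<in>A. x * y \<in> A) \<and> closed A"

definition opsys_gen :: "'a::unital_cstar_algebra \<Rightarrow> 'a \<Rightarrow> 'a set" where
  "opsys_gen u v = operator_system hull {u, v}"

definition cstar_gen :: "'a::unital_cstar_algebra \<Rightarrow> 'a \<Rightarrow> 'a set" where
  "cstar_gen u v = unital_cstar_subalgebra hull {u, v}"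

text \<open>
  Maps between subspaces are total functions of which only the values on the subspace matter,
  and an \<open>m \<times> m\<close> matrix is a function of which only the entries with indices below \<open>m\<close> matter.
  A matrix \<open>X\<close> over a C*-algebra is positive if \<open>X = Y\<^sup>* Y\<close> for some matrix \<open>Y\<close>. Matrices over
  an operator system are ordered by positivity in the matrices over the ambient C*-algebra.
\<close>

definition linear_map_on ::
    "'a::unital_cstar_algebra set \<Rightarrow> ('a \<Rightarrow> 'b::unital_cstar_algebra) \<Rightarrow> bool" where
  "linear_map_on S f \<longleftrightarrow>
     (\<forall>x\<in>S. \<forall>y\<in>S. f (x + y) = f x + f y) \<and> (\<forall>c. \<forall>x\<in>S. f (c *\<^sub>C x) = c *\<^sub>C f x)"

definition positive_matrix :: "nat \<Rightarrow> (nat \<Rightarrow> nat \<Rightarrow> 'a::unital_cstar_algebra) \<Rightarrow> bool" where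
  "positive_matrix m X \<longleftrightarrow>
     (\<exists>Y. \<forall>i<m. \<forall>j<m. X i j = (\<Sum>l<m. star (Y l i) * Y l j))"

definition n_positive_on ::
    "nat \<Rightarrow> 'a::unital_cstar_algebra set \<Rightarrow> ('a \<Rightarrow> 'b::unital_cstar_algebra) \<Rightarrow> bool" where
  "n_positive_on m S f \<longleftrightarrow>
     (\<forall>X. (\<forall>i<m. \<forall>j<m. X i j \<in> S) \<and> positive_matrix m X
        \<longrightarrow> positive_matrix m (\<lambda>i j. f (X i j)))"

definition completely_positive_on ::
    "'a::unital_cstar_algebra set \<Rightarrow> ('a \<Rightarrow> 'b::unital_cstar_algebra) \<Rightarrow> bool" where
  "completely_positive_on S f \<longleftrightarrow> (\<forall>m. n_positive_on m S f)"

definition n_order_isomorphism ::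
    "nat \<Rightarrow> 'a::unital_cstar_algebra set \<Rightarrow> 'b::unital_cstar_algebra set \<Rightarrow> ('a \<Rightarrow> 'b) \<Rightarrow> bool" where
  "n_order_isomorphism m S T f \<longleftrightarrow>
     linear_map_on S f \<and> f 1 = 1 \<and> bij_betw f S T \<and>
     n_positive_on m S f \<and> n_positive_on m T (inv_into S f)"

definition star_isomorphism ::
    "'a::unital_cstar_algebra set \<Rightarrow> 'b::unital_cstar_algebra set \<Rightarrow> ('a \<Rightarrow> 'b) \<Rightarrow> bool" where
  "star_isomorphism A B f \<longleftrightarrow>
     linear_map_on A f \<and> (\<forall>x\<in>A. \<forall>y\<in>A. f (x * y) = f x * f y) \<and>
     (\<forall>x\<in>A. f (star x) = star (f x)) \<and> bij_betw f A B"

end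

(* A matrix of the form (4 - e) - 2 Re x - 2 Re y with x, y the tensor products of u, v with the
   clock and shift matrices of size n has its entries in the operator system of u, v, so
   n-positivity transfers its positivity from (u', v') to (u, v). Such a gap (after rotating x and
   y by phases) says that a point of the torus is far from the joint spectrum of (x, y). If q were
   not exp (2 pi i k / n), then x' and y' would not commute and there would be a gap at all points,
   which Fejer's kernel evaluated at the commuting unitaries x, y excludes. If q has the right
   value, the same averaging shows that positivity of a Laurent polynomial in the central elements
   u'^n, v'^n passes to u^n, v^n. Averaging over conjugations by u^a v^b extends this to all Laurent
   polynomials, so u' -> u, v' -> v extends to a contractive *-homomorphism of the generated
   C*-algebras. Complete positivity follows since a positive matrix has a square root with entries
   in the generated algebra. *)

theory Submission
  imports Defs
begin

section \<open>Square roots and positive elements\<close>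

text \<open>Everything takes place inside the two algebras, without representations or spectra.
  Columns with entries in the algebra replace Hilbert space vectors, so a squared length is an
  element of the algebra and each estimate is an inequality between elements. A point
  \<open>(cis s, cis t)\<close> of the torus is seen only through the form \<open>Q\<close>, which
  is small on vectors nearly fixed by the rotated operators; being far from the joint spectrum means
  a lower bound \<open>e\<close> for \<open>Q\<close>. The size n comes from the phase, whose order
  is exactly n by coprimality: clock and shift of that size cancel it. The obstacle is that
  n-positivity gives no direct access to functions other than these gaps. Fejer's kernel fits
  because its values are squared lengths \<open>nn (wave ...)\<close>, to which a gap applies. What
  is recovered this way concerns only exponents divisible by n, where the matrix factors disappear.
  The step to all exponents needs no exact formula: it is enough that a positive element is
  dominated by its unnormalised average. The argument runs in one direction, from gaps of one pair
  to gaps of the other; an order isomorphism allows it to be run both ways.\<close>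

lemma scaleC_one: "1 *\<^sub>C (x::'a::unital_cstar_algebra) = x"
  using scaleR_scaleC[of 1 x] by simp

lemma scaleC_zero_left [simp]: "0 *\<^sub>C (x::'a::unital_cstar_algebra) = 0"
  using scaleR_scaleC[of 0 x] by simp

lemma scaleC_zero_right [simp]: "c *\<^sub>C (0::'a::unital_cstar_algebra) = 0"
  using scaleC_add_right[of c 0 0] by simp

lemma scaleC_minus_left: "(- c) *\<^sub>C (x::'a::unital_cstar_algebra) = - (c *\<^sub>C x)"
  using scaleC_add_left[of c "-c" x] by (simp add: eq_neg_iff_add_eq_0 add.commute)

lemma scaleC_minus_right: "c *\<^sub>C (- x::'a::unital_cstar_algebra) = - (c *\<^sub>C x)"
  using scaleC_add_right[of c x "-x"] by (simp add: eq_neg_iff_add_eq_0 add.commute)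

lemma scaleC_diff_right: "c *\<^sub>C (x - y::'a::unital_cstar_algebra) = c *\<^sub>C x - c *\<^sub>C y"
  using scaleC_add_right[of c x "-y"] by (simp add: scaleC_minus_right)

lemma scaleC_diff_left: "(c - d) *\<^sub>C (x::'a::unital_cstar_algebra) = c *\<^sub>C x - d *\<^sub>C x"
  using scaleC_add_left[of c "-d" x] by (simp add: scaleC_minus_left)

lemma scaleC_sum_right: "c *\<^sub>C (\<Sum>i\<in>I. f i) = (\<Sum>i\<in>I. c *\<^sub>C (f i::'a::unital_cstar_algebra))"
  by (induction I rule: infinite_finite_induct) (auto simp: scaleC_add_right)

lemma scaleC_sum_left: "(\<Sum>i\<in>I. f i) *\<^sub>C (x::'a::unital_cstar_algebra) = (\<Sum>i\<in>I. f i *\<^sub>C x)"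
  by (induction I rule: infinite_finite_induct) (auto simp: scaleC_add_left)

lemma scaleC_scaleR: "c *\<^sub>C (r *\<^sub>R (x::'a::unital_cstar_algebra)) = r *\<^sub>R (c *\<^sub>C x)"
  by (simp add: scaleR_scaleC scaleC_scaleC mult.commute)

lemma bounded_linear_scaleC_right: "bounded_linear (\<lambda>x::'a::unital_cstar_algebra. c *\<^sub>C x)"
  by (rule bounded_linear_intro[where K = "cmod c"])
     (auto simp: scaleC_add_right scaleC_scaleR norm_scaleC)

lemma star_zero [simp]: "star (0::'a::unital_cstar_algebra) = 0"
  using star_add[of "0::'a" 0] by simp

lemma star_one [simp]: "star (1::'a::unital_cstar_algebra) = 1"
  by (metis mult.left_neutral mult.right_neutral star_mult star_star)

lemma star_minus: "star (- x::'a::unital_cstar_algebra) = - star x"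
  using star_add[of x "-x"] by (simp add: eq_neg_iff_add_eq_0 add.commute)

lemma star_diff: "star (x - y::'a::unital_cstar_algebra) = star x - star y"
  using star_add[of x "-y"] by (simp add: star_minus)

lemma star_scaleR: "star (r *\<^sub>R x::'a::unital_cstar_algebra) = r *\<^sub>R star x"
  by (simp add: scaleR_scaleC star_scaleC)

lemma star_sum: "star (\<Sum>i\<in>I. f i) = (\<Sum>i\<in>I. star (f i::'a::unital_cstar_algebra))"
  by (induction I rule: infinite_finite_induct) (auto simp: star_add)

lemma star_power: "star (x ^ n::'a::unital_cstar_algebra) = star x ^ n"
  by (induction n) (auto simp: star_mult power_commutes)

lemmas star_simps = star_add star_diff star_minus star_mult star_scaleR star_scaleC star_star
  star_sum star_power

lemma norm_star [simp]: "norm (star x) = norm (x::'a::unital_cstar_algebra)"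
proof -
  have le: "norm y \<le> norm (star y)" for y :: 'a
  proof (cases "norm y = 0")
    case False
    have "norm y * norm y \<le> norm (star y) * norm y"
      using cstar_identity[of y] norm_mult_ineq[of "star y" y] by (simp add: power2_eq_square)
    with False show ?thesis
      by (metis linorder_not_le mult_le_cancel_right norm_ge_zero order_le_less)
  qed auto
  show ?thesis using le[of x] le[of "star x"] by (simp add: star_star)
qed

lemma bounded_linear_star: "bounded_linear (star :: 'a::unital_cstar_algebra \<Rightarrow> 'a)"
  by (rule bounded_linear_intro[where K = 1]) (auto simp: star_add star_scaleR)

lemmas tendsto_star = bounded_linear.tendsto[OF bounded_linear_star]

lemma norm_eq_1_if_isometry:
  assumes "star u * u = (1::'a::unital_cstar_algebra)"
  shows "norm u = 1"
  using cstar_identity[of u] assms by (simp add: power2_eq_1_iff) (smt (verit) norm_ge_zero)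

text \<open>Closed subalgebras record where square roots live. Scalars are real because the
  coefficients of the root series are.\<close>

definition subalgebra :: "'a::real_algebra_1 set \<Rightarrow> bool" where
  "subalgebra S \<longleftrightarrow> 1 \<in> S \<and> (\<forall>x\<in>S. \<forall>y\<in>S. x + y \<in> S \<and> x * y \<in> S) \<and> (\<forall>c. \<forall>x\<in>S. c *\<^sub>R x \<in> S)"

lemma subalgebra_sum:
  assumes "subalgebra S" "\<And>i. i \<in> I \<Longrightarrow> f i \<in> S"
  shows "sum f I \<in> S"
proof -
  have "0 \<in> S" using assms(1) unfolding subalgebra_def by (metis scale_zero_left)
  with assms show ?thesis
    by (induction I rule: infinite_finite_induct) (auto simp: subalgebra_def)
qed

lemma subalgebra_diff: "subalgebra S \<Longrightarrow> x \<in> S \<Longrightarrow> y \<in> S \<Longrightarrow> x - y \<in> S"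
  unfolding subalgebra_def by (metis diff_conv_add_uminus scaleR_minus1_left)

lemma subalgebra_power: "subalgebra S \<Longrightarrow> x \<in> S \<Longrightarrow> x ^ n \<in> S"
  by (induction n) (auto simp: subalgebra_def)

lemma subalgebra_closure:
  fixes S :: "'a::real_normed_algebra_1 set"
  assumes "subalgebra S"
  shows "subalgebra (closure S)"
  unfolding subalgebra_def
proof (intro conjI ballI allI)
  show "1 \<in> closure S" using assms closure_subset unfolding subalgebra_def by blast
next
  fix x y assume "x \<in> closure S" "y \<in> closure S"
  then obtain a b where ab: "\<And>n. a n \<in> S" "a \<longlonglongrightarrow> x" "\<And>n. b n \<in> S" "b \<longlonglongrightarrow> y"
    unfolding closure_sequential by blast
  have "(\<lambda>n. a n + b n) \<longlonglongrightarrow> x + y" "(\<lambda>n. a n * b n) \<longlonglongrightarrow> x * y"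
    using ab by (auto intro: tendsto_intros)
  moreover have "a n + b n \<in> S" "a n * b n \<in> S" for n
    using ab assms unfolding subalgebra_def by auto
  ultimately show "x + y \<in> closure S" "x * y \<in> closure S"
    unfolding closure_sequential
    by (metis (no_types, lifting))+
next
  fix c x assume "x \<in> closure S"
  then obtain a where ab: "\<And>n. a n \<in> S" "a \<longlonglongrightarrow> x"
    unfolding closure_sequential by blast
  have "(\<lambda>n. c *\<^sub>R a n) \<longlonglongrightarrow> c *\<^sub>R x" using ab by (auto intro: tendsto_intros)
  moreover have "c *\<^sub>R a n \<in> S" for n using ab assms unfolding subalgebra_def by auto
  ultimately show "c *\<^sub>R x \<in> closure S"
    unfolding closure_sequential by (metis (no_types, lifting))
qed

section \<open>Taylor coefficients of sqrt (1 - x) and their absolute summability\<close>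

definition sqrt_coeff :: "nat \<Rightarrow> real" where
  "sqrt_coeff k = (1 / 2 gchoose k) * (- 1) ^ k"

lemma sqrt_coeff_0 [simp]: "sqrt_coeff 0 = 1"
  by (simp add: sqrt_coeff_def)

lemma gbinomial_Suc_eq: "(a gchoose Suc k :: real) = (a gchoose k) * (a - real k) / (real k + 1)"
proof -
  have "(real k + 1) * (a gchoose Suc k) = (a - real k) * (a gchoose k)"
    using gbinomial_mult_1[of a k] by (simp add: algebra_simps)
  thus ?thesis by (simp add: eq_divide_eq mult_ac)
qed

lemma sqrt_coeff_Suc: "sqrt_coeff (Suc k) = sqrt_coeff k * (real k - 1 / 2) / (real k + 1)"
  by (simp add: sqrt_coeff_def gbinomial_Suc_eq[of "1/2" k] field_simps)

lemma sqrt_coeff_nonpos: "sqrt_coeff (Suc k) \<le> 0"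
proof (induction k)
  case (Suc k)
  thus ?case by (subst sqrt_coeff_Suc) (auto intro!: divide_nonpos_nonneg mult_nonpos_nonneg)
qed (simp add: sqrt_coeff_Suc)

text \<open>Partial sums of the coefficients of the power 1/2 of \<open>1 - x\<close> are the
  coefficients of its quotient by \<open>1 - x\<close>, that is of the power -1/2, and these are
  nonnegative.\<close>

lemma sum_sqrt_coeff_nonneg: "(\<Sum>k\<le>m. sqrt_coeff k) \<ge> 0"
proof -
  have "0 \<le> (- 1 / 2 gchoose m) * (- 1 :: real) ^ m" for m
  proof (induction m)
    case (Suc m)
    have "(- 1 / 2 gchoose Suc m) * (- 1 :: real) ^ Suc m =
      (- 1 / 2 gchoose m) * (- 1) ^ m * ((1 / 2 + real m) / (real m + 1))"
      by (subst gbinomial_Suc_eq) (simp add: field_simps)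
    with Suc show ?case by simp
  qed auto
  thus ?thesis
    using gbinomial_sum_lower_neg[of "1/2::real" m] by (simp add: sqrt_coeff_def mult.commute)
qed

text \<open>All coefficients after the constant 1 are nonpositive, so the absolute sum is 1 minus a
  partial sum. This yields absolute convergence even for arguments of norm exactly 1, and the value
  1 is the constant in \<open>norm_one_minus_sqrt_series\<close>.\<close>

lemma sum_abs_sqrt_coeff: "(\<Sum>k<m. \<bar>sqrt_coeff (Suc k)\<bar>) \<le> 1"
proof -
  have "(\<Sum>k<m. \<bar>sqrt_coeff (Suc k)\<bar>) = - (\<Sum>k<m. sqrt_coeff (Suc k))"
    using sqrt_coeff_nonpos by (simp add: sum_negf[symmetric] abs_of_nonpos)
  also have "\<dots> = 1 - (\<Sum>k\<le>m. sqrt_coeff k)"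
    by (subst sum.atMost_shift) simp
  finally show ?thesis using sum_sqrt_coeff_nonneg[of m] by simp
qed

lemma summable_abs_sqrt_coeff_Suc: "summable (\<lambda>k. \<bar>sqrt_coeff (Suc k)\<bar>)"
  by (rule summableI_nonneg_bounded[where x = 1]) (auto simp: sum_abs_sqrt_coeff)

lemma suminf_abs_sqrt_coeff_Suc: "(\<Sum>k. \<bar>sqrt_coeff (Suc k)\<bar>) \<le> 1"
  by (rule suminf_le_const[OF summable_abs_sqrt_coeff_Suc]) (rule sum_abs_sqrt_coeff)

lemma summable_abs_sqrt_coeff: "summable (\<lambda>k. \<bar>sqrt_coeff k\<bar>)"
  using summable_abs_sqrt_coeff_Suc by (subst (asm) summable_Suc_iff)

text \<open>Vandermonde's convolution for 1/2 + 1/2 = 1: the square of the series is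
  \<open>1 - x\<close>.\<close>

lemma sqrt_coeff_convolution:
  "(\<Sum>i\<le>k. sqrt_coeff i * sqrt_coeff (k - i)) = (if k = 0 then 1 else if k = 1 then - 1 else 0)"
proof -
  have "(\<Sum>i\<le>k. sqrt_coeff i * sqrt_coeff (k - i)) =
        (\<Sum>i\<le>k. (1 / 2 gchoose i) * (1 / 2 gchoose (k - i)) * (- 1) ^ k)"
    by (rule sum.cong) (auto simp: sqrt_coeff_def power_add[symmetric] mult_ac)
  also have "\<dots> = (1 gchoose k) * (- 1) ^ k"
    using gbinomial_Vandermonde[of "1/2::real" "1/2" k]
    by (simp add: sum_distrib_right[symmetric] atMost_atLeast0)
  also have "(1 gchoose k :: real) = of_nat (1 choose k)"
    by (metis of_nat_1 binomial_gbinomial)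
  also have "(1 choose k) = (if k \<le> 1 then 1 else 0)"
    by (cases k) (auto simp: binomial_eq_0)
  finally show ?thesis by auto
qed

text \<open>For self-adjoint \<open>a\<close> the norm condition says that the spectrum lies in the
  interval from 0 to 2 t. In this form sums of positive elements are positive by the triangle
  inequality, and for t > 0 the element \<open>1 - a / t\<close> lies in the unit ball, where the
  root series converges.\<close>

definition pos :: "'a::unital_cstar_algebra \<Rightarrow> bool" where
  "pos a \<longleftrightarrow> star a = a \<and> (\<exists>t::real. norm (t *\<^sub>R 1 - a) \<le> t)"

lemma pos_selfadjoint: "pos a \<Longrightarrow> star a = a"
  by (simp add: pos_def)

lemma pos_zero [simp]: "pos 0" by (auto simp: pos_def intro: exI[of _ 0])

lemma pos_add: assumes "pos a" "pos b" shows "pos (a + b)"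
proof -
  obtain s t where "norm (s *\<^sub>R 1 - a) \<le> s" "norm (t *\<^sub>R 1 - b) \<le> t"
    using assms by (auto simp: pos_def)
  hence "norm ((s + t) *\<^sub>R 1 - (a + b)) \<le> s + t"
    using norm_triangle_ineq[of "s *\<^sub>R 1 - a" "t *\<^sub>R 1 - b"] by (simp add: algebra_simps)
  thus ?thesis using assms unfolding pos_def by (auto simp: star_add)
qed

lemma pos_scaleR: assumes "pos a" "r \<ge> 0" shows "pos (r *\<^sub>R a)"
proof -
  obtain s where "norm (s *\<^sub>R 1 - a) \<le> s" using assms by (auto simp: pos_def)
  hence "norm ((r * s) *\<^sub>R 1 - r *\<^sub>R a) \<le> r * s"
    using assms by (metis abs_of_nonneg mult_left_mono norm_scaleR real_vector.scale_right_diff_distrib scaleR_scaleR)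
  thus ?thesis using assms unfolding pos_def by (auto simp: star_scaleR)
qed

lemma pos_one [simp]: "pos 1" by (auto simp: pos_def intro: exI[of _ 1])

lemma pos_sum: "(\<And>i. i \<in> I \<Longrightarrow> pos (f i)) \<Longrightarrow> pos (sum f I)"
  by (induction I rule: infinite_finite_induct) (auto simp: pos_add)

section \<open>Square roots of positive elements by the power series\<close>

definition sqrt_series :: "'a::unital_cstar_algebra \<Rightarrow> 'a" where
  "sqrt_series x = (\<Sum>k. sqrt_coeff k *\<^sub>R x ^ k)"

lemma summable_sqrt_series:
  fixes x :: "'a::unital_cstar_algebra"
  assumes "norm x \<le> 1"
  shows "summable (\<lambda>k. norm (sqrt_coeff k *\<^sub>R x ^ k))"
proof (rule summable_comparison_test[OF _ summable_abs_sqrt_coeff], intro exI allI impI)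
  fix n
  have "norm (x ^ n) \<le> 1" using norm_power_ineq[of x n] power_le_one[of "norm x" n] assms by simp
  thus "norm (norm (sqrt_coeff n *\<^sub>R x ^ n)) \<le> \<bar>sqrt_coeff n\<bar>"
    by (simp add: mult_left_le)
qed

lemma sqrt_series_sums:
  fixes x :: "'a::unital_cstar_algebra"
  assumes "norm x \<le> 1"
  shows "(\<lambda>k. sqrt_coeff k *\<^sub>R x ^ k) sums sqrt_series x"
  unfolding sqrt_series_def using summable_norm_cancel[OF summable_sqrt_series[OF assms]]
  by (rule summable_sums)

lemma sqrt_series_square:
  fixes x :: "'a::unital_cstar_algebra"
  assumes "norm x \<le> 1"
  shows "sqrt_series x * sqrt_series x = 1 - x"
proof -
  have "(\<lambda>k. \<Sum>i\<le>k. (sqrt_coeff i *\<^sub>R x ^ i) * (sqrt_coeff (k - i) *\<^sub>R x ^ (k - i)))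
          sums (sqrt_series x * sqrt_series x)"
    unfolding sqrt_series_def
    by (rule Cauchy_product_sums) (use summable_sqrt_series[OF assms] in auto)
  also have "(\<lambda>k. \<Sum>i\<le>k. (sqrt_coeff i *\<^sub>R x ^ i) * (sqrt_coeff (k - i) *\<^sub>R x ^ (k - i))) =
    (\<lambda>k. (if k = 0 then 1 else if k = 1 then - 1 else 0) *\<^sub>R x ^ k)"
  proof
    fix k
    have "(\<Sum>i\<le>k. (sqrt_coeff i *\<^sub>R x ^ i) * (sqrt_coeff (k - i) *\<^sub>R x ^ (k - i))) =
      (\<Sum>i\<le>k. sqrt_coeff i * sqrt_coeff (k - i)) *\<^sub>R x ^ k"
      unfolding scaleR_sum_left by (rule sum.cong) (auto simp: power_add[symmetric])
    thus "(\<Sum>i\<le>k. (sqrt_coeff i *\<^sub>R x ^ i) * (sqrt_coeff (k - i) *\<^sub>R x ^ (k - i))) =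
      (if k = 0 then 1 else if k = 1 then - 1 else 0) *\<^sub>R x ^ k"
      by (simp add: sqrt_coeff_convolution)
  qed
  finally have *: "(\<lambda>k. (if k = 0 then 1 else if k = 1 then - 1 else (0::real)) *\<^sub>R x ^ k)
      sums (sqrt_series x * sqrt_series x)" .
  have "(\<lambda>k. (if k = 0 then 1 else if k = 1 then - 1 else (0::real)) *\<^sub>R x ^ k) sums
    (\<Sum>k\<in>{0,1}. (if k = 0 then 1 else if k = 1 then - 1 else (0::real)) *\<^sub>R x ^ k)"
    by (rule sums_finite) auto
  from sums_unique2[OF * this] show ?thesis by simp
qed

lemma sqrt_series_star:
  fixes x :: "'a::unital_cstar_algebra"
  assumes "norm x \<le> 1" "star x = x"
  shows "star (sqrt_series x) = sqrt_series x"
proof -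
  have "(\<lambda>k. star (sqrt_coeff k *\<^sub>R x ^ k)) sums star (sqrt_series x)"
    using bounded_linear.sums[OF bounded_linear_star sqrt_series_sums[OF assms(1)]] .
  hence "(\<lambda>k. sqrt_coeff k *\<^sub>R x ^ k) sums star (sqrt_series x)"
    using assms by (simp add: star_simps)
  thus ?thesis using sqrt_series_sums[OF assms(1)] sums_unique2 by blast
qed

lemma sqrt_series_commute:
  fixes x :: "'a::unital_cstar_algebra"
  assumes "norm x \<le> 1" "x * b = b * x"
  shows "sqrt_series x * b = b * sqrt_series x"
proof -
  have "x ^ k * b = b * x ^ k" for k
    using power_commuting_commutes[OF assms(2)] by simp
  hence "(\<lambda>k. sqrt_coeff k *\<^sub>R x ^ k * b) = (\<lambda>k. b * (sqrt_coeff k *\<^sub>R x ^ k))" by auto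
  thus ?thesis
    using sums_mult2[OF sqrt_series_sums[OF assms(1)], of b]
      sums_mult[OF sqrt_series_sums[OF assms(1)], of b] sums_unique2 by metis
qed

lemma sqrt_series_mem:
  fixes x :: "'a::unital_cstar_algebra"
  assumes "norm x \<le> 1" "subalgebra S" "closed S" "x \<in> S"
  shows "sqrt_series x \<in> S"
proof -
  have "(\<Sum>k<m. sqrt_coeff k *\<^sub>R x ^ k) \<in> S" for m
    using assms subalgebra_power[OF assms(2,4)]
    by (intro subalgebra_sum) (auto simp: subalgebra_def)
  thus ?thesis
    using sqrt_series_sums[OF assms(1)] assms(3) unfolding sums_def closed_sequential_limits
    by (metis (no_types, lifting))
qed

text \<open>The constant term cancels and the remaining coefficients have absolute sum at most 1.
  This is the norm condition of \<open>pos\<close> for the root, with t = 1.\<close>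

lemma norm_one_minus_sqrt_series:
  fixes x :: "'a::unital_cstar_algebra"
  assumes "norm x \<le> 1"
  shows "norm (1 - sqrt_series x) \<le> 1"
proof -
  let ?f = "\<lambda>k. sqrt_coeff (Suc k) *\<^sub>R x ^ Suc k"
  have "?f sums (sqrt_series x - sqrt_coeff 0 *\<^sub>R x ^ 0)"
    using sqrt_series_sums[OF assms] by (subst sums_Suc_iff) auto
  hence eq: "sqrt_series x - 1 = suminf ?f" by (simp add: sums_iff)
  have le: "norm (?f k) \<le> \<bar>sqrt_coeff (Suc k)\<bar>" for k
  proof -
    have "norm (x ^ Suc k) \<le> 1"
      using norm_power_ineq[of x "Suc k"] power_le_one[of "norm x" "Suc k"] assms by simp
    thus ?thesis by (simp add: mult_left_le del: power_Suc)
  qed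
  have "norm (sqrt_series x - 1) \<le> (\<Sum>k. \<bar>sqrt_coeff (Suc k)\<bar>)"
    unfolding eq by (rule norm_suminf_le[OF le summable_abs_sqrt_coeff_Suc])
  thus ?thesis using suminf_abs_sqrt_coeff_Suc by (simp add: norm_minus_commute)
qed

text \<open>The series is applied to \<open>x = 1 - a / t\<close>. The root is a limit of real
  polynomials in \<open>a\<close>, whence the clauses on commutation and membership.\<close>

lemma pos_sqrt_exists:
  assumes "pos (a::'a::unital_cstar_algebra)"
  shows "\<exists>h. pos h \<and> h * h = a \<and> (\<forall>b. a * b = b * a \<longrightarrow> h * b = b * h) \<and>
    (\<forall>S. subalgebra S \<longrightarrow> closed S \<longrightarrow> a \<in> S \<longrightarrow> h \<in> S)"
proof -
  obtain t0 where t0: "norm (t0 *\<^sub>R 1 - a) \<le> t0" and sa: "star a = a"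
    using assms by (auto simp: pos_def)
  \<comment> \<open>\<open>t0\<close> may be 0; the bound survives adding 1, and \<open>t\<close>
    can be divided by.\<close>
  define t where "t = t0 + 1"
  have t0': "t0 \<ge> 0" using t0 norm_ge_zero order_trans by blast
  have t: "t > 0" using t0' by (simp add: t_def)
  have nt: "norm (t *\<^sub>R 1 - a) \<le> t"
    using norm_triangle_ineq[of "t0 *\<^sub>R 1 - a" 1] t0 by (simp add: t_def algebra_simps)
  define x where "x = 1 - (1 / t) *\<^sub>R a"
  have "x = (1 / t) *\<^sub>R (t *\<^sub>R 1 - a)" using t by (simp add: x_def algebra_simps)
  hence "norm x = norm ((1 / t) *\<^sub>R (t *\<^sub>R 1 - a))" by (rule arg_cong)
  hence "norm x = norm (t *\<^sub>R 1 - a) / t" using t by (subst (asm) norm_scaleR) simp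
  hence nx: "norm x \<le> 1" using nt t by simp
  have sx: "star x = x" by (simp add: x_def star_simps sa)
  define h where "h = sqrt t *\<^sub>R sqrt_series x"
  show ?thesis
  proof (intro exI conjI allI impI)
    have "norm (sqrt t *\<^sub>R 1 - h) = norm (sqrt t *\<^sub>R (1 - sqrt_series x))"
      by (simp add: h_def algebra_simps)
    also have "\<dots> = sqrt t * norm (1 - sqrt_series x)" using t by simp
    also have "\<dots> \<le> sqrt t" using norm_one_minus_sqrt_series[OF nx] t
      by (intro mult_left_le) auto
    finally show "pos h" unfolding pos_def
      using sqrt_series_star[OF nx sx] by (auto simp: h_def star_simps)
    have "h * h = t *\<^sub>R (sqrt_series x * sqrt_series x)" using t by (simp add: h_def)
    thus "h * h = a" using t unfolding sqrt_series_square[OF nx] by (simp add: x_def)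
    show "h * b = b * h" if "a * b = b * a" for b
      using sqrt_series_commute[OF nx, of b] that by (simp add: h_def x_def algebra_simps)
    show "h \<in> S" if S: "subalgebra S" "closed S" "a \<in> S" for S
    proof -
      have "x \<in> S" unfolding x_def using S by (intro subalgebra_diff) (auto simp: subalgebra_def)
      from sqrt_series_mem[OF nx S(1,2) this] S(1) show ?thesis by (simp add: h_def subalgebra_def)
    qed
  qed
qed

text \<open>These identities produce multiples of unitaries from two commuting square roots; real
  and imaginary parts of such elements are then bounded by means of the C*-identity.\<close>

lemma
  fixes k l :: "'a::unital_cstar_algebra"
  assumes "star k = k" "star l = l" "k * l = l * k"
  shows star_mult_cartesian: "star (k + \<i> *\<^sub>C l) * (k + \<i> *\<^sub>C l) = k * k + l * l"
    and square_cartesian: "(k + \<i> *\<^sub>C l) * (k + \<i> *\<^sub>C l) + star ((k + \<i> *\<^sub>C l) * (k + \<i> *\<^sub>C l))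
      = 2 *\<^sub>R (k * k - l * l)"
proof -
  note s = star_simps assms(1,2) distrib_left distrib_right left_diff_distrib right_diff_distrib
    mult_scaleC_left mult_scaleC_right scaleC_scaleC scaleC_minus_left scaleC_one assms(3)
    scaleC_add_right scaleC_diff_right complex_cnj_i mult_minus_left mult_minus_right i_squared minus_minus
  show "star (k + \<i> *\<^sub>C l) * (k + \<i> *\<^sub>C l) = k * k + l * l"
    by (simp add: s)
  show "(k + \<i> *\<^sub>C l) * (k + \<i> *\<^sub>C l) + star ((k + \<i> *\<^sub>C l) * (k + \<i> *\<^sub>C l))
      = 2 *\<^sub>R (k * k - l * l)"
    by (simp add: s scaleR_2)
qed

definition psqrt :: "'a::unital_cstar_algebra \<Rightarrow> 'a" where
  "psqrt a = (SOME h. pos h \<and> h * h = a \<and> (\<forall>b. a * b = b * a \<longrightarrow> h * b = b * h) \<and>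
    (\<forall>S. subalgebra S \<longrightarrow> closed S \<longrightarrow> a \<in> S \<longrightarrow> h \<in> S))"

lemma
  assumes "pos a"
  shows pos_psqrt: "pos (psqrt a)"
    and psqrt_square: "psqrt a * psqrt a = a"
    and psqrt_commute: "a * b = b * a \<Longrightarrow> psqrt a * b = b * psqrt a"
    and psqrt_mem: "subalgebra S \<Longrightarrow> closed S \<Longrightarrow> a \<in> S \<Longrightarrow> psqrt a \<in> S"
  using someI_ex[OF pos_sqrt_exists[OF assms]] unfolding psqrt_def[symmetric] by simp_all

text \<open>If \<open>h\<close> is a self-adjoint contraction and \<open>s = sqrt (1 - h\<^sup>2)\<close>, then \<open>h + \<i> s\<close> is unitary,
  so its imaginary part \<open>s\<close> is a contraction.\<close>

lemma norm_one_minus_square: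
  fixes h :: "'a::unital_cstar_algebra"
  assumes "star h = h" "norm h \<le> 1"
  shows "norm (1 - h * h) \<le> 1"
proof -
  have n: "norm (h * h) \<le> 1" using cstar_identity[of h] assms by (simp add: power_le_one)
  define s where "s = sqrt_series (h * h)"
  have ss: "s * s = 1 - h * h" using sqrt_series_square[OF n] by (simp add: s_def)
  have sa: "star s = s" using sqrt_series_star[OF n] assms by (simp add: s_def star_simps)
  have sh: "s * h = h * s" using sqrt_series_commute[OF n, of h] by (simp add: s_def mult.assoc)
  define w where "w = h + \<i> *\<^sub>C s"
  have ww: "star w * w = 1"
    using star_mult_cartesian[of h s] ss sh sa assms by (simp add: w_def)
  have nw: "norm w = 1" by (rule norm_eq_1_if_isometry[OF ww])
  have "2 *\<^sub>R s = (- \<i>) *\<^sub>C (w - star w)"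
    by (simp add: w_def star_simps assms sa scaleC_diff_right scaleC_scaleC scaleC_minus_left scaleC_add_right
        scaleC_minus_right scaleC_one scaleR_2)
  hence "norm (2 *\<^sub>R s) = norm (w - star w)" by (simp add: norm_scaleC)
  also have "\<dots> \<le> 2" using norm_triangle_ineq4[of w "star w"] nw by simp
  finally have "norm s \<le> 1" by simp
  thus ?thesis using cstar_identity[of s] sa ss by (simp add: power_le_one)
qed

lemma norm_minus_square:
  fixes h :: "'a::unital_cstar_algebra"
  assumes "star h = h"
  shows "norm (norm (h * h) *\<^sub>R 1 - h * h) \<le> norm (h * h)"
proof (cases "h = 0")
  case False
  let ?g = "(1 / norm h) *\<^sub>R h"
  have "norm (1 - ?g * ?g) \<le> 1"
    by (rule norm_one_minus_square) (use False assms in \<open>auto simp: star_simps\<close>)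
  moreover have hh: "norm (h * h) = norm h * norm h"
    using cstar_identity[of h] assms by (simp add: power2_eq_square)
  moreover have "norm (h * h) *\<^sub>R 1 - h * h = norm (h * h) *\<^sub>R (1 - ?g * ?g)"
    using False hh by (simp add: algebra_simps)
  ultimately show ?thesis by (metis mult_left_le norm_ge_zero norm_scaleR abs_norm_cancel)
qed auto

lemma pos_square: "star h = h \<Longrightarrow> pos (h * h)"
  using norm_minus_square by (auto simp: pos_def star_simps)

text \<open>Writing \<open>a\<close> as the square of its root shows that the free \<open>t\<close>
  in \<open>pos\<close> can be taken to be \<open>norm a\<close>. This choice depends continuously
  on \<open>a\<close>, so limits of positive elements are positive.\<close>

lemma pos_iff_norm: "pos a \<longleftrightarrow> star a = a \<and> norm (norm a *\<^sub>R 1 - a) \<le> norm a"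
proof
  assume "pos a"
  thus "star a = a \<and> norm (norm a *\<^sub>R 1 - a) \<le> norm a"
    using norm_minus_square[of "psqrt a"] pos_selfadjoint[of a] pos_selfadjoint[of "psqrt a"]
    by (simp add: pos_psqrt psqrt_square)
qed (auto simp: pos_def)

lemma pos_LIMSEQ:
  fixes a :: "nat \<Rightarrow> 'a::unital_cstar_algebra"
  assumes "a \<longlonglongrightarrow> l" "\<And>n. pos (a n)"
  shows "pos l"
proof -
  have "star l = l"
  proof (rule LIMSEQ_unique[OF _ assms(1)])
    have "(\<lambda>n. star (a n)) = a" using assms(2) pos_selfadjoint by blast
    thus "a \<longlonglongrightarrow> star l" using tendsto_star[OF assms(1)] by simp
  qed
  moreover have "(\<lambda>n. norm (norm (a n) *\<^sub>R 1 - a n)) \<longlonglongrightarrow> norm (norm l *\<^sub>R 1 - l)"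
    "(\<lambda>n. norm (a n)) \<longlonglongrightarrow> norm l"
    using assms(1) by (auto intro!: tendsto_intros)
  hence "norm (norm l *\<^sub>R 1 - l) \<le> norm l"
    by (rule LIMSEQ_le) (use assms(2) pos_iff_norm in blast)
  ultimately show ?thesis by (simp add: pos_iff_norm)
qed

text \<open>With \<open>k\<^sup>2 = \<beta> - a\<close> and \<open>l\<^sup>2 = \<beta> + a\<close> the element \<open>w = (k + \<i> l) / sqrt (2 \<beta>)\<close> is
  unitary and \<open>- a / \<beta>\<close> is the real part of \<open>w\<^sup>2\<close>.\<close>

lemma norm_le_if_pos_pos:
  fixes a :: "'a::unital_cstar_algebra"
  assumes "star a = a" "pos (\<beta> *\<^sub>R 1 - a)" "pos (\<beta> *\<^sub>R 1 + a)" "\<beta> > 0"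
  shows "norm a \<le> \<beta>"
proof -
  define k l where k_def: "k = psqrt (\<beta> *\<^sub>R 1 - a)" and l_def: "l = psqrt (\<beta> *\<^sub>R 1 + a)"
  note k = pos_psqrt[OF assms(2), folded k_def l_def] psqrt_square[OF assms(2), folded k_def l_def]
    psqrt_commute[OF assms(2), folded k_def l_def]
  note l = pos_psqrt[OF assms(3), folded k_def l_def] psqrt_square[OF assms(3), folded k_def l_def]
    psqrt_commute[OF assms(3), folded k_def l_def]
  have "k * a = a * k" by (rule k(3)) (simp add: algebra_simps)
  hence lk: "l * k = k * l" by (intro l(3)) (simp add: algebra_simps)
  have sk: "star k = k" "star l = l" using k(1) l(1) by (simp_all add: pos_selfadjoint)
  define w where "w = k + \<i> *\<^sub>C l"
  have ww: "star w * w = (2 * \<beta>) *\<^sub>R 1"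
    unfolding w_def star_mult_cartesian[OF sk lk[symmetric]] k(2) l(2)
    by (simp add: scaleR_left.add[of \<beta> \<beta>, symmetric])
  have nw: "(norm w)\<^sup>2 = 2 * \<beta>" using cstar_identity[of w] ww assms(4) by simp
  have "(- 4) *\<^sub>R a = w * w + star (w * w)"
  proof -
    have "k * k - l * l = (- 2) *\<^sub>R a" by (simp add: k(2) l(2) scaleR_2)
    thus ?thesis using square_cartesian[OF sk lk[symmetric]] by (simp add: w_def)
  qed
  hence "4 * norm a = norm (w * w + star (w * w))" by (metis abs_neg_numeral norm_scaleR)
  also have "\<dots> \<le> 2 * norm (w * w)" using norm_triangle_ineq[of "w*w" "star (w*w)"] by simp
  also have "\<dots> \<le> 2 * (norm w)\<^sup>2" using norm_mult_ineq[of w w] by (simp add: power2_eq_square)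
  finally show ?thesis using nw by simp
qed

text \<open>The root \<open>h\<close> of \<open>d\<close> commutes with \<open>z\<close>, so the
  product is the square of the self-adjoint \<open>h * z\<close>. The conjugation rule without
  commutation comes later, since it rests on \<open>pos_star_mult\<close>, whose proof uses this
  case.\<close>

lemma pos_commute_conj:
  fixes z :: "'a::unital_cstar_algebra"
  assumes "pos d" "star z = z" "d * z = z * d"
  shows "pos (z * z * d)"
proof -
  let ?h = "psqrt d"
  have hz: "?h * z = z * ?h" by (rule psqrt_commute[OF assms(1,3)])
  have "star (?h * z) = ?h * z"
    using hz assms by (simp add: star_mult pos_selfadjoint pos_psqrt)
  from pos_square[OF this] have "pos (z * (?h * ?h) * z)" by (simp add: hz mult.assoc)
  thus ?thesis using assms by (simp add: psqrt_square mult.assoc)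
qed

lemma pos_of_real_iff: "pos (r *\<^sub>R (1::'a::unital_cstar_algebra)) \<longleftrightarrow> r \<ge> 0"
proof
  assume "pos (r *\<^sub>R (1::'a))"
  hence "norm (\<bar>r\<bar> *\<^sub>R (1::'a) - r *\<^sub>R 1) \<le> \<bar>r\<bar>" by (auto simp: pos_iff_norm)
  hence "\<bar>\<bar>r\<bar> - r\<bar> \<le> \<bar>r\<bar>"
    by (metis norm_scaleR norm_one mult.right_neutral scaleR_left_diff_distrib)
  thus "r \<ge> 0" by auto
qed (auto intro: pos_scaleR)

lemma pos_norm_minus: "star a = a \<Longrightarrow> pos (norm a *\<^sub>R 1 - a)"
  unfolding pos_def by (auto simp: star_simps intro!: exI[of _ "norm a"])

lemma pos_bound_minus:
  assumes "star a = a" "norm a \<le> r"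
  shows "pos (r *\<^sub>R 1 - a)"
proof -
  have "pos ((r - norm a) *\<^sub>R 1 + (norm a *\<^sub>R 1 - a))"
    using assms by (intro pos_add pos_norm_minus) (auto simp: pos_of_real_iff)
  thus ?thesis by (simp add: algebra_simps)
qed

lemma norm_one_minus_pos:
  assumes "pos a" "norm a \<le> 1"
  shows "norm (1 - a) \<le> 1"
proof -
  have "norm ((1 - norm a) *\<^sub>R 1 + (norm a *\<^sub>R 1 - a)) \<le> (1 - norm a) + norm a"
    using assms by (intro norm_triangle_le add_mono) (auto simp: pos_iff_norm)
  thus ?thesis by (simp add: algebra_simps)
qed

lemma norm_le_if_pos_diff:
  assumes "pos a" "pos (\<beta> *\<^sub>R 1 - a)"
  shows "norm (a::'a::unital_cstar_algebra) \<le> \<beta>"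
\<comment> \<open>The slack \<open>e\<close> covers the case that the bound is 0, which
  \<open>norm_le_if_pos_pos\<close> excludes.\<close>
proof (rule field_le_epsilon)
  fix e :: real assume e: "e > 0"
  have "pos (a + (\<beta> *\<^sub>R 1 - a))" using assms by (rule pos_add)
  hence "\<beta> \<ge> 0" by (simp add: pos_of_real_iff)
  moreover have "pos ((\<beta> *\<^sub>R 1 - a) + e *\<^sub>R 1)" "pos ((\<beta> + e) *\<^sub>R 1 + a)"
    using assms e \<open>\<beta> \<ge> 0\<close> by (auto intro!: pos_add simp: pos_of_real_iff)
  ultimately show "norm a \<le> \<beta> + e"
    using e pos_selfadjoint[OF assms(1)]
    by (intro norm_le_if_pos_pos) (auto simp: algebra_simps)
qed

lemma pos_antisym:
  assumes "pos a" "pos (- a)"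
  shows "a = (0::'a::unital_cstar_algebra)"
  using norm_le_if_pos_diff[of a 0] assms by simp

text \<open>Bernoulli's inequality multiplied by \<open>c = z * z\<close>. If \<open>D N\<close> is
  the element in question, then \<open>D (N + 1) = D N + c * D N + N c^3\<close>, a sum of positive
  elements.\<close>

lemma pos_one_plus_power:
  fixes z :: "'a::unital_cstar_algebra"
  assumes "star z = z"
  shows "pos ((1 + z * z) ^ N * (z * z) - z * z - real N *\<^sub>R (z * z * (z * z)))"
proof (induction N)
  case (Suc N)
  let ?c = "z * z"
  let ?d = "(1 + ?c) ^ N * ?c - ?c - real N *\<^sub>R (?c * ?c)"
  have "(1 + ?c) * z = z * (1 + ?c)" by (simp add: algebra_simps)
  hence "(1 + ?c) ^ N * z = z * (1 + ?c) ^ N"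
    by (rule power_commuting_commutes)
  hence *: "(1 + ?c) ^ N * (z * x) = z * ((1 + ?c) ^ N * x)" for x
    by (simp add: mult.assoc[symmetric])
  have "?d * z = z * ?d"
    using * by (simp add: left_diff_distrib right_diff_distrib mult.assoc)
  hence "pos (?c * ?d)" using Suc assms by (intro pos_commute_conj) auto
  moreover have "pos (real N *\<^sub>R (z * z * z * (z * z * z)))"
    using assms by (intro pos_scaleR pos_square) (simp_all add: star_mult mult.assoc)
  ultimately have "pos (?d + ?c * ?d + real N *\<^sub>R (z * z * z * (z * z * z)))"
    using Suc by (intro pos_add)
  also have "?d + ?c * ?d + real N *\<^sub>R (z * z * z * (z * z * z)) =
    (1 + ?c) ^ Suc N * ?c - ?c - real (Suc N) *\<^sub>R (?c * ?c)"
    by (simp add: algebra_simps)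
  finally show ?case .
qed simp

text \<open>Since \<open>t t\<^sup>* = (t t\<^sup>* + t\<^sup>* t) + z\<^sup>2\<close> is positive, the powers of \<open>1 - t t\<^sup>*\<close> stay bounded,
  whereas \<open>t\<^sup>* (1 - t t\<^sup>*)\<^sup>N t = - (1 + z\<^sup>2)\<^sup>N z\<^sup>2\<close> grows with \<open>N\<close>.\<close>

lemma star_mult_neg_square_contraction:
  fixes t :: "'a::unital_cstar_algebra"
  assumes "star z = z" "star t * t = - (z * z)" "norm t \<le> 1"
  shows "z = 0"
proof -
  \<comment> \<open>Real and imaginary parts of \<open>t\<close>; twice the sum of their squares is
    \<open>t * star t + star t * t\<close>.\<close>
  define h k where "h = (1 / 2) *\<^sub>R (t + star t)" and "k = (1 / 2) *\<^sub>R (\<i> *\<^sub>C (star t - t))"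
  have sa: "star h = h" "star k = k"
    by (auto simp: h_def k_def star_simps add.commute scaleC_minus_left scaleC_minus_right[symmetric])
  have hk: "2 *\<^sub>R (h * h + k * k) = t * star t + star t * t"
  proof -
    have "k * k = - ((1 / 4) *\<^sub>R ((star t - t) * (star t - t)))"
      by (simp add: k_def mult_scaleC_left mult_scaleC_right scaleC_scaleC scaleC_scaleR
          scaleC_minus_left scaleC_one)
    hence "2 *\<^sub>R (h * h + k * k) =
      (1 / 2) *\<^sub>R ((t + star t) * (t + star t) - (star t - t) * (star t - t))"
      by (simp add: h_def scaleR_right_diff_distrib)
    also have "(t + star t) * (t + star t) - (star t - t) * (star t - t) =
      2 *\<^sub>R (t * star t + star t * t)"
      by (simp add: algebra_simps scaleR_2)
    finally show ?thesis by simp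
  qed
  have "pos (2 *\<^sub>R (h * h + k * k) + z * z)"
    by (intro pos_add pos_scaleR pos_square sa assms) simp
  hence m: "pos (t * star t)" unfolding hk assms by simp
  have nm: "norm (t * star t) \<le> 1"
    using norm_mult_ineq[of t "star t"] assms(3) by (simp add: mult_le_one order_trans)
  have n1: "norm ((1 - t * star t) ^ N) \<le> 1" for N
    using norm_power_ineq[of "1 - t * star t" N] norm_one_minus_pos[OF m nm]
      power_le_one[of "norm (1 - t * star t)" N] by simp
  have push: "star t * (1 - t * star t) ^ N = (1 + z * z) ^ N * star t" for N
  proof (induction N)
    case (Suc N)
    have "star t * (1 - t * star t) = (1 - star t * t) * star t" by (simp add: algebra_simps)
    also have "\<dots> = (1 + z * z) * star t" by (simp add: assms)
    finally have 1: "star t * (1 - t * star t) = (1 + z * z) * star t" .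
    have "star t * (1 - t * star t) ^ Suc N = (1 + z * z) * (star t * (1 - t * star t) ^ N)"
      using 1 by (simp add: mult.assoc[symmetric])
    thus ?case using Suc by (simp add: mult.assoc)
  qed simp
  have bound: "real N * norm (z * z * (z * z)) \<le> 1" for N
  proof -
    let ?X = "(1 + z * z) ^ N * (z * z)"
    have X: "?X = - (star t * (1 - t * star t) ^ N * t)"
      unfolding push by (simp add: mult.assoc assms)
    have "norm ?X = norm (star t * (1 - t * star t) ^ N * t)" by (simp add: X)
    also have "\<dots> \<le> norm (star t) * norm ((1 - t * star t) ^ N) * norm t"
      by (meson mult_right_mono norm_ge_zero norm_mult_ineq order_trans)
    also have "\<dots> \<le> 1 * 1 * 1" using n1[of N] assms(3) by (intro mult_mono) auto
    finally have nX: "norm ?X \<le> 1" by simp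
    have c: "pos (z * z)" using assms(1) by (rule pos_square)
    have "pos (?X - z * z - real N *\<^sub>R (z * z * (z * z)) + z * z)"
      using pos_one_plus_power[OF assms(1)] c by (rule pos_add)
    hence D: "pos (?X - real N *\<^sub>R (z * z * (z * z)))" by simp
    have c2: "pos (real N *\<^sub>R (z * z * (z * z)))"
      using c by (intro pos_scaleR pos_square) (auto simp: pos_selfadjoint)
    have "star ?X = ?X" using pos_selfadjoint[OF pos_add[OF D c2]] by simp
    hence "pos ((1 *\<^sub>R 1 - ?X) + (?X - real N *\<^sub>R (z * z * (z * z))))"
      using nX D by (intro pos_add pos_bound_minus)
    from norm_le_if_pos_diff[of _ 1, OF c2] this show ?thesis by simp
  qed
  have "norm (z * z * (z * z)) = 0"
  proof (rule ccontr)
    assume "norm (z * z * (z * z)) \<noteq> 0"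
    then obtain N where "1 < real N * norm (z * z * (z * z))"
      using reals_Archimedean3[of "norm (z * z * (z * z))"] by auto
    with bound[of N] show False by simp
  qed
  hence "star (z * z) * (z * z) = 0" using assms(1) by (simp add: star_mult)
  hence "z * z = 0" using cstar_identity[of "z * z"] by simp
  thus "z = 0" using cstar_identity[of z] assms by simp
qed

lemma star_mult_neg_square:
  fixes t :: "'a::unital_cstar_algebra"
  assumes "star z = z" "star t * t = - (z * z)"
  shows "z = 0"
proof (cases "t = 0")
  case False
  let ?s = "1 / norm t"
  have "?s *\<^sub>R z = 0"
    by (rule star_mult_neg_square_contraction[of _ "?s *\<^sub>R t"])
       (use False assms in \<open>auto simp: star_simps\<close>)
  with False show ?thesis by simp
qed (use assms cstar_identity[of z] in auto)

text \<open>The criterion is applied with \<open>r = \<bar>a\<bar> - a\<close> and \<open>z = sqrt \<bar>a\<bar> r\<close>; note that \<open>r a = - r \<bar>a\<bar>\<close>.\<close>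

lemma pos_if_no_negative_part:
  fixes a :: "'a::unital_cstar_algebra"
  assumes sa: "star a = a"
    and no_neg: "\<And>r z. star r = r \<Longrightarrow> star z = z \<Longrightarrow> r * a * r = - (z * z) \<Longrightarrow>
      (\<And>S. subalgebra S \<Longrightarrow> closed S \<Longrightarrow> a \<in> S \<Longrightarrow> r \<in> S) \<Longrightarrow> z = 0"
  shows "pos a"
proof -
  have pa: "pos (a * a)" by (rule pos_square[OF sa])
  define b where "b = psqrt (a * a)"
  have b: "pos b" "b * b = a * a" "b * a = a * b"
    using pos_psqrt[OF pa] psqrt_square[OF pa] psqrt_commute[OF pa, of a]
    by (simp_all add: b_def mult.assoc)
  define d where "d = psqrt b"
  have d: "star d = d" "d * d = b" "d * a = a * d" "d * b = b * d"
    using pos_psqrt[OF b(1)] psqrt_square[OF b(1)] psqrt_commute[OF b(1), of a]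
      psqrt_commute[OF b(1), of b] b(3)
    by (simp_all add: d_def pos_selfadjoint)
  define r where "r = b - a"
  have sr: "star r = r" using sa b(1) by (simp add: r_def star_simps pos_selfadjoint)
  \<comment> \<open>This clause lets an application approximate \<open>r\<close> from any dense
    subalgebra of a closed algebra containing \<open>a\<close>.\<close>
  have rS: "r \<in> S" if S: "subalgebra S" "closed S" "a \<in> S" for S
  proof -
    have "a * a \<in> S" using S by (simp add: subalgebra_def)
    thus ?thesis unfolding r_def b_def by (intro subalgebra_diff psqrt_mem pa S)
  qed
  have ra: "r * a = - (r * b)" using b by (simp add: r_def algebra_simps)
  have dr: "d * r = r * d" using d by (simp add: r_def algebra_simps)
  define z where "z = d * r"
  have sz: "star z = z" by (simp add: z_def star_simps sr d(1) dr)
  have "z * z = r * d * (d * r)" by (simp add: z_def dr)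
  hence zz: "z * z = r * b * r" by (simp add: mult.assoc flip: d(2))
  have "z = 0" by (rule no_neg[OF sr sz _ rS]) (simp_all add: ra zz)
  have "b * r = d * z" by (simp add: z_def mult.assoc flip: d(2))
  hence br: "b * r = 0" by (simp add: \<open>z = 0\<close>)
  have "r * b = star (b * r)" using sr b(1) by (simp add: star_simps pos_selfadjoint)
  hence rb: "r * b = 0" by (simp add: br)
  have "r * r = r * b - r * a" by (simp add: r_def algebra_simps)
  hence "r * r = 0" by (simp add: ra rb)
  hence "r = 0" using cstar_identity[of r] sr by simp
  thus ?thesis using b(1) by (simp add: r_def)
qed

text \<open>Compressing by a self-adjoint \<open>r\<close> gives
  \<open>star (y * r) * (y * r)\<close>, again of the form \<open>star t * t\<close>, and such an
  element equals \<open>- (z * z)\<close> only for \<open>z = 0\<close>.\<close>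

lemma pos_star_mult: "pos (star y * (y::'a::unital_cstar_algebra))"
proof (rule pos_if_no_negative_part)
  fix r z :: 'a
  assume r: "star r = r" and z: "star z = z" and "r * (star y * y) * r = - (z * z)"
  hence "star (y * r) * (y * r) = - (z * z)" by (simp add: star_mult mult.assoc)
  thus "z = 0" by (rule star_mult_neg_square[OF z])
qed (simp add: star_simps)

lemma pos_conj:
  assumes "pos a"
  shows "pos (star c * a * (c::'a::unital_cstar_algebra))"
proof -
  have "star c * a * c = star (psqrt a * c) * (psqrt a * c)"
    using assms psqrt_square[OF assms]
    by (simp add: star_mult pos_selfadjoint pos_psqrt mult.assoc)
       (simp flip: mult.assoc)
  thus ?thesis by (simp add: pos_star_mult)
qed

section \<open>The order between elements and algebra-valued squares\<close>

definition cle :: "'a::unital_cstar_algebra \<Rightarrow> 'a \<Rightarrow> bool"  (infix "\<preceq>" 50) where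
  "a \<preceq> b \<longleftrightarrow> pos (b - a)"

lemma pos_iff_cle: "pos a \<longleftrightarrow> 0 \<preceq> a"
  by (simp add: cle_def)

lemma cle_refl [simp]: "a \<preceq> a"
  by (simp add: cle_def)

lemma cle_trans [trans]: "a \<preceq> b \<Longrightarrow> b \<preceq> c \<Longrightarrow> a \<preceq> c"
  unfolding cle_def using pos_add by fastforce

lemma cle_eq_trans [trans]: "a \<preceq> b \<Longrightarrow> b = c \<Longrightarrow> a \<preceq> c" "a = b \<Longrightarrow> b \<preceq> c \<Longrightarrow> a \<preceq> c"
  by simp_all

lemma cle_add_mono: "a \<preceq> b \<Longrightarrow> c \<preceq> d \<Longrightarrow> a + c \<preceq> b + d"
  unfolding cle_def using pos_add[of "b - a" "d - c"] by (simp add: algebra_simps)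

lemma cle_sum_mono: "(\<And>i. i \<in> I \<Longrightarrow> f i \<preceq> g i) \<Longrightarrow> sum f I \<preceq> sum g I"
  unfolding cle_def by (simp add: pos_sum flip: sum_subtractf)

lemma cle_scaleR_mono: "a \<preceq> b \<Longrightarrow> 0 \<le> r \<Longrightarrow> r *\<^sub>R a \<preceq> r *\<^sub>R b"
  unfolding cle_def using pos_scaleR[of "b - a" r] by (simp add: algebra_simps)

lemma cle_scaleR_pos: "pos a \<Longrightarrow> r \<le> s \<Longrightarrow> r *\<^sub>R a \<preceq> s *\<^sub>R a"
  unfolding cle_def using pos_scaleR[of a "s - r"] by (simp add: algebra_simps)

lemma cle_conj: "a \<preceq> b \<Longrightarrow> star c * a * c \<preceq> star c * b * c"
  unfolding cle_def using pos_conj[of "b - a" c] by (simp add: algebra_simps)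

lemma cle_LIMSEQ: "f \<longlonglongrightarrow> a \<Longrightarrow> g \<longlonglongrightarrow> b \<Longrightarrow> (\<And>n. f n \<preceq> g n) \<Longrightarrow> a \<preceq> b"
  unfolding cle_def by (rule pos_LIMSEQ[OF tendsto_diff])

definition asq :: "'a::unital_cstar_algebra \<Rightarrow> 'a" where
  "asq x = star x * x"

lemma pos_asq [simp]: "pos (asq x)"
  by (simp add: asq_def pos_star_mult)

text \<open>Parallelogram identity: the two sides differ by \<open>asq (x - y)\<close>.\<close>

lemma asq_add_le: "asq (x + y) \<preceq> 2 *\<^sub>R asq x + 2 *\<^sub>R asq y"
proof -
  have "2 *\<^sub>R asq x + 2 *\<^sub>R asq y - asq (x + y) = asq (x - y)"
    by (simp add: asq_def star_simps algebra_simps scaleR_2)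
  thus ?thesis by (simp add: cle_def)
qed

lemma asq_mult_le: "asq (a * x) \<preceq> (norm a)\<^sup>2 *\<^sub>R asq x"
proof -
  have "star a * a \<preceq> (norm a)\<^sup>2 *\<^sub>R 1"
    using pos_norm_minus[of "star a * a"] by (simp add: cle_def star_simps cstar_identity)
  from cle_conj[OF this, of x] show ?thesis by (simp add: asq_def star_simps mult.assoc)
qed

lemma asq_scaleC: "asq (c *\<^sub>C x) = (cmod c)\<^sup>2 *\<^sub>R asq x"
  unfolding scaleR_scaleC complex_norm_square
  by (simp add: asq_def star_simps mult_scaleC_left mult_scaleC_right scaleC_scaleC mult.commute)

lemma asq_diff_commute: "asq (x - y) = asq (y - x)"
  by (simp add: asq_def star_simps algebra_simps)

section \<open>Positive matrices\<close>

text \<open>The vectors form the Hilbert module of rank m over the algebra itself, and the form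
  takes values in the algebra.\<close>

definition qform :: "nat \<Rightarrow> (nat \<Rightarrow> nat \<Rightarrow> 'a::unital_cstar_algebra) \<Rightarrow> (nat \<Rightarrow> 'a) \<Rightarrow> 'a" where
  "qform m X w = (\<Sum>i<m. \<Sum>j<m. star (w i) * X i j * w j)"

definition mat_app :: "nat \<Rightarrow> (nat \<Rightarrow> nat \<Rightarrow> 'a::unital_cstar_algebra) \<Rightarrow> (nat \<Rightarrow> 'a) \<Rightarrow> nat \<Rightarrow> 'a" where
  "mat_app m X w i = (\<Sum>j<m. X i j * w j)"

definition vip :: "nat \<Rightarrow> (nat \<Rightarrow> 'a::unital_cstar_algebra) \<Rightarrow> (nat \<Rightarrow> 'a) \<Rightarrow> 'a" where
  "vip m w w' = (\<Sum>i<m. star (w i) * w' i)"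

lemma qform_eq_vip: "qform m X w = vip m w (mat_app m X w)"
  by (simp add: qform_def vip_def mat_app_def sum_distrib_left mult.assoc)

lemma vip_eq_asq: "vip m w w = (\<Sum>i<m. asq (w i))"
  by (simp add: vip_def asq_def)

lemma pos_vip: "pos (vip m w w)"
  by (simp add: vip_eq_asq pos_sum)

lemma vip_mat_app_hermitian:
  assumes "\<And>i j. i < m \<Longrightarrow> j < m \<Longrightarrow> star (X i j) = X j i"
  shows "vip m (mat_app m X w) w' = vip m w (mat_app m X w')"
proof -
  have "vip m (mat_app m X w) w' = (\<Sum>i<m. \<Sum>j<m. star (w j) * X j i * w' i)"
    by (simp add: vip_def mat_app_def star_sum star_mult sum_distrib_right assms)
  also have "\<dots> = (\<Sum>j<m. \<Sum>i<m. star (w j) * X j i * w' i)" by (rule sum.swap)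
  finally show ?thesis by (simp add: vip_def mat_app_def sum_distrib_left mult.assoc)
qed

lemma pos_qform_positive_matrix:
  assumes "positive_matrix m X"
  shows "pos (qform m X w)"
proof -
  obtain Y where Y: "\<And>i j. i < m \<Longrightarrow> j < m \<Longrightarrow> X i j = (\<Sum>l<m. star (Y l i) * Y l j)"
    using assms unfolding positive_matrix_def by blast
  have "qform m X w = (\<Sum>i<m. \<Sum>j<m. \<Sum>l<m. star (Y l i * w i) * (Y l j * w j))"
    by (simp add: qform_def Y sum_distrib_left sum_distrib_right star_mult mult.assoc)
  also have "\<dots> = (\<Sum>i<m. \<Sum>l<m. \<Sum>j<m. star (Y l i * w i) * (Y l j * w j))"
    by (intro sum.cong refl sum.swap)
  also have "\<dots> = (\<Sum>l<m. \<Sum>i<m. \<Sum>j<m. star (Y l i * w i) * (Y l j * w j))"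
    by (rule sum.swap)
  also have "\<dots> = (\<Sum>l<m. asq (mat_app m Y w l))"
    by (simp add: asq_def mat_app_def star_sum sum_product)
  finally show ?thesis by (simp add: pos_sum)
qed

lemma star_positive_matrix:
  assumes "positive_matrix m X" "i < m" "j < m"
  shows "star (X i j) = X j i"
  using assms unfolding positive_matrix_def by (auto simp: star_simps)

lemma asq_cross_le: "star a * b + star b * a \<preceq> asq a + asq b"
proof -
  have "asq a + asq b - (star a * b + star b * a) = asq (a - b)"
    by (simp add: asq_def star_simps algebra_simps)
  thus ?thesis by (simp add: cle_def)
qed

lemma qform_bounded:
  assumes herm: "\<And>i j. i < m \<Longrightarrow> j < m \<Longrightarrow> star (X i j) = X j i"
  shows "\<exists>t>0. \<forall>w. qform m X w \<preceq> t *\<^sub>R vip m w w"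
proof -
  define K where "K = (\<Sum>i<m. \<Sum>j<m. (norm (X i j))\<^sup>2)"
  have K: "(norm (X i j))\<^sup>2 \<le> K" if "i < m" "j < m" for i j
  proof -
    have "(norm (X i j))\<^sup>2 \<le> (\<Sum>j<m. (norm (X i j))\<^sup>2)"
      using that by (intro member_le_sum) auto
    also have "\<dots> \<le> K" unfolding K_def using that by (intro member_le_sum sum_nonneg) auto
    finally show ?thesis .
  qed
  have K0: "K \<ge> 0" by (simp add: K_def sum_nonneg)
  \<comment> \<open>Each index pair contributes at most
    \<open>(asq (w i) + K asq (w j)) / 2\<close>, which sums to the factor
    \<open>m (1 + K) / 2\<close>; the extra 1 keeps \<open>t\<close> positive also for
    \<open>m = 0\<close>.\<close>
  define t where "t = real m * (1 + K) / 2 + 1"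
  have "t > 0" using K0 by (simp add: t_def add_nonneg_pos)
  moreover have "qform m X w \<preceq> t *\<^sub>R vip m w w" for w
  proof -
    have "star (vip m w (mat_app m X w)) = vip m (mat_app m X w) w"
      by (simp add: vip_def star_simps)
    also have "\<dots> = vip m w (mat_app m X w)"
      by (rule vip_mat_app_hermitian[OF herm])
    finally have "star (vip m w (mat_app m X w)) = vip m w (mat_app m X w)" .
    hence "2 *\<^sub>R qform m X w = qform m X w + star (qform m X w)"
      by (simp add: qform_eq_vip scaleR_2)
    also have "\<dots> = (\<Sum>i<m. \<Sum>j<m. star (w i) * (X i j * w j) + star (X i j * w j) * w i)"
      by (simp add: qform_def star_simps sum.distrib mult.assoc)
    also have "\<dots> \<preceq> (\<Sum>i<m. \<Sum>j<m. asq (w i) + K *\<^sub>R asq (w j))"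
    proof (intro cle_sum_mono)
      fix i j assume ij: "i \<in> {..<m}" "j \<in> {..<m}"
      have "asq (X i j * w j) \<preceq> (norm (X i j))\<^sup>2 *\<^sub>R asq (w j)" by (rule asq_mult_le)
      also have "\<dots> \<preceq> K *\<^sub>R asq (w j)" using ij by (intro cle_scaleR_pos K) auto
      finally have "asq (w i) + asq (X i j * w j) \<preceq> asq (w i) + K *\<^sub>R asq (w j)"
        by (intro cle_add_mono) auto
      thus "star (w i) * (X i j * w j) + star (X i j * w j) * w i \<preceq> asq (w i) + K *\<^sub>R asq (w j)"
        using asq_cross_le cle_trans by blast
    qed
    also have "\<dots> = (real m * (1 + K)) *\<^sub>R vip m w w"
      by (simp add: sum.distrib vip_eq_asq scaleR_sum_right sum_distrib_left algebra_simps sum_constant_scaleR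
          del: sum_constant flip: scaleR_sum_right)
    also have "\<dots> \<preceq> (2 * t) *\<^sub>R vip m w w"
      by (intro cle_scaleR_pos pos_vip) (simp add: t_def)
    finally have "(1 / 2) *\<^sub>R 2 *\<^sub>R qform m X w \<preceq> (1 / 2) *\<^sub>R (2 * t) *\<^sub>R vip m w w"
      by (rule cle_scaleR_mono) simp
    thus ?thesis by simp
  qed
  ultimately show ?thesis by blast
qed

definition unit_vec :: "nat \<Rightarrow> nat \<Rightarrow> 'a::unital_cstar_algebra" where
  "unit_vec j i = (if i = j then 1 else 0)"

lemma vip_unit_vec: "j < m \<Longrightarrow> vip m (unit_vec j) w = w j"
  by (simp add: vip_def unit_vec_def if_distrib[of star] if_distrib[of "\<lambda>x. x * _"] cong: if_cong)

text \<open>Column j is the k-fold action on the j-th unit vector, so the product rule for powers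
  becomes \<open>funpow_add\<close>.\<close>

definition mat_pow :: "nat \<Rightarrow> (nat \<Rightarrow> nat \<Rightarrow> 'a::unital_cstar_algebra) \<Rightarrow> nat \<Rightarrow> nat \<Rightarrow> nat \<Rightarrow> 'a" where
  "mat_pow m x k i j = (mat_app m x ^^ k) (unit_vec j) i"

lemma mat_app_pow:
  assumes "i < m"
  shows "(mat_app m x ^^ k) w i = (\<Sum>l<m. mat_pow m x k i l * w l)"
  using assms
proof (induction k arbitrary: i)
  case 0
  thus ?case by (simp add: mat_pow_def unit_vec_def if_distrib[of "\<lambda>x. x * _"] cong: if_cong)
next
  case (Suc k)
  have "(mat_app m x ^^ Suc k) w i = (\<Sum>j<m. \<Sum>l<m. x i j * mat_pow m x k j l * w l)"
    by (simp add: mat_app_def[of m x "(mat_app m x ^^ k) w"] Suc sum_distrib_left mult.assoc)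
  also have "\<dots> = (\<Sum>l<m. \<Sum>j<m. x i j * mat_pow m x k j l * w l)" by (rule sum.swap)
  also have "\<dots> = (\<Sum>l<m. mat_pow m x (Suc k) i l * w l)"
    by (simp add: mat_pow_def mat_app_def[of m x "(mat_app m x ^^ k) w" for w] sum_distrib_right)
  finally show ?case .
qed

lemma mat_pow_add:
  assumes "i < m"
  shows "(\<Sum>l<m. mat_pow m x a i l * mat_pow m x b l j) = mat_pow m x (a + b) i j"
  using mat_app_pow[OF assms, where k = a and x = x and w = "(mat_app m x ^^ b) (unit_vec j)"]
  by (simp add: mat_pow_def funpow_add)

lemma vip_mat_app_pow_hermitian:
  assumes "\<And>i j. i < m \<Longrightarrow> j < m \<Longrightarrow> star (x i j) = x j i"
  shows "vip m ((mat_app m x ^^ k) w) w' = vip m w ((mat_app m x ^^ k) w')"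
  by (induction k arbitrary: w w')
     (simp_all add: vip_mat_app_hermitian[OF assms] funpow_swap1)

lemma mat_pow_star:
  assumes "\<And>i j. i < m \<Longrightarrow> j < m \<Longrightarrow> star (x i j) = x j i" "i < m" "j < m"
  shows "star (mat_pow m x k i j) = mat_pow m x k j i"
proof -
  have "star (mat_pow m x k i j) = star (vip m (unit_vec i) ((mat_app m x ^^ k) (unit_vec j)))"
    by (simp add: vip_unit_vec assms mat_pow_def)
  also have "\<dots> = vip m ((mat_app m x ^^ k) (unit_vec j)) (unit_vec i)"
    by (simp add: vip_def star_simps)
  also have "\<dots> = vip m (unit_vec j) ((mat_app m x ^^ k) (unit_vec i))"
    by (rule vip_mat_app_pow_hermitian[OF assms(1)])
  finally show ?thesis by (simp add: vip_unit_vec assms mat_pow_def)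
qed

text \<open>For \<open>0 \<le> x \<le> 1\<close> the identity \<open>x - x\<^sup>2 = x (1 - x) x + (1 - x) x (1 - x)\<close> gives \<open>x\<^sup>2 \<le> 1\<close>.\<close>

lemma mat_app_contraction:
  assumes herm: "\<And>i j. i < m \<Longrightarrow> j < m \<Longrightarrow> star (x i j) = x j i"
    and nonneg: "\<And>w. pos (qform m x w)" and le: "\<And>w. qform m x w \<preceq> vip m w w"
  shows "vip m (mat_app m x w) (mat_app m x w) \<preceq> vip m w w"
proof -
  let ?T = "mat_app m x"
  let ?d = "\<lambda>i. w i - ?T w i"
  have lin: "?T ?d = (\<lambda>i. ?T w i - ?T (?T w) i)"
    by (auto simp: mat_app_def right_diff_distrib sum_subtractf)
  have "vip m (?T w) (?T (?T w)) = vip m w (?T (?T (?T w)))"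
     "vip m (?T w) (?T w) = vip m w (?T (?T w))" "vip m (?T w) w = vip m w (?T w)"
    by (simp_all add: vip_mat_app_hermitian[OF herm])
  moreover have "vip m ?d (\<lambda>i. ?T w i - ?T (?T w) i) =
      vip m w (?T w) - vip m w (?T (?T w)) - vip m (?T w) (?T w) + vip m (?T w) (?T (?T w))"
    by (simp add: vip_def star_simps algebra_simps sum.distrib sum_subtractf)
  ultimately have "vip m w (?T w) - vip m (?T w) (?T w) =
      (vip m (?T w) (?T w) - qform m x (?T w)) + qform m x ?d"
    by (simp add: qform_eq_vip lin)
  hence "vip m (?T w) (?T w) \<preceq> vip m w (?T w)"
    using le[of "?T w"] nonneg[of ?d] by (simp add: cle_def pos_add)
  also have "\<dots> \<preceq> vip m w w" using le[of w] by (simp add: qform_eq_vip)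
  finally show ?thesis .
qed

text \<open>As \<open>x\<close> is a contraction, column j of the power is no longer than the unit
  vector, and an entry is dominated by its column. The bound is uniform in k, which makes the root
  series converge entrywise.\<close>

lemma mat_pow_norm_le:
  assumes herm: "\<And>i j. i < m \<Longrightarrow> j < m \<Longrightarrow> star (x i j) = x j i"
    and nonneg: "\<And>w. pos (qform m x w)" and le: "\<And>w. qform m x w \<preceq> vip m w w"
    and ij: "i < m" "j < m"
  shows "norm (mat_pow m x k i j) \<le> 1"
proof -
  let ?v = "(mat_app m x ^^ k) (unit_vec j)"
  have contr: "vip m ((mat_app m x ^^ k) w) ((mat_app m x ^^ k) w) \<preceq> vip m w w" for w
  proof (induction k)
    case (Suc k)
    show ?case
      using mat_app_contraction[OF herm nonneg le, of "(mat_app m x ^^ k) w"] Suc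
      by (auto intro: cle_trans)
  qed simp
  have "asq (?v i) \<preceq> vip m ?v ?v"
  proof -
    have "pos (\<Sum>i\<in>{..<m} - {i}. asq (?v i))" by (intro pos_sum pos_asq)
    thus ?thesis using ij by (simp add: vip_eq_asq cle_def sum.remove[of _ i])
  qed
  also have "\<dots> \<preceq> vip m (unit_vec j) (unit_vec j)" by (rule contr)
  also have "\<dots> = 1 *\<^sub>R 1" using ij by (simp add: vip_unit_vec) (simp add: unit_vec_def)
  finally have "norm (asq (?v i)) \<le> 1"
    by (intro norm_le_if_pos_diff) (auto simp: cle_def)
  thus ?thesis by (simp add: asq_def cstar_identity mat_pow_def abs_square_le_1)
qed

text \<open>The square root of a positive matrix is computed by the power series of \<open>sqrt (1 - x)\<close>,
  so its entries stay in any closed subalgebra that contains the entries of the matrix.\<close>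

lemma positive_matrix_root:
  assumes herm: "\<And>i j. i < m \<Longrightarrow> j < m \<Longrightarrow> star (X i j) = X j i"
    and nonneg: "\<And>w. pos (qform m X w)"
    and S: "subalgebra S" "closed S" "\<And>i j. i < m \<Longrightarrow> j < m \<Longrightarrow> X i j \<in> S"
  shows "\<exists>R. (\<forall>i<m. \<forall>j<m. R i j \<in> S) \<and> (\<forall>i<m. \<forall>j<m. X i j = (\<Sum>l<m. star (R l i) * R l j))"
proof -
  obtain t where t: "t > 0" and bound: "\<And>w. qform m X w \<preceq> t *\<^sub>R vip m w w"
    using qform_bounded[of m X] herm by blast
  \<comment> \<open>By the choice of \<open>t\<close> the form of \<open>x\<close> lies between 0
    and the squared length, and \<open>X / t\<close> is the identity minus \<open>x\<close>.\<close>
  define x where "x i j = unit_vec j i - (1 / t) *\<^sub>R X i j" for i j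
  have xherm: "star (x i j) = x j i" if "i < m" "j < m" for i j
    using that by (simp add: x_def star_simps herm unit_vec_def)
  have app_x: "mat_app m x w i = w i - (1 / t) *\<^sub>R mat_app m X w i" if "i < m" for w i
    using that by (simp add: mat_app_def x_def left_diff_distrib sum_subtractf unit_vec_def
        scaleR_sum_right if_distrib[of "\<lambda>x. x * _"] cong: if_cong)
  have qx: "qform m x w = vip m w w - (1 / t) *\<^sub>R qform m X w" for w
    by (simp add: qform_eq_vip vip_def app_x right_diff_distrib sum_subtractf scaleR_sum_right)
  have xpos: "pos (qform m x w)" for w
    using cle_scaleR_mono[OF bound[of w], of "1 / t"] t by (simp add: qx cle_def)
  have xle: "qform m x w \<preceq> vip m w w" for w
    using pos_scaleR[OF nonneg[of w], of "1 / t"] t by (simp add: qx cle_def)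
  have npow: "norm (mat_pow m x k i j) \<le> 1" if "i < m" "j < m" for k i j
    by (rule mat_pow_norm_le[OF xherm xpos xle that])
  have powS: "mat_pow m x k i j \<in> S" if "i < m" "j < m" for k i j
    using that
  proof (induction k arbitrary: i)
    case 0
    show ?case using S(1) unfolding mat_pow_def unit_vec_def subalgebra_def
      by simp (metis scale_zero_left)
  next
    case (Suc k)
    have "x i l \<in> S" if "l < m" for l
    proof -
      have "unit_vec l i \<in> S" using S(1) unfolding unit_vec_def subalgebra_def
        by simp (metis scale_zero_left)
      thus ?thesis unfolding x_def using S Suc that
        by (intro subalgebra_diff[OF S(1)]) (auto simp: subalgebra_def)
    qed
    hence "(\<Sum>l<m. x i l * mat_pow m x k l j) \<in> S"
      using Suc S(1) by (intro subalgebra_sum) (auto simp: subalgebra_def)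
    thus ?case by (simp add: mat_pow_def mat_app_def[of m x "(mat_app m x ^^ k) w" for w])
  qed
  let ?f = "\<lambda>i j k. sqrt_coeff k *\<^sub>R mat_pow m x k i j"
  have summ: "summable (\<lambda>k. norm (?f i j k))" if "i < m" "j < m" for i j
  proof (rule summable_comparison_test[OF _ summable_abs_sqrt_coeff], intro exI allI impI)
    fix k show "norm (norm (?f i j k)) \<le> \<bar>sqrt_coeff k\<bar>"
      using npow[OF that, of k] by (simp add: mult_left_le)
  qed
  define R where "R i j = suminf (?f i j)" for i j
  have sums: "?f i j sums R i j" if "i < m" "j < m" for i j
    unfolding R_def using summable_norm_cancel[OF summ[OF that]] by (rule summable_sums)
  have RS: "R i j \<in> S" if "i < m" "j < m" for i j
  proof -
    have "(\<Sum>k<n. ?f i j k) \<in> S" for n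
      using powS[OF that] S(1) by (intro subalgebra_sum) (auto simp: subalgebra_def)
    thus ?thesis
      using sums[OF that] S(2) unfolding sums_def closed_sequential_limits
      by (metis (no_types, lifting))
  qed
  have Rstar: "star (R i j) = R j i" if "i < m" "j < m" for i j
  proof -
    have "(\<lambda>k. star (?f i j k)) sums star (R i j)"
      using bounded_linear.sums[OF bounded_linear_star sums[OF that]] .
    hence "?f j i sums star (R i j)"
      using that by (simp add: star_scaleR mat_pow_star[of m x, OF xherm])
    thus ?thesis using sums[of j i] that sums_unique2 by blast
  qed
  have RR: "(\<Sum>l<m. R i l * R l j) = (1 / t) *\<^sub>R X i j" if "i < m" "j < m" for i j
  proof -
    let ?c = "\<lambda>k. (if k = 0 then 1 else if k = 1 then - 1 else (0::real))"
    have "(\<lambda>k. \<Sum>a\<le>k. ?f i l a * ?f l j (k - a)) sums (R i l * R l j)" if "l < m" for l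
      unfolding R_def by (rule Cauchy_product_sums) (use summ that \<open>i < m\<close> \<open>j < m\<close> in auto)
    hence "(\<lambda>k. \<Sum>l<m. \<Sum>a\<le>k. ?f i l a * ?f l j (k - a)) sums (\<Sum>l<m. R i l * R l j)"
      by (intro sums_sum) auto
    moreover have "(\<Sum>l<m. \<Sum>a\<le>k. ?f i l a * ?f l j (k - a)) = ?c k *\<^sub>R mat_pow m x k i j" for k
    proof -
      have "(\<Sum>l<m. \<Sum>a\<le>k. ?f i l a * ?f l j (k - a)) =
        (\<Sum>a\<le>k. \<Sum>l<m. ?f i l a * ?f l j (k - a))" by (rule sum.swap)
      also have "\<dots> = (\<Sum>a\<le>k. (sqrt_coeff a * sqrt_coeff (k - a)) *\<^sub>R
          (\<Sum>l<m. mat_pow m x a i l * mat_pow m x (k - a) l j))"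
        by (simp add: scaleR_sum_right mult.commute)
      also have "\<dots> = (\<Sum>a\<le>k. (sqrt_coeff a * sqrt_coeff (k - a)) *\<^sub>R mat_pow m x k i j)"
        using that by (intro sum.cong) (auto simp: mat_pow_add)
      also have "\<dots> = ?c k *\<^sub>R mat_pow m x k i j"
        unfolding scaleR_sum_left[symmetric] sqrt_coeff_convolution ..
      finally show ?thesis .
    qed
    ultimately have 1: "(\<lambda>k. ?c k *\<^sub>R mat_pow m x k i j) sums (\<Sum>l<m. R i l * R l j)" by simp
    have "(\<lambda>k. ?c k *\<^sub>R mat_pow m x k i j) sums (\<Sum>k\<in>{0,1}. ?c k *\<^sub>R mat_pow m x k i j)"
      by (rule sums_finite) auto
    from sums_unique2[OF 1 this]
    have "(\<Sum>l<m. R i l * R l j) = unit_vec j i - mat_app m x (unit_vec j) i"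
      by (simp add: mat_pow_def)
    also have "mat_app m x (unit_vec j) i = x i j"
      using that by (simp add: mat_app_def unit_vec_def if_distrib[of "\<lambda>y. _ * y"] cong: if_cong)
    finally show ?thesis by (simp add: x_def)
  qed
  show ?thesis
  proof (rule exI[of _ "\<lambda>i j. sqrt t *\<^sub>R R i j"], intro conjI allI impI)
    fix i j assume ij: "i < m" "j < m"
    show "sqrt t *\<^sub>R R i j \<in> S" using RS[OF ij] S(1) by (simp add: subalgebra_def)
    have "(\<Sum>l<m. star (sqrt t *\<^sub>R R l i) * (sqrt t *\<^sub>R R l j)) = t *\<^sub>R (\<Sum>l<m. R i l * R l j)"
      using ij t by (simp add: star_scaleR Rstar scaleR_sum_right)
    thus "X i j = (\<Sum>l<m. star (sqrt t *\<^sub>R R l i) * (sqrt t *\<^sub>R R l j))"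
      using RR[OF ij] t by simp
  qed
qed

text \<open>For the nontrivial direction the factor \<open>Y\<close> is the square root matrix, with
  \<open>UNIV\<close> as the closed subalgebra.\<close>

lemma positive_matrix_iff_qform:
  "positive_matrix m X \<longleftrightarrow>
    (\<forall>i<m. \<forall>j<m. star (X i j) = X j i) \<and> (\<forall>w. pos (qform m X w))"
proof
  assume "(\<forall>i<m. \<forall>j<m. star (X i j) = X j i) \<and> (\<forall>w. pos (qform m X w))"
  thus "positive_matrix m X"
    using positive_matrix_root[of m X UNIV] unfolding positive_matrix_def
    by (auto simp: subalgebra_def)
qed (auto simp: star_positive_matrix pos_qform_positive_matrix)

section \<open>Powers of unitaries and the twisted shift operators\<close>

definition upow :: "'a::unital_cstar_algebra \<Rightarrow> int \<Rightarrow> 'a" where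
  "upow u i = (if 0 \<le> i then u ^ nat i else star u ^ nat (- i))"

lemma upow_0 [simp]: "upow u 0 = 1" by (simp add: upow_def)

lemma upow_1 [simp]: "upow u 1 = u" by (simp add: upow_def)

lemma upow_add_1: assumes "unitary u" shows "upow u (i + 1) = upow u i * u"
proof (cases "i \<ge> 0")
  case True
  thus ?thesis by (simp add: upow_def nat_add_distrib power_commutes)
next
  case False
  hence "nat (- i) = Suc (nat (- (i + 1)))" by simp
  hence "upow u i = star u ^ nat (- (i + 1)) * star u"
    using False by (simp add: upow_def power_commutes)
  hence "upow u i * u = star u ^ nat (- (i + 1))"
    using assms by (simp add: unitary_def mult.assoc)
  thus ?thesis using False by (cases "i = -1") (auto simp: upow_def)
qed

lemma upow_diff_1: assumes "unitary u" shows "upow u (i - 1) = upow u i * star u"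
  using upow_add_1[OF assms, of "i - 1"] assms by (simp add: unitary_def mult.assoc)

lemma upow_add: assumes "unitary u" shows "upow u (i + j) = upow u i * upow u j"
proof (induction j rule: int_induct[where k = 0])
  case (step1 j)
  thus ?case using upow_add_1[OF assms, of "i + j"] upow_add_1[OF assms, of j]
    by (simp add: add.assoc mult.assoc)
next
  case (step2 j)
  thus ?case using upow_diff_1[OF assms, of "i + j"] upow_diff_1[OF assms, of j]
    by (simp add: add_diff_eq mult.assoc)
qed simp

lemma star_upow: "unitary u \<Longrightarrow> star (upow u i) = upow u (- i)"
  by (cases i "0::int" rule: linorder_cases) (auto simp: upow_def star_power star_star)

lemma unitary_upow: assumes "unitary u" shows "unitary (upow u i)"
  unfolding unitary_def star_upow[OF assms] upow_add[OF assms, symmetric] by simp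

lemma unitary_mult: "unitary u \<Longrightarrow> unitary v \<Longrightarrow> unitary (u * v)"
  unfolding unitary_def star_mult by (metis mult.assoc mult.left_neutral)

lemma mult_upow_commute:
  assumes "unitary b" "a * b = cis \<theta> *\<^sub>C (b * a)"
  shows "a * upow b j = cis (of_int j * \<theta>) *\<^sub>C (upow b j * a)"
proof (induction j rule: int_induct[where k = 0])
  case (step1 j)
  have "a * upow b (j + 1) = a * upow b j * b"
    by (simp add: upow_add_1[OF assms(1)] mult.assoc)
  also have "\<dots> = cis (of_int j * \<theta>) *\<^sub>C (upow b j * (a * b))"
    by (simp add: step1 mult_scaleC_left mult.assoc)
  also have "\<dots> = cis (of_int (j + 1) * \<theta>) *\<^sub>C (upow b (j + 1) * a)"
  proof -
    have "of_int j * \<theta> + \<theta> = of_int (j + 1) * \<theta>" by (simp add: algebra_simps)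
    thus ?thesis by (simp add: assms(2) mult_scaleC_right scaleC_scaleC upow_add_1[OF assms(1)]
        mult.assoc cis_mult del: of_int_add)
  qed
  finally show ?case .
next
  case (step2 j)
  have "star b * (a * b) * star b = cis \<theta> *\<^sub>C (star b * b * (a * star b))"
    by (simp add: assms(2) mult_scaleC_left mult_scaleC_right mult.assoc)
  moreover have "star b * b = 1" "b * star b = 1" using assms(1) by (simp_all add: unitary_def)
  ultimately have "star b * a = cis \<theta> *\<^sub>C (a * star b)"
    by (metis mult.assoc mult.left_neutral mult.right_neutral)
  hence ab: "a * star b = cis (- \<theta>) *\<^sub>C (star b * a)"
    by (simp add: scaleC_scaleC cis_mult scaleC_one)
  have "a * upow b (j - 1) = a * upow b j * star b"
    by (simp add: upow_diff_1[OF assms(1)] mult.assoc)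
  also have "\<dots> = cis (of_int j * \<theta>) *\<^sub>C (upow b j * (a * star b))"
    by (simp add: step2 mult_scaleC_left mult.assoc)
  also have "\<dots> = cis (of_int (j - 1) * \<theta>) *\<^sub>C (upow b (j - 1) * a)"
    by (simp add: ab mult_scaleC_right scaleC_scaleC upow_diff_1[OF assms(1)] mult.assoc
        cis_mult algebra_simps)
  finally show ?case .
qed (simp add: scaleC_one)

lemma upow_upow_commute:
  assumes "unitary u" "unitary v" "u * v = cis \<theta> *\<^sub>C (v * u)"
  shows "upow v j * upow u i = cis (- (of_int i * of_int j * \<theta>)) *\<^sub>C (upow u i * upow v j)"
proof -
  have "u * upow v j = cis (of_int j * \<theta>) *\<^sub>C (upow v j * u)"
    by (rule mult_upow_commute[OF assms(2,3)])
  hence "upow v j * u = cis (- (of_int j * \<theta>)) *\<^sub>C (u * upow v j)"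
    by (simp add: scaleC_scaleC cis_mult scaleC_one)
  from mult_upow_commute[OF assms(1) this, of i] show ?thesis by (simp add: algebra_simps)
qed

section \<open>Sums over roots of unity and over periods\<close>

lemma cis_root_eq_1_iff:
  assumes "M > 0"
  shows "cis (2 * pi * of_int m / real M) = 1 \<longleftrightarrow> int M dvd m"
proof
  assume "cis (2 * pi * of_int m / real M) = 1"
  hence "cos (2 * pi * of_int m / real M) = 1" by (simp add: complex_eq_iff)
  then obtain l :: int where "2 * pi * of_int m / real M = of_int l * 2 * pi"
    using cos_one_2pi_int by auto
  hence "real_of_int m = of_int l * real M" using assms by (simp add: field_simps)
  hence "m = l * int M" by (metis of_int_eq_iff of_int_mult of_int_of_nat_eq)
  thus "int M dvd m" by simp
next
  assume "int M dvd m"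
  then obtain l where "m = int M * l" by blast
  thus "cis (2 * pi * of_int m / real M) = 1"
    using assms cis_multiple_2pi[of "of_int l"] by (simp add: mult_ac)
qed

lemma sum_cis_roots:
  assumes "M > 0"
  shows "(\<Sum>p<M. cis (of_int m * (2 * pi * real p / real M))) =
    (if int M dvd m then of_nat M else 0)"
proof -
  define z where "z = cis (2 * pi * of_int m / real M)"
  have zp: "cis (of_int m * (2 * pi * real p / real M)) = z ^ p" for p
    by (simp add: z_def Complex.DeMoivre field_simps)
  have zM: "z ^ M = 1"
    using assms cis_multiple_2pi[of "of_int m"] by (simp add: z_def Complex.DeMoivre mult.commute)
  have "z = 1 \<longleftrightarrow> int M dvd m" unfolding z_def by (rule cis_root_eq_1_iff[OF assms])
  thus ?thesis unfolding zp using geometric_sum[of z M] zM by auto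
qed

lemma sum_cis_roots_small:
  assumes "M > 0" "\<bar>m\<bar> < int M"
  shows "(\<Sum>p<M. cis (of_int m * (2 * pi * real p / real M))) = (if m = 0 then of_nat M else 0)"
  using sum_cis_roots[OF assms(1), of m] assms(2) zdvd_not_zless[of "\<bar>m\<bar>" "int M"] by auto

lemma sum_shift_periodic:
  fixes g :: "int \<Rightarrow> 'a::ab_group_add"
  assumes "\<And>i. g (i + int n) = g i"
  shows "(\<Sum>i<n. g (int i + b)) = (\<Sum>i<n. g (int i))"
proof -
  have 1: "(\<Sum>i<n. g (int i + (b + 1))) = (\<Sum>i<n. g (int i + b))" for b
  proof -
    have "(\<Sum>i<n. g (int i + (b + 1))) = (\<Sum>i<n. g (int (Suc i) + b))"
      by (simp add: algebra_simps)
    also have "\<dots> = (\<Sum>i<Suc n. g (int i + b)) - g b"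
      by (subst sum.lessThan_Suc_shift) simp
    also have "\<dots> = (\<Sum>i<n. g (int i + b))"
      using assms[of b] by (simp add: add.commute)
    finally show ?thesis .
  qed
  show ?thesis
  proof (induction b rule: int_induct[where k = 0])
    case (step1 b)
    thus ?case using 1[of b] by simp
  next
    case (step2 b)
    thus ?case using 1[of "b - 1"] by simp
  qed simp
qed

text \<open>The second assumption says that \<open>cis \<theta>\<close> is a primitive n-th root of
  unity; this is the form in which coprimality of k and n is used.\<close>

locale phase =
  fixes n :: nat and \<theta> :: real
  assumes n_pos: "n \<ge> 1" and cis_eq_1_iff: "cis (of_int m * \<theta>) = 1 \<longleftrightarrow> int n dvd m"
begin

text \<open>Vectors of length n are encoded as n-periodic functions on the integers, so that the
  cyclic shift is \<open>i + b\<close> without reduction mod n.\<close>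

definition per :: "(int \<Rightarrow> 'a::unital_cstar_algebra) \<Rightarrow> bool" where
  "per w \<longleftrightarrow> (\<forall>i. w (i + int n) = w i)"

definition ip :: "(int \<Rightarrow> 'a::unital_cstar_algebra) \<Rightarrow> (int \<Rightarrow> 'a) \<Rightarrow> 'a" where
  "ip w w' = (\<Sum>i<n. star (w (int i)) * w' (int i))"

definition nn :: "(int \<Rightarrow> 'a::unital_cstar_algebra) \<Rightarrow> 'a" where
  "nn w = (\<Sum>i<n. asq (w (int i)))"

text \<open>\<open>XY u v s t a b\<close> is \<open>x\<^sup>a y\<^sup>b\<close>, where \<open>x\<close> is \<open>exp (- \<i> s) u\<close> times the clock matrix and
  \<open>y\<close> is \<open>exp (- \<i> t) v\<close> times the cyclic shift, acting on vectors that are \<open>n\<close>-periodic in the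
  index. The phases of the clock make \<open>x\<close> and \<open>y\<close> commute if \<open>u v = exp (\<i> \<theta>) v u\<close>.\<close>

definition XY :: "'a::unital_cstar_algebra \<Rightarrow> 'a \<Rightarrow> real \<Rightarrow> real \<Rightarrow> int \<Rightarrow> int \<Rightarrow> (int \<Rightarrow> 'a) \<Rightarrow> int \<Rightarrow> 'a" where
  "XY u v s t a b w i =
    cis (of_int i * of_int a * \<theta> - of_int a * s - of_int b * t) *\<^sub>C (upow u a * upow v b * w (i + b))"

text \<open>The squared lengths of \<open>(1 - x) w\<close> and \<open>(1 - y) w\<close>. They are
  small when \<open>w\<close> is nearly a joint eigenvector of the unrotated operators for the
  eigenvalues \<open>cis s\<close> and \<open>cis t\<close>.\<close>

definition Q :: "'a::unital_cstar_algebra \<Rightarrow> 'a \<Rightarrow> real \<Rightarrow> real \<Rightarrow> (int \<Rightarrow> 'a) \<Rightarrow> 'a" where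
  "Q u v s t w = nn (\<lambda>i. w i - XY u v s t 1 0 w i) + nn (\<lambda>i. w i - XY u v s t 0 1 w i)"

lemma nn_eq_ip: "nn w = ip w w" by (simp add: nn_def ip_def asq_def)

lemma pos_nn [simp]: "pos (nn w)" by (simp add: nn_def pos_sum)

lemma pos_Q [simp]: "pos (Q u v s t w)" by (simp add: Q_def pos_add)

lemma nn_add_le: "nn (\<lambda>i. w i + w' i) \<preceq> 2 *\<^sub>R nn w + 2 *\<^sub>R nn w'"
  unfolding nn_def scaleR_sum_right sum.distrib[symmetric] by (intro cle_sum_mono asq_add_le)

lemma nn_uminus: "nn (\<lambda>i. - w i) = nn w" by (simp add: nn_def asq_def star_minus)

lemma nn_diff_le: "nn (\<lambda>i. w i - w' i) \<preceq> 2 *\<^sub>R nn w + 2 *\<^sub>R nn w'"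
  using nn_add_le[of w "\<lambda>i. - w' i"] by (simp add: nn_uminus)

lemma nn_diff_commute: "nn (\<lambda>i. w i - w' i) = nn (\<lambda>i. w' i - w i)"
  by (simp add: nn_def asq_diff_commute)

lemma nn_scaleC: "nn (\<lambda>i. c *\<^sub>C w i) = (cmod c)\<^sup>2 *\<^sub>R nn w"
  by (simp add: nn_def asq_scaleC scaleR_sum_right)

lemma cis_period: "cis (of_int (int n * a) * \<theta>) = 1"
  by (simp add: cis_eq_1_iff del: of_int_mult)

lemma per_XY: assumes "per w" shows "per (XY u v s t a b w)"
  unfolding per_def
proof
  fix i
  have "cis (of_int (i + int n) * of_int a * \<theta> - of_int a * s - of_int b * t) =
      cis (of_int i * of_int a * \<theta> - of_int a * s - of_int b * t) * cis (of_int (int n * a) * \<theta>)"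
    unfolding cis_mult by (simp add: algebra_simps)
  moreover have "w (i + int n + b) = w (i + b)"
    using assms unfolding per_def by (metis add.commute add.left_commute)
  ultimately show "XY u v s t a b w (i + int n) = XY u v s t a b w i"
    by (simp add: XY_def cis_period del: of_int_add of_int_mult)
qed

lemma per_diff: "per w \<Longrightarrow> per w' \<Longrightarrow> per (\<lambda>i. w i - w' i)" by (simp add: per_def)

lemma per_sum: "(\<And>a. a \<in> I \<Longrightarrow> per (f a)) \<Longrightarrow> per (\<lambda>i. \<Sum>a\<in>I. f a i)"
  unfolding per_def by (auto intro: sum.cong)

lemma XY_diff: "XY u v s t a b (\<lambda>i. w i - w' i) = (\<lambda>i. XY u v s t a b w i - XY u v s t a b w' i)"
  by (auto simp: XY_def right_diff_distrib scaleC_diff_right)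

lemma XY_sum: "XY u v s t a b (\<lambda>i. \<Sum>c\<in>I. f c i) = (\<lambda>i. \<Sum>c\<in>I. XY u v s t a b (f c) i)"
  by (auto simp: XY_def sum_distrib_left scaleC_sum_right)

lemma XY_0: "XY u v s t 0 0 w = w"
  by (auto simp: XY_def scaleC_one)

lemma ip_XY:
  assumes "unitary u" "unitary v" "per w" "per w'"
  shows "ip (XY u v s t a b w) (XY u v s t a b w') = ip w w'"
proof -
  let ?m = "upow u a * upow v b"
  have m: "star ?m * ?m = 1"
    using unitary_mult[OF unitary_upow unitary_upow, OF assms(1,2)] by (simp add: unitary_def)
  have eq: "star (c *\<^sub>C (?m * x)) * (c *\<^sub>C (?m * y)) = star x * y" if "cmod c = 1" for c x y
  proof -
    have "star (c *\<^sub>C (?m * x)) * (c *\<^sub>C (?m * y)) = (c * cnj c) *\<^sub>C (star x * (star ?m * ?m) * y)"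
      by (simp add: star_simps mult_scaleC_left mult_scaleC_right scaleC_scaleC mult.assoc mult.commute[of c])
    also have "c * cnj c = 1" using that by (simp add: complex_norm_square[symmetric])
    finally show ?thesis unfolding m by (simp add: scaleC_one)
  qed
  have "ip (XY u v s t a b w) (XY u v s t a b w') = (\<Sum>i<n. star (w (int i + b)) * w' (int i + b))"
    unfolding ip_def XY_def by (intro sum.cong refl eq) simp
  also have "\<dots> = ip w w'"
    unfolding ip_def using assms by (intro sum_shift_periodic) (simp add: per_def)
  finally show ?thesis .
qed

lemma nn_XY:
  "unitary u \<Longrightarrow> unitary v \<Longrightarrow> per w \<Longrightarrow> nn (XY u v s t a b w) = nn w"
  by (simp add: nn_eq_ip ip_XY)

text \<open>Moving \<open>v^b\<close> past \<open>u^c\<close> costs the phase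
  \<open>cis (- b c \<theta>)\<close>, and the clock, read at the shifted index
  \<open>i + b\<close>, supplies its inverse. Hence the operators form a commutative group.\<close>

lemma XY_XY:
  assumes "unitary u" "unitary v" "u * v = cis \<theta> *\<^sub>C (v * u)"
  shows "XY u v s t a b (XY u v s t c d w) = XY u v s t (a + c) (b + d) w"
proof
  fix i
  let ?\<phi> = "of_int i * of_int a * \<theta> - of_int a * s - of_int b * t"
  let ?\<psi> = "of_int (i + b) * of_int c * \<theta> - of_int c * s - of_int d * t"
  have "XY u v s t a b (XY u v s t c d w) i =
      (cis ?\<phi> * cis ?\<psi>) *\<^sub>C (upow u a * (upow v b * upow u c) * upow v d * w (i + b + d))"
    by (simp add: XY_def mult_scaleC_right scaleC_scaleC mult.assoc)
  also have "upow v b * upow u c = cis (- (of_int c * of_int b * \<theta>)) *\<^sub>C (upow u c * upow v b)"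
    by (rule upow_upow_commute[OF assms])
  also have "upow u a * (cis (- (of_int c * of_int b * \<theta>)) *\<^sub>C (upow u c * upow v b)) * upow v d * w (i + b + d) =
     cis (- (of_int c * of_int b * \<theta>)) *\<^sub>C (upow u (a + c) * upow v (b + d) * w (i + (b + d)))"
    by (simp add: mult_scaleC_left mult_scaleC_right upow_add[OF assms(1)] upow_add[OF assms(2)] mult.assoc add.assoc)
  finally show "XY u v s t a b (XY u v s t c d w) i = XY u v s t (a + c) (b + d) w i"
    by (simp add: XY_def scaleC_scaleC cis_mult) (simp add: algebra_simps)
qed

text \<open>The matrix of the form \<open>Q u v s t w - e nn w\<close>, which is \<open>4 - e - 2 Re x - 2 Re y\<close>. For \<open>n \<le> 2\<close>
  the off-diagonal entries of \<open>y\<close> and \<open>y\<^sup>*\<close> fall on the same positions, hence the separate summands.\<close>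

definition gap_matrix :: "'a::unital_cstar_algebra \<Rightarrow> 'a \<Rightarrow> real \<Rightarrow> real \<Rightarrow> real \<Rightarrow> nat \<Rightarrow> nat \<Rightarrow> 'a" where
  "gap_matrix u v s t e i j =
    (if i = j then (4 - e) *\<^sub>R 1 - (cis (of_nat i * \<theta> - s) *\<^sub>C u + cis (s - of_nat i * \<theta>) *\<^sub>C star u) else 0)
    - (if j = (i + 1) mod n then cis (- t) *\<^sub>C v else 0)
    - (if i = (j + 1) mod n then cis t *\<^sub>C star v else 0)"

lemma star_gap_matrix: "star (gap_matrix u v s t e i j) = gap_matrix u v s t e j i"
  by (auto simp: gap_matrix_def star_simps cis_cnj)

text \<open>Since \<open>x\<close> is isometric, the squared length of \<open>w - x w\<close> is
  twice that of \<open>w\<close> minus twice the real part of the inner product of \<open>w\<close>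
  and \<open>x w\<close>; likewise for \<open>y\<close>. This accounts for the 4 on the
  diagonal.\<close>

lemma qform_gap_matrix:
  assumes "unitary u" "unitary v" "per w"
  shows "qform n (gap_matrix u v s t e) (\<lambda>i. w (int i)) = Q u v s t w - e *\<^sub>R nn w"
proof -
  have wrap: "w (int ((i + 1) mod n)) = w (int i + 1)" if "i < n" for i
  proof (cases "i + 1 = n")
    case True
    hence "int i + 1 = 0 + int n" by simp
    hence "w (int i + 1) = w (0 + int n)" by (simp only:)
    also have "\<dots> = w 0" using assms(3) unfolding per_def by blast
    finally show ?thesis using True by simp
  next
    case False
    thus ?thesis using that by (simp add: add.commute)
  qed
  have asq_diff: "asq (a - b) = asq a + asq b - star a * b - star b * a" for a b :: 'a
    by (simp add: asq_def star_simps algebra_simps)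
  let ?p = "\<lambda>i::nat. cis (of_nat i * \<theta> - s) *\<^sub>C u"
  let ?D = "\<lambda>i. star (w (int i)) * ?p i * w (int i)"
  let ?V = "\<lambda>i. star (w (int i)) * (cis (- t) *\<^sub>C v) * w (int i + 1)"
  have A: "nn (\<lambda>i. w i - XY u v s t 1 0 w i) = 2 *\<^sub>R nn w - (\<Sum>i<n. ?D i) - (\<Sum>i<n. star (?D i))"
  proof -
    have "(\<Sum>i<n. asq (XY u v s t 1 0 w (int i))) = nn w"
      using nn_XY[OF assms, of s t 1 0] by (simp add: nn_def)
    thus ?thesis
      by (simp add: nn_def asq_diff sum.distrib sum_subtractf scaleR_2)
         (simp add: XY_def star_simps mult_scaleC_left mult_scaleC_right mult.assoc)
  qed
  have B: "nn (\<lambda>i. w i - XY u v s t 0 1 w i) = 2 *\<^sub>R nn w - (\<Sum>i<n. ?V i) - (\<Sum>i<n. star (?V i))"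
  proof -
    have "(\<Sum>i<n. asq (XY u v s t 0 1 w (int i))) = nn w"
      using nn_XY[OF assms, of s t 0 1] by (simp add: nn_def)
    thus ?thesis
      by (simp add: nn_def asq_diff sum.distrib sum_subtractf scaleR_2)
         (simp add: XY_def star_simps mult_scaleC_left mult_scaleC_right mult.assoc)
  qed
  have "qform n (gap_matrix u v s t e) (\<lambda>i. w (int i)) =
    (\<Sum>i<n. \<Sum>j<n. if i = j then star (w (int i)) * ((4 - e) *\<^sub>R 1 - (?p i + star (?p i))) * w (int j) else 0)
    - (\<Sum>i<n. \<Sum>j<n. if j = (i + 1) mod n then star (w (int i)) * (cis (- t) *\<^sub>C v) * w (int j) else 0)
    - (\<Sum>i<n. \<Sum>j<n. if i = (j + 1) mod n then star (w (int i)) * (cis t *\<^sub>C star v) * w (int j) else 0)"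
    unfolding qform_def sum_subtractf[symmetric]
    by (intro sum.cong refl) (simp add: gap_matrix_def star_simps cis_cnj left_diff_distrib right_diff_distrib)
  also have "(\<Sum>i<n. \<Sum>j<n. if i = j then star (w (int i)) * ((4 - e) *\<^sub>R 1 - (?p i + star (?p i))) * w (int j) else 0)
    = (4 - e) *\<^sub>R nn w - (\<Sum>i<n. ?D i) - (\<Sum>i<n. star (?D i))"
    by (simp add: nn_def asq_def scaleR_sum_right)
       (simp add: left_diff_distrib right_diff_distrib distrib_left distrib_right sum_subtractf sum.distrib star_simps mult.assoc)
  also have "(\<Sum>i<n. \<Sum>j<n. if j = (i + 1) mod n then star (w (int i)) * (cis (- t) *\<^sub>C v) * w (int j) else 0)
    = (\<Sum>i<n. ?V i)"
    using n_pos by (intro sum.cong refl) (simp add: wrap[simplified])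
  also have "(\<Sum>i<n. \<Sum>j<n. if i = (j + 1) mod n then star (w (int i)) * (cis t *\<^sub>C star v) * w (int j) else 0)
    = (\<Sum>j<n. \<Sum>i<n. if i = (j + 1) mod n then star (w (int i)) * (cis t *\<^sub>C star v) * w (int j) else 0)"
    by (rule sum.swap)
  also have "\<dots> = (\<Sum>i<n. star (?V i))"
    using n_pos by (intro sum.cong refl) (simp add: wrap[simplified] star_simps cis_cnj mult.assoc)
  finally show ?thesis unfolding Q_def A B
    by (simp add: algebra_simps) (simp add: algebra_simps flip: scaleR_add_left)
qed

lemma positive_gap_matrix_iff:
  fixes u v :: "'a::unital_cstar_algebra"
  assumes "unitary u" "unitary v"
  shows "positive_matrix n (gap_matrix u v s t e) \<longleftrightarrow> (\<forall>w. per w \<longrightarrow> e *\<^sub>R nn w \<preceq> Q u v s t w)"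
proof
  assume *: "positive_matrix n (gap_matrix u v s t e)"
  show "\<forall>w. per w \<longrightarrow> e *\<^sub>R nn w \<preceq> Q u v s t w"
    using pos_qform_positive_matrix[OF *] qform_gap_matrix[OF assms] unfolding cle_def by metis
next
  assume *: "\<forall>w. per w \<longrightarrow> e *\<^sub>R nn w \<preceq> Q u v s t w"
  have "pos (qform n (gap_matrix u v s t e) w)" for w
  proof -
    \<comment> \<open>Only the entries below n matter, so a vector may be replaced by its periodic
      extension.\<close>
    define w' where "w' i = w (nat (i mod int n))" for i
    have p: "per w'" by (simp add: per_def w'_def)
    have "qform n (gap_matrix u v s t e) w = qform n (gap_matrix u v s t e) (\<lambda>i. w' (int i))"
      unfolding qform_def by (intro sum.cong refl) (simp add: w'_def nat_mod_as_int[symmetric] zmod_int[symmetric])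
    thus ?thesis using * p qform_gap_matrix[OF assms p, of s t e] by (simp add: cle_def)
  qed
  thus "positive_matrix n (gap_matrix u v s t e)"
    by (simp add: positive_matrix_iff_qform star_gap_matrix)
qed

text \<open>The commutator of \<open>1 - x\<close> and \<open>1 - y\<close> is
  \<open>x y - y x = r y x\<close>, and \<open>y x\<close> is isometric. Each of the two products in
  the commutator is controlled by one defect, since \<open>1 - x\<close> and \<open>1 - y\<close>
  enlarge squared lengths at most by 4; with the factor 2 from \<open>nn_diff_le\<close> this gives
  8.\<close>

lemma Q_lower_bound_if_wrong_phase:
  fixes u v :: "'a::unital_cstar_algebra"
  assumes "unitary u" "unitary v" "u * v = q *\<^sub>C (v * u)" "q \<noteq> cis \<theta>"
  shows "\<exists>e>0. \<forall>s t w. per w \<longrightarrow> e *\<^sub>R nn w \<preceq> Q u v s t w"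
proof -
  define r where "r = q * cis (- \<theta>) - 1"
  have "r \<noteq> 0"
  proof
    assume "r = 0"
    hence "q * cis (- \<theta>) * cis \<theta> = cis \<theta>" by (simp add: r_def)
    thus False using assms(4) by (simp add: cis_mult mult.assoc)
  qed
  moreover have "((cmod r)\<^sup>2 / 8) *\<^sub>R nn w \<preceq> Q u v s t w" if w: "per w" for s t and w :: "int \<Rightarrow> 'a"
  proof -
    let ?x = "XY u v s t 1 0" and ?y = "XY u v s t 0 1"
    have comm: "?x (?y w) i = (q * cis (- \<theta>)) *\<^sub>C ?y (?x w) i" for i
    proof -
      have "?x (?y w) i = (cis (of_int i * \<theta> - s) * cis (- t)) *\<^sub>C (u * v * w (i + 1))"
        by (simp add: XY_def mult_scaleC_right scaleC_scaleC mult.assoc)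
      also have "\<dots> = (q * cis (of_int i * \<theta> - s) * cis (- t)) *\<^sub>C (v * u * w (i + 1))"
        by (simp add: assms(3) mult_scaleC_left scaleC_scaleC mult_ac)
      also have "\<dots> = (q * cis (- \<theta>)) *\<^sub>C ?y (?x w) i"
        by (simp add: XY_def mult_scaleC_right scaleC_scaleC mult.assoc cis_mult) (simp add: algebra_simps)
      finally show ?thesis .
    qed
    let ?dx = "\<lambda>w i. w i - ?x w i" and ?dy = "\<lambda>w i. w i - ?y w i"
    have "r *\<^sub>C ?y (?x w) i = ?dx (?dy w) i - ?dy (?dx w) i" for i
      by (simp add: XY_diff r_def scaleC_diff_left scaleC_one comm)
    hence "(cmod r)\<^sup>2 *\<^sub>R nn w = nn (\<lambda>i. ?dx (?dy w) i - ?dy (?dx w) i)"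
      using nn_scaleC[of r "?y (?x w)"] by (simp add: nn_XY per_XY assms w)
    also have "\<dots> \<preceq> 2 *\<^sub>R nn (?dx (?dy w)) + 2 *\<^sub>R nn (?dy (?dx w))" by (rule nn_diff_le)
    also have "\<dots> \<preceq> 2 *\<^sub>R (4 *\<^sub>R nn (?dy w)) + 2 *\<^sub>R (4 *\<^sub>R nn (?dx w))"
    proof -
      have 4: "nn (\<lambda>i. z i - XY u v s t a b z i) \<preceq> 4 *\<^sub>R nn z" if "per z" for z a b
        using nn_diff_le[of z "XY u v s t a b z"] nn_XY[OF assms(1,2) that]
        by (simp flip: scaleR_add_left)
      thus ?thesis by (intro cle_add_mono cle_scaleR_mono 4 per_diff per_XY w) simp_all
    qed
    also have "\<dots> = 8 *\<^sub>R Q u v s t w" by (simp add: Q_def algebra_simps)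
    finally have "(1 / 8) *\<^sub>R (cmod r)\<^sup>2 *\<^sub>R nn w \<preceq> (1 / 8) *\<^sub>R 8 *\<^sub>R Q u v s t w"
      by (rule cle_scaleR_mono) simp
    thus ?thesis by simp
  qed
  ultimately show ?thesis by (intro exI[of _ "(cmod r)\<^sup>2 / 8"]) auto
qed

end

section \<open>Averages over the torus\<close>

context phase
begin

definition e0 :: "int \<Rightarrow> 'a::unital_cstar_algebra" where
  "e0 i = (if int n dvd i then 1 else 0)"

text \<open>For a box \<open>I\<close> this is the product of the Dirichlet sums of \<open>x\<close>
  and \<open>y\<close> applied to the basis vector \<open>e0\<close>, so its squared length is an
  unnormalised Fejer kernel with \<open>u\<close>, \<open>v\<close> inserted.\<close>

definition wave :: "'a::unital_cstar_algebra \<Rightarrow> 'a \<Rightarrow> real \<Rightarrow> real \<Rightarrow> (int \<times> int) set \<Rightarrow> int \<Rightarrow> 'a" where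
  "wave u v s t I i = (\<Sum>(a, b)\<in>I. XY u v s t a b e0 i)"

definition uvmon :: "'a::unital_cstar_algebra \<Rightarrow> 'a \<Rightarrow> int \<Rightarrow> int \<Rightarrow> 'a" where
  "uvmon u v i j = upow u i * upow v j"

lemma per_e0: "per e0"
  by (simp add: per_def e0_def)

lemma per_wave: "per (wave u v s t I)"
proof -
  have "per (\<lambda>i. \<Sum>x\<in>I. XY u v s t (fst x) (snd x) e0 i)" by (intro per_sum per_XY per_e0)
  thus ?thesis by (simp add: wave_def[abs_def] case_prod_unfold)
qed

lemma ip_e0: "ip e0 w = w 0"
proof -
  have "ip e0 w = (\<Sum>i<n. if i = 0 then w 0 else 0)"
    unfolding ip_def e0_def by (intro sum.cong) (auto dest: nat_dvd_not_less)
  thus ?thesis using n_pos by simp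
qed

text \<open>Pulling back along the isometry \<open>x^a y^b\<close> leaves coordinate 0 of
  \<open>x^(c - a) y^(d - b) e0\<close>. It vanishes unless the shift is a multiple of n, and at
  index 0 the clock contributes no phase.\<close>

lemma ip_XY_e0:
  assumes "unitary u" "unitary v" "u * v = cis \<theta> *\<^sub>C (v * u)"
  shows "ip (XY u v s t a b e0) (XY u v s t c d e0) =
    (if int n dvd d - b then cis (- (of_int (c - a) * s) - of_int (d - b) * t) *\<^sub>C uvmon u v (c - a) (d - b) else 0)"
proof -
  have "XY u v s t c d e0 = XY u v s t a b (XY u v s t (c - a) (d - b) e0)"
    by (simp add: XY_XY[OF assms])
  hence "ip (XY u v s t a b e0) (XY u v s t c d e0) = ip e0 (XY u v s t (c - a) (d - b) e0)"
    by (simp only: ip_XY[OF assms(1,2)] per_e0 per_XY)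
  thus ?thesis by (simp add: ip_e0 XY_def e0_def uvmon_def)
qed

lemma ip_sum: "ip (\<lambda>i. \<Sum>a\<in>I. f a i) (\<lambda>i. \<Sum>b\<in>J. g b i) = (\<Sum>a\<in>I. \<Sum>b\<in>J. ip (f a) (g b))"
proof -
  have "ip (\<lambda>i. \<Sum>a\<in>I. f a i) (\<lambda>i. \<Sum>b\<in>J. g b i) =
    (\<Sum>i<n. \<Sum>a\<in>I. \<Sum>b\<in>J. star (f a (int i)) * g b (int i))"
    by (simp add: ip_def star_sum sum_product)
  also have "\<dots> = (\<Sum>a\<in>I. \<Sum>i<n. \<Sum>b\<in>J. star (f a (int i)) * g b (int i))" by (rule sum.swap)
  also have "\<dots> = (\<Sum>a\<in>I. \<Sum>b\<in>J. ip (f a) (g b))"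
    unfolding ip_def by (intro sum.cong refl sum.swap)
  finally show ?thesis .
qed

lemma nn_wave:
  assumes "unitary u" "unitary v" "u * v = cis \<theta> *\<^sub>C (v * u)"
  shows "nn (wave u v s t I) = (\<Sum>(a, b)\<in>I. \<Sum>(c, d)\<in>I. if int n dvd d - b
    then cis (- (of_int (c - a) * s) - of_int (d - b) * t) *\<^sub>C uvmon u v (c - a) (d - b) else 0)"
  unfolding nn_eq_ip wave_def case_prod_unfold ip_sum ip_XY_e0[OF assms] ..

section \<open>Discrete Fourier averages and the Fejer weights\<close>

definition grid :: "nat \<Rightarrow> nat \<Rightarrow> real" where
  "grid N p = 2 * pi * real p / real (2 * N)"

definition grid_sum :: "nat \<Rightarrow> (real \<Rightarrow> real \<Rightarrow> 'a) \<Rightarrow> 'a::comm_monoid_add" where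
  "grid_sum N F = (\<Sum>p<2 * N. \<Sum>r<2 * N. F (grid N p) (grid N r))"

text \<open>With 2 N nodes per circle the average is exact for frequencies below 2 N. A symbol of
  degree below N and the index differences of a box of side N together stay in this range.\<close>

lemma grid_sum_cis:
  assumes "N > 0" "\<bar>m\<bar> < 2 * int N" "\<bar>l\<bar> < 2 * int N"
  shows "grid_sum N (\<lambda>s t. cis (of_int m * s + of_int l * t)) =
    (if m = 0 \<and> l = 0 then of_nat ((2 * N)\<^sup>2) else 0)"
proof -
  have "grid_sum N (\<lambda>s t. cis (of_int m * s + of_int l * t)) =
    (\<Sum>p<2 * N. cis (of_int m * grid N p)) * (\<Sum>r<2 * N. cis (of_int l * grid N r))"
    by (simp add: grid_sum_def sum_product cis_mult)
  thus ?thesis using assms sum_cis_roots_small[of "2 * N" m] sum_cis_roots_small[of "2 * N" l]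
    by (simp add: grid_def power2_eq_square)
qed

text \<open>Expanding the squared length as a double sum over \<open>I\<close>, the average keeps
  just the pairs of indices with difference \<open>(i, j)\<close>; divisibility of \<open>j\<close>
  ensures that they are present in the expansion.\<close>

lemma grid_sum_nn_wave:
  assumes uv: "unitary u" "unitary v" "u * v = cis \<theta> *\<^sub>C (v * u)"
    and N: "N > 0" and fin: "finite I" and j: "int n dvd j"
    and bound: "\<And>a b c d. (a, b) \<in> I \<Longrightarrow> (c, d) \<in> I \<Longrightarrow> \<bar>i - (c - a)\<bar> < 2 * int N \<and> \<bar>j - (d - b)\<bar> < 2 * int N"
  shows "grid_sum N (\<lambda>s t. cis (of_int i * s + of_int j * t) *\<^sub>C nn (wave u v s t I)) =
    (real ((2 * N)\<^sup>2) * real (card {(a, b) \<in> I. (a + i, b + j) \<in> I})) *\<^sub>R uvmon u v i j"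
proof -
  let ?F = "\<lambda>x y s t. if int n dvd snd y - snd x then cis (of_int (i - (fst y - fst x)) * s + of_int (j - (snd y - snd x)) * t)
      *\<^sub>C uvmon u v (fst y - fst x) (snd y - snd x) else 0"
  have "cis (of_int i * s + of_int j * t) *\<^sub>C nn (wave u v s t I) = (\<Sum>x\<in>I. \<Sum>y\<in>I. ?F x y s t)" for s t
    unfolding nn_wave[OF uv] scaleC_sum_right case_prod_unfold
    by (intro sum.cong refl) (auto simp: scaleC_scaleC cis_mult algebra_simps)
  hence "grid_sum N (\<lambda>s t. cis (of_int i * s + of_int j * t) *\<^sub>C nn (wave u v s t I)) =
     (\<Sum>p<2 * N. \<Sum>r<2 * N. \<Sum>x\<in>I. \<Sum>y\<in>I. ?F x y (grid N p) (grid N r))"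
    by (simp add: grid_sum_def)
  also have "\<dots> = (\<Sum>x\<in>I. \<Sum>y\<in>I. \<Sum>p<2 * N. \<Sum>r<2 * N. ?F x y (grid N p) (grid N r))"
    unfolding sum.swap[of _ I "{..<2 * N}"] ..
  also have "\<dots> = (\<Sum>x\<in>I. \<Sum>y\<in>I. if y = (fst x + i, snd x + j) then real ((2 * N)\<^sup>2) *\<^sub>R uvmon u v i j else 0)"
  proof (intro sum.cong refl)
    fix x y assume xy: "x \<in> I" "y \<in> I"
    let ?m = "i - (fst y - fst x)" and ?l = "j - (snd y - snd x)"
    have b: "\<bar>?m\<bar> < 2 * int N" "\<bar>?l\<bar> < 2 * int N"
      using bound[of "fst x" "snd x" "fst y" "snd y"] xy by auto
    have eq: "(?m = 0 \<and> ?l = 0) \<longleftrightarrow> y = (fst x + i, snd x + j)" by (cases y) auto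
    have "(\<Sum>p<2 * N. \<Sum>r<2 * N. ?F x y (grid N p) (grid N r)) = (if int n dvd snd y - snd x
      then grid_sum N (\<lambda>s t. cis (of_int ?m * s + of_int ?l * t)) *\<^sub>C uvmon u v (fst y - fst x) (snd y - snd x) else 0)"
      by (simp add: grid_sum_def scaleC_sum_left)
    thus "(\<Sum>p<2 * N. \<Sum>r<2 * N. ?F x y (grid N p) (grid N r)) =
      (if y = (fst x + i, snd x + j) then real ((2 * N)\<^sup>2) *\<^sub>R uvmon u v i j else 0)"
      unfolding grid_sum_cis[OF N b] eq using j by (auto simp: scaleR_scaleC)
  qed
  also have "\<dots> = (\<Sum>x\<in>I. if (fst x + i, snd x + j) \<in> I then real ((2 * N)\<^sup>2) *\<^sub>R uvmon u v i j else 0)"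
    using fin by (intro sum.cong refl) simp
  also have "\<dots> = (\<Sum>x\<in>{x\<in>I. (fst x + i, snd x + j) \<in> I}. real ((2 * N)\<^sup>2) *\<^sub>R uvmon u v i j)"
    using fin by (intro sum.inter_filter[symmetric])
  also have "{x\<in>I. (fst x + i, snd x + j) \<in> I} = {(a, b) \<in> I. (a + i, b + j) \<in> I}" by auto
  finally show ?thesis by (simp add: sum_constant_scaleR mult.commute del: sum_constant)
qed

definition index_box :: "nat \<Rightarrow> (int \<times> int) set" where
  "index_box N = {0..<int N} \<times> {0..<int N}"

lemma card_box_shift:
  "card {(a, b) \<in> index_box N. (a + i, b + j) \<in> index_box N} = nat (int N - \<bar>i\<bar>) * nat (int N - \<bar>j\<bar>)"
proof -
  have "{(a, b) \<in> index_box N. (a + i, b + j) \<in> index_box N} =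
    {max 0 (- i)..<min (int N) (int N - i)} \<times> {max 0 (- j)..<min (int N) (int N - j)}"
    by (auto simp: index_box_def)
  moreover have "min (int N) (int N - l) - max 0 (- l) = int N - \<bar>l\<bar>" for l by auto
  ultimately show ?thesis by (simp add: card_cartesian_product)
qed

lemma grid_sum_box:
  assumes uv: "unitary u" "unitary v" "u * v = cis \<theta> *\<^sub>C (v * u)"
    and "int n dvd j" "\<bar>i\<bar> < int N" "\<bar>j\<bar> < int N"
  shows "grid_sum N (\<lambda>s t. cis (of_int i * s + of_int j * t) *\<^sub>C nn (wave u v s t (index_box N))) =
    ((2 * real N)\<^sup>2 * ((real N - real_of_int \<bar>i\<bar>) * (real N - real_of_int \<bar>j\<bar>))) *\<^sub>R uvmon u v i j"
proof -
  have "grid_sum N (\<lambda>s t. cis (of_int i * s + of_int j * t) *\<^sub>C nn (wave u v s t (index_box N))) =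
    (real ((2 * N)\<^sup>2) * real (card {(a, b) \<in> index_box N. (a + i, b + j) \<in> index_box N})) *\<^sub>R uvmon u v i j"
    by (rule grid_sum_nn_wave[OF uv]) (use assms in \<open>auto simp: index_box_def\<close>)
  thus ?thesis using assms unfolding card_box_shift by (simp add: of_nat_nat)
qed

text \<open>The mass is the number \<open>(2 N)^2\<close> of nodes times the number
  \<open>N^2\<close> of indices in the box.\<close>

lemma grid_sum_nn_box:
  assumes uv: "unitary u" "unitary v" "u * v = cis \<theta> *\<^sub>C (v * u)" and "N > 0"
  shows "grid_sum N (\<lambda>s t. nn (wave u v s t (index_box N))) = (4 * real N ^ 4) *\<^sub>R 1"
  using grid_sum_box[OF uv, of 0 0 N] assms(4)
  by (simp add: scaleC_one uvmon_def power2_eq_square power4_eq_xxxx)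

lemma grid_sum_mono: "(\<And>s t. F s t \<preceq> G s t) \<Longrightarrow> grid_sum N F \<preceq> grid_sum N G"
  unfolding grid_sum_def by (intro cle_sum_mono)

lemma grid_sum_add: "grid_sum N (\<lambda>s t. F s t + G s t) = grid_sum N F + grid_sum N G"
  by (simp add: grid_sum_def sum.distrib)

lemma grid_sum_scaleR:
  "grid_sum N (\<lambda>s t. r *\<^sub>R F s t) = r *\<^sub>R (grid_sum N F :: 'a::unital_cstar_algebra)"
  by (simp add: grid_sum_def scaleR_sum_right)

text \<open>Telescoping: \<open>(1 - x) \<Sum>\<^sub>a x\<^sup>a = 1 - x\<^sup>N\<close>, and \<open>x\<^sup>N\<close> is isometric.\<close>

lemma Q_wave_le:
  assumes uv: "unitary u" "unitary v" "u * v = cis \<theta> *\<^sub>C (v * u)"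
  shows "Q u v s t (wave u v s t (index_box N)) \<preceq>
    4 *\<^sub>R nn (wave u v s t ({0} \<times> {0..<int N})) + 4 *\<^sub>R nn (wave u v s t ({0..<int N} \<times> {0}))"
proof -
  let ?W = "wave u v s t" and ?XY = "XY u v s t"
  have shift: "?XY c d (?W I) i = (\<Sum>(a, b)\<in>I. ?XY (a + c) (b + d) e0 i)" for c d I i
    unfolding wave_def case_prod_unfold XY_sum XY_XY[OF uv] by (simp add: add.commute)
  have tele: "(\<Sum>a\<in>{0..<int N}. f a - f (a + 1)) = f 0 - f (int N)" for f :: "int \<Rightarrow> 'a"
  proof (induction N)
    case (Suc N)
    have "{0..<int (Suc N)} = insert (int N) {0..<int N}" by auto
    thus ?case using Suc by (simp add: add.commute)
  qed simp
  have bd: "nn (\<lambda>i. ?W I i - ?XY c d (?W I) i) \<preceq> 4 *\<^sub>R nn (?W I)" for c d I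
    using nn_diff_le[of "?W I" "?XY c d (?W I)"] nn_XY[OF uv(1,2) per_wave]
    by (simp flip: scaleR_add_left)
  have "?W (index_box N) i - ?XY 1 0 (?W (index_box N)) i =
     ?W ({0} \<times> {0..<int N}) i - ?XY (int N) 0 (?W ({0} \<times> {0..<int N})) i" for i
  proof -
    have "?W (index_box N) i - ?XY 1 0 (?W (index_box N)) i =
      (\<Sum>a\<in>{0..<int N}. (\<Sum>b\<in>{0..<int N}. ?XY a b e0 i) - (\<Sum>b\<in>{0..<int N}. ?XY (a + 1) b e0 i))"
      unfolding shift by (simp add: wave_def index_box_def sum_subtractf sum.cartesian_product)
    also have "\<dots> = (\<Sum>b\<in>{0..<int N}. ?XY 0 b e0 i) - (\<Sum>b\<in>{0..<int N}. ?XY (int N) b e0 i)"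
      by (rule tele)
    finally show ?thesis unfolding shift by (simp add: wave_def sum.cartesian_product[symmetric])
  qed
  hence 1: "nn (\<lambda>i. ?W (index_box N) i - ?XY 1 0 (?W (index_box N)) i) \<preceq> 4 *\<^sub>R nn (?W ({0} \<times> {0..<int N}))"
    using bd by simp
  have "?W (index_box N) i - ?XY 0 1 (?W (index_box N)) i =
     ?W ({0..<int N} \<times> {0}) i - ?XY 0 (int N) (?W ({0..<int N} \<times> {0})) i" for i
  proof -
    have "?W (index_box N) i - ?XY 0 1 (?W (index_box N)) i =
      (\<Sum>a\<in>{0..<int N}. \<Sum>b\<in>{0..<int N}. ?XY a b e0 i - ?XY a (b + 1) e0 i)"
      unfolding shift by (simp add: wave_def index_box_def sum_subtractf sum.cartesian_product)
    also have "\<dots> = (\<Sum>a\<in>{0..<int N}. ?XY a 0 e0 i - ?XY a (int N) e0 i)"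
      by (intro sum.cong refl tele)
    finally show ?thesis unfolding shift
      by (simp add: wave_def sum.cartesian_product[symmetric] sum_subtractf)
  qed
  hence "nn (\<lambda>i. ?W (index_box N) i - ?XY 0 1 (?W (index_box N)) i) \<preceq> 4 *\<^sub>R nn (?W ({0..<int N} \<times> {0}))"
    using bd by simp
  with 1 show ?thesis unfolding Q_def by (rule cle_add_mono)
qed

text \<open>Each of the two boundary waves has N modes, hence mass \<open>4 N^3\<close>, and enters
  with the factor 4. Relative to the mass \<open>4 N^4\<close> of the full box the total is 8 /
  N.\<close>

lemma grid_sum_Q_le:
  assumes uv: "unitary u" "unitary v" "u * v = cis \<theta> *\<^sub>C (v * u)" and N: "N > 0"
  shows "grid_sum N (\<lambda>s t. Q u v s t (wave u v s t (index_box N))) \<preceq> (32 * real N ^ 3) *\<^sub>R 1"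
proof -
  have one: "grid_sum N (\<lambda>s t. nn (wave u v s t I)) = (4 * real N ^ 3) *\<^sub>R 1"
    if I: "I = {0} \<times> {0..<int N} \<or> I = {0..<int N} \<times> {0}" for I
  proof -
    have fin: "finite I" and card: "card I = N" using I by (auto simp: card_cartesian_product)
    have b: "\<bar>0 - (c - a)\<bar> < 2 * int N \<and> \<bar>0 - (d - b)\<bar> < 2 * int N"
      if "(a, b) \<in> I" "(c, d) \<in> I" for a b c d
      using I that by (elim disjE) auto
    have "{(a, b) \<in> I. (a + 0, b + 0) \<in> I} = I" by auto
    hence "grid_sum N (\<lambda>s t. cis (of_int 0 * s + of_int 0 * t) *\<^sub>C nn (wave u v s t I)) =
      (real ((2 * N)\<^sup>2) * real N) *\<^sub>R uvmon u v 0 0"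
      using grid_sum_nn_wave[OF uv N fin dvd_0_right b] card by (simp only:)
    thus ?thesis by (simp add: scaleC_one uvmon_def power2_eq_square power3_eq_cube)
  qed
  have "grid_sum N (\<lambda>s t. Q u v s t (wave u v s t (index_box N))) \<preceq>
    grid_sum N (\<lambda>s t. 4 *\<^sub>R nn (wave u v s t ({0} \<times> {0..<int N})) + 4 *\<^sub>R nn (wave u v s t ({0..<int N} \<times> {0})))"
    by (intro grid_sum_mono Q_wave_le uv)
  also have "\<dots> = (32 * real N ^ 3) *\<^sub>R 1"
    unfolding grid_sum_add grid_sum_scaleR by (simp add: one flip: scaleR_add_left)
  finally show ?thesis .
qed

lemma no_uniform_gap:
  fixes u v :: "'a::unital_cstar_algebra"
  assumes uv: "unitary u" "unitary v" "u * v = cis \<theta> *\<^sub>C (v * u)"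
    and gap: "\<And>s t w. per w \<Longrightarrow> e *\<^sub>R nn w \<preceq> Q u v s t w"
  shows "e \<le> 0"
proof (rule ccontr)
  assume "\<not> e \<le> 0"
  hence e: "e > 0" by simp
  \<comment> \<open>Averaging the gap over the grid gives \<open>e * 4 N^4 <= 32 N^3\<close>, that
    is \<open>e * N <= 8\<close>.\<close>
  obtain N :: nat where N: "8 / e < real N" using reals_Archimedean2 by blast
  hence N0: "N > 0" using e by (metis divide_nonneg_pos gr0I less_le_not_le less_numeral_extra(3) of_nat_0 zero_le_numeral)
  have "e *\<^sub>R grid_sum N (\<lambda>s t. nn (wave u v s t (index_box N))) \<preceq>
      grid_sum N (\<lambda>s t. Q u v s t (wave u v s t (index_box N)))"
    unfolding grid_sum_scaleR[symmetric] by (intro grid_sum_mono gap per_wave)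
  also have "\<dots> \<preceq> (32 * real N ^ 3) *\<^sub>R 1" by (rule grid_sum_Q_le[OF uv N0])
  finally have "pos ((32 * real N ^ 3 - e * (4 * real N ^ 4)) *\<^sub>R (1::'a))"
    unfolding grid_sum_nn_box[OF uv N0] cle_def by (simp add: algebra_simps)
  hence "e * (4 * real N ^ 4) \<le> 32 * real N ^ 3" by (simp add: pos_of_real_iff)
  hence "real N ^ 3 * (e * real N) \<le> real N ^ 3 * 8"
    by (simp add: power4_eq_xxxx power3_eq_cube mult_ac)
  hence "e * real N \<le> 8" using N0 by simp
  thus False using N e by (simp add: field_simps)
qed

end

section \<open>Transfer of positivity\<close>

context phase
begin

lemma per_mult: assumes "per w" shows "w (i + int n * b) = w i"
proof (induction b rule: int_induct[where k = 0])
  case (step1 b)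
  have "w (i + int n * (b + 1)) = w (i + int n * b + int n)" by (simp add: algebra_simps)
  thus ?case using step1 assms by (simp add: per_def)
next
  case (step2 b)
  have "w (i + int n * (b - 1)) = w (i + int n * (b - 1) + int n)" using assms by (simp add: per_def)
  also have "\<dots> = w (i + int n * b)" by (simp add: algebra_simps)
  finally show ?case using step2 by simp
qed simp

text \<open>For \<open>z = x^a y^b\<close> one has
  \<open>1 - z^(k + 1) = (1 - z^k) + z^k (1 - z)\<close> with \<open>z^k\<close> isometric; negative
  exponents reduce to positive ones by \<open>1 - z^m = z^m (z^(-m) - 1)\<close>. It matters that
  \<open>C\<close> does not depend on \<open>s\<close> and \<open>t\<close>.\<close>

lemma nn_XY_power_bound:
  fixes u v :: "'a::unital_cstar_algebra"
  assumes uv: "unitary u" "unitary v" "u * v = cis \<theta> *\<^sub>C (v * u)"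
  shows "\<exists>C\<ge>0. \<forall>s t w. per w \<longrightarrow>
    nn (\<lambda>i. w i - XY u v s t (m * a) (m * b) w i) \<preceq> C *\<^sub>R nn (\<lambda>i. w i - XY u v s t a b w i)"
proof -
  let ?P = "\<lambda>m C. \<forall>s t (w :: int \<Rightarrow> 'a). per w \<longrightarrow>
    nn (\<lambda>i. w i - XY u v s t (m * a) (m * b) w i) \<preceq> C *\<^sub>R nn (\<lambda>i. w i - XY u v s t a b w i)"
  have nat: "\<exists>C\<ge>0. ?P (int k) C" for k
  proof (induction k)
    case 0
    have "nn (\<lambda>i. 0 :: 'a) = 0" by (simp add: nn_def asq_def)
    thus ?case by (intro exI[of _ 0]) (auto simp: XY_0)
  next
    case (Suc k)
    then obtain C where C: "C \<ge> 0" "?P (int k) C" by blast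
    have "?P (int (Suc k)) (2 * C + 2)"
    proof (intro allI impI)
      fix s t and w :: "int \<Rightarrow> 'a" assume w: "per w"
      let ?X = "XY u v s t (int k * a) (int k * b)" and ?d = "\<lambda>i. w i - XY u v s t a b w i"
      have "w i - XY u v s t (int (Suc k) * a) (int (Suc k) * b) w i = (w i - ?X w i) + ?X ?d i" for i
        unfolding XY_diff XY_XY[OF uv] by (simp add: algebra_simps)
      hence "nn (\<lambda>i. w i - XY u v s t (int (Suc k) * a) (int (Suc k) * b) w i) =
          nn (\<lambda>i. (w i - ?X w i) + ?X ?d i)" by (simp only:)
      also have "\<dots> \<preceq> 2 *\<^sub>R nn (\<lambda>i. w i - ?X w i) + 2 *\<^sub>R nn (?X ?d)" by (rule nn_add_le)
      also have "nn (?X ?d) = nn ?d" by (intro nn_XY uv per_diff per_XY w)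
      also have "2 *\<^sub>R nn (\<lambda>i. w i - ?X w i) + 2 *\<^sub>R nn ?d \<preceq> 2 *\<^sub>R (C *\<^sub>R nn ?d) + 2 *\<^sub>R nn ?d"
        using C(2) w by (intro cle_add_mono cle_scaleR_mono) auto
      finally show "nn (\<lambda>i. w i - XY u v s t (int (Suc k) * a) (int (Suc k) * b) w i) \<preceq> (2 * C + 2) *\<^sub>R nn ?d"
        by (simp add: scaleR_add_left)
    qed
    thus ?case using C(1) by (intro exI[of _ "2 * C + 2"]) auto
  qed
  show ?thesis
  proof (cases "m \<ge> 0")
    case True
    thus ?thesis using nat[of "nat m"] by simp
  next
    case False
    then obtain C where C: "C \<ge> 0" "?P (- m) C" using nat[of "nat (- m)"] by auto
    have "?P m C"
    proof (intro allI impI)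
      fix s t and w :: "int \<Rightarrow> 'a" assume w: "per w"
      let ?X = "XY u v s t (m * a) (m * b)" and ?Y = "XY u v s t (- m * a) (- m * b)"
      have "?X (\<lambda>i. ?Y w i - w i) = (\<lambda>i. w i - ?X w i)"
        unfolding XY_diff XY_XY[OF uv] by (simp add: XY_0)
      moreover have "nn (?X (\<lambda>i. ?Y w i - w i)) = nn (\<lambda>i. ?Y w i - w i)"
        by (intro nn_XY uv per_diff per_XY w)
      ultimately have "nn (\<lambda>i. w i - ?X w i) = nn (\<lambda>i. w i - ?Y w i)"
        by (simp add: nn_diff_commute)
      thus "nn (\<lambda>i. w i - ?X w i) \<preceq> C *\<^sub>R nn (\<lambda>i. w i - XY u v s t a b w i)"
        using C(2) w by simp
    qed
    thus ?thesis using C(1) by blast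
  qed
qed

text \<open>When n divides both exponents, the clock and shift factors of \<open>x^i y^j\<close> are
  trivial, so up to a phase it is left multiplication by \<open>u^i v^j\<close>. Vectors nearly
  fixed by \<open>x\<close> and \<open>y\<close> are therefore nearly eigenvectors of that
  multiplication.\<close>

lemma nn_central_uvmon_bound:
  fixes u v :: "'a::unital_cstar_algebra"
  assumes uv: "unitary u" "unitary v" "u * v = cis \<theta> *\<^sub>C (v * u)"
    and dvd: "int n dvd i" "int n dvd j"
  shows "\<exists>C\<ge>0. \<forall>s t w. per w \<longrightarrow>
    nn (\<lambda>l. (c *\<^sub>C uvmon u v i j) * w l - (c * cis (of_int i * s + of_int j * t)) *\<^sub>C w l) \<preceq> C *\<^sub>R Q u v s t w"
proof -
  obtain C1 where C1: "C1 \<ge> 0" "\<And>s t (w::int\<Rightarrow>'a). per w \<Longrightarrow>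
    nn (\<lambda>l. w l - XY u v s t i 0 w l) \<preceq> C1 *\<^sub>R nn (\<lambda>l. w l - XY u v s t 1 0 w l)"
    using nn_XY_power_bound[OF uv, of i 1 0] by auto
  obtain C2 where C2: "C2 \<ge> 0" "\<And>s t (w::int\<Rightarrow>'a). per w \<Longrightarrow>
    nn (\<lambda>l. w l - XY u v s t 0 j w l) \<preceq> C2 *\<^sub>R nn (\<lambda>l. w l - XY u v s t 0 1 w l)"
    using nn_XY_power_bound[OF uv, of j 0 1] by auto
  define C where "C = (cmod c)\<^sup>2 * (2 * C1 + 2 * C2)"
  have "nn (\<lambda>l. (c *\<^sub>C uvmon u v i j) * w l - (c * cis (of_int i * s + of_int j * t)) *\<^sub>C w l) \<preceq> C *\<^sub>R Q u v s t w"
    if w: "per w" for s t and w :: "int \<Rightarrow> 'a"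
  proof -
    let ?z = "cis (of_int i * s + of_int j * t)" and ?X = "XY u v s t i 0" and ?Y = "XY u v s t 0 j"
    let ?dx = "\<lambda>l. w l - XY u v s t 1 0 w l" and ?dy = "\<lambda>l. w l - XY u v s t 0 1 w l"
    have XYij: "?z *\<^sub>C XY u v s t i j w l = uvmon u v i j * w l" for l
    proof -
      obtain a where a: "i = int n * a" using dvd by blast
      have "cis (of_int l * of_int i * \<theta>) = cis (of_int (int n * (l * a)) * \<theta>)"
        by (simp add: a mult_ac)
      also have "\<dots> = 1" by (rule cis_period)
      finally have 1: "cis (of_int l * of_int i * \<theta>) = 1" .
      have "w (l + j) = w l" using dvd(2) per_mult[OF w] by auto
      moreover have "?z * cis (of_int l * of_int i * \<theta> - of_int i * s - of_int j * t) =
        cis (of_int l * of_int i * \<theta>)" by (simp add: cis_mult)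
      ultimately show ?thesis by (simp add: XY_def uvmon_def scaleC_scaleC 1 scaleC_one)
    qed
    have "(c *\<^sub>C uvmon u v i j) * w l - (c * ?z) *\<^sub>C w l = (- (c * ?z)) *\<^sub>C (w l - XY u v s t i j w l)" for l
      by (simp add: mult_scaleC_left scaleC_diff_right scaleC_minus_left XYij flip: scaleC_scaleC)
    hence "nn (\<lambda>l. (c *\<^sub>C uvmon u v i j) * w l - (c * ?z) *\<^sub>C w l) =
        (cmod c)\<^sup>2 *\<^sub>R nn (\<lambda>l. w l - XY u v s t i j w l)"
      by (simp add: nn_scaleC norm_mult)
    also have "\<dots> = (cmod c)\<^sup>2 *\<^sub>R nn (\<lambda>l. (w l - ?X w l) + ?X (\<lambda>l. w l - ?Y w l) l)"
      unfolding XY_diff XY_XY[OF uv] by simp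
    also have "\<dots> \<preceq> (cmod c)\<^sup>2 *\<^sub>R (2 *\<^sub>R nn (\<lambda>l. w l - ?X w l) + 2 *\<^sub>R nn (?X (\<lambda>l. w l - ?Y w l)))"
      by (intro cle_scaleR_mono nn_add_le) simp
    also have "nn (?X (\<lambda>l. w l - ?Y w l)) = nn (\<lambda>l. w l - ?Y w l)"
      by (intro nn_XY uv per_diff per_XY w)
    also have "(cmod c)\<^sup>2 *\<^sub>R (2 *\<^sub>R nn (\<lambda>l. w l - ?X w l) + 2 *\<^sub>R nn (\<lambda>l. w l - ?Y w l)) \<preceq>
      (cmod c)\<^sup>2 *\<^sub>R (2 *\<^sub>R C1 *\<^sub>R nn ?dx + 2 *\<^sub>R C2 *\<^sub>R nn ?dy)"
      using C1 C2 w by (intro cle_scaleR_mono cle_add_mono) auto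
    also have "\<dots> \<preceq> (cmod c)\<^sup>2 *\<^sub>R ((2 * C1 + 2 * C2) *\<^sub>R nn ?dx + (2 * C1 + 2 * C2) *\<^sub>R nn ?dy)"
      unfolding scaleR_scaleR
      using C1 C2 by (intro cle_scaleR_mono[OF cle_add_mono] cle_scaleR_pos) auto
    also have "\<dots> = C *\<^sub>R Q u v s t w" by (simp add: C_def Q_def scaleR_add_right)
    finally show ?thesis .
  qed
  moreover have "C \<ge> 0" using C1 C2 by (simp add: C_def)
  ultimately show ?thesis by blast
qed

section \<open>Averages over conjugations by monomials\<close>

lemma star_uvmon_uvmon:
  assumes "unitary u" "unitary v"
  shows "star (uvmon u v a b) * uvmon u v a b = 1"
  using unitary_mult[OF unitary_upow unitary_upow, OF assms] by (simp add: unitary_def uvmon_def)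

lemma uvmon_mult:
  assumes uv: "unitary u" "unitary v" "u * v = cis \<theta> *\<^sub>C (v * u)"
  shows "uvmon u v i j * uvmon u v a b = cis (- (of_int a * of_int j * \<theta>)) *\<^sub>C uvmon u v (i + a) (j + b)"
proof -
  have "uvmon u v i j * uvmon u v a b = upow u i * (upow v j * upow u a) * upow v b"
    by (simp add: uvmon_def mult.assoc)
  thus ?thesis unfolding upow_upow_commute[OF uv]
    by (simp add: uvmon_def mult_scaleC_left mult_scaleC_right upow_add[OF uv(1)] upow_add[OF uv(2)] mult.assoc)
qed

lemma star_uvmon:
  assumes uv: "unitary u" "unitary v" "u * v = cis \<theta> *\<^sub>C (v * u)"
  shows "star (uvmon u v i j) = cis (- (of_int i * of_int j * \<theta>)) *\<^sub>C uvmon u v (- i) (- j)"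
  using upow_upow_commute[OF uv, of "- j" "- i"]
  by (simp add: uvmon_def star_mult star_upow uv)

text \<open>On Laurent polynomials this is \<open>n^2\<close> times the projection to exponents
  divisible by n. It is left unnormalised so that a positive \<open>x\<close>, being the summand for
  \<open>a = b = 0\<close>, lies below its average.\<close>

definition avg :: "'a::unital_cstar_algebra \<Rightarrow> 'a \<Rightarrow> 'a \<Rightarrow> 'a" where
  "avg u v x = (\<Sum>a<n. \<Sum>b<n. star (uvmon u v (int a) (int b)) * x * uvmon u v (int a) (int b))"

lemma avg_add: "avg u v (x + y) = avg u v x + avg u v y"
  by (simp add: avg_def distrib_left distrib_right sum.distrib)

lemma avg_minus: "avg u v (- x) = - avg u v x"
  by (simp add: avg_def sum_negf)

lemma star_avg: "star (avg u v x) = avg u v (star x)"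
  by (simp add: avg_def star_simps mult.assoc)

lemma pos_avg: "pos x \<Longrightarrow> pos (avg u v x)"
  unfolding avg_def by (intro pos_sum pos_conj)

lemma le_avg: assumes "pos x" shows "x \<preceq> avg u v x"
proof -
  let ?f = "\<lambda>a b. star (uvmon u v (int a) (int b)) * x * uvmon u v (int a) (int b)"
  have 0: "0 \<in> {..<n}" using n_pos by auto
  have "avg u v x = ?f 0 0 + (\<Sum>b\<in>{..<n} - {0}. ?f 0 b) + (\<Sum>a\<in>{..<n} - {0}. \<Sum>b<n. ?f a b)"
    unfolding avg_def using 0 by (simp add: sum.remove[of "{..<n}" 0])
  moreover have "pos ((\<Sum>b\<in>{..<n} - {0}. ?f 0 b) + (\<Sum>a\<in>{..<n} - {0}. \<Sum>b<n. ?f a b))"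
    by (intro pos_add pos_sum pos_conj assms)
  ultimately show ?thesis by (simp add: cle_def uvmon_def)
qed

lemma tendsto_avg: "(f \<longlongrightarrow> l) F \<Longrightarrow> ((\<lambda>x. avg u v (f x)) \<longlongrightarrow> avg u v l) F"
  unfolding avg_def by (intro tendsto_intros)

lemma sum_cis_phase: "(\<Sum>a<n. cis (of_int (m * int a) * \<theta>)) = (if int n dvd m then of_nat n else 0)"
proof -
  define z where "z = cis (of_int m * \<theta>)"
  have z: "cis (of_int (m * int a) * \<theta>) = z ^ a" for a
    by (simp add: z_def Complex.DeMoivre mult_ac)
  have "z ^ n = cis (of_int (int n * m) * \<theta>)" by (simp add: z_def Complex.DeMoivre mult_ac)
  hence zn: "z ^ n = 1" by (simp only: cis_period)
  have "z = 1 \<longleftrightarrow> int n dvd m" by (simp add: z_def cis_eq_1_iff)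
  thus ?thesis unfolding z using geometric_sum[of z n] zn by auto
qed

text \<open>Conjugation by \<open>u^a v^b\<close> multiplies \<open>u^i v^j\<close> by
  \<open>cis ((i b - j a) \<theta>)\<close>; the sums over \<open>a\<close> and \<open>b\<close> run
  through full periods and vanish unless n divides both exponents.\<close>

lemma avg_uvmon:
  assumes uv: "unitary u" "unitary v" "u * v = cis \<theta> *\<^sub>C (v * u)"
  shows "avg u v (c *\<^sub>C uvmon u v i j) = (if int n dvd i \<and> int n dvd j then of_nat (n\<^sup>2) * c else 0) *\<^sub>C uvmon u v i j"
proof -
  have conj: "star (uvmon u v a b) * uvmon u v i j * uvmon u v a b =
    cis (of_int (i * b) * \<theta>) *\<^sub>C (cis (of_int (- j * a) * \<theta>) *\<^sub>C uvmon u v i j)" for a b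
  proof -
    have "uvmon u v i j * uvmon u v a b = cis (of_int (i * b) * \<theta>) *\<^sub>C
      (cis (of_int (- j * a) * \<theta>) *\<^sub>C (uvmon u v a b * uvmon u v i j))"
      unfolding uvmon_mult[OF uv] scaleC_scaleC cis_mult by (simp add: algebra_simps)
    thus ?thesis
      by (simp add: mult.assoc mult_scaleC_right) (simp add: star_uvmon_uvmon uv flip: mult.assoc)
  qed
  have "avg u v (c *\<^sub>C uvmon u v i j) =
    (\<Sum>a<n. \<Sum>b<n. c *\<^sub>C (cis (of_int (i * int b) * \<theta>) *\<^sub>C (cis (of_int (- j * int a) * \<theta>) *\<^sub>C uvmon u v i j)))"
    unfolding avg_def by (simp add: mult_scaleC_left mult_scaleC_right conj del: of_int_mult)
  also have "\<dots> = c *\<^sub>C ((\<Sum>b<n. cis (of_int (i * int b) * \<theta>)) *\<^sub>C ((\<Sum>a<n. cis (of_int (- j * int a) * \<theta>)) *\<^sub>C uvmon u v i j))"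
    by (simp only: scaleC_sum_left[symmetric] scaleC_sum_right[symmetric])
  also have "\<dots> = (if int n dvd i \<and> int n dvd j then of_nat (n\<^sup>2) * c else 0) *\<^sub>C uvmon u v i j"
    unfolding sum_cis_phase by (simp add: scaleC_scaleC power2_eq_square mult_ac)
  finally show ?thesis .
qed

end

text \<open>Within the locale n-positivity survives only as the passage of gaps from one pair to the
  other, so the locale can be used for a map and for its inverse.\<close>

locale phase_transfer = phase n \<theta> for n \<theta> +
  fixes u' v' :: "'a::unital_cstar_algebra" and u v :: "'b::unital_cstar_algebra"
  assumes uv': "unitary u'" "unitary v'" "u' * v' = cis \<theta> *\<^sub>C (v' * u')"
    and uv: "unitary u" "unitary v" "u * v = cis \<theta> *\<^sub>C (v * u)"
    and transfer: "\<And>s t e. e > 0 \<Longrightarrow> (\<And>w. per w \<Longrightarrow> e *\<^sub>R nn w \<preceq> Q u' v' s t w) \<Longrightarrow>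
      per w \<Longrightarrow> e *\<^sub>R nn w \<preceq> Q u v s t w"
begin

text \<open>Corresponding Laurent polynomials in \<open>(u'\<^sup>n, v'\<^sup>n)\<close> and \<open>(u\<^sup>n, v\<^sup>n)\<close>, together with their
  value at the point \<open>(exp (\<i> s), exp (\<i> t))\<close> substituted for \<open>(u, v)\<close>.\<close>

inductive central :: "'a \<Rightarrow> 'b \<Rightarrow> (real \<Rightarrow> real \<Rightarrow> complex) \<Rightarrow> bool" where
  uvmon: "int n dvd i \<Longrightarrow> int n dvd j \<Longrightarrow>
    central (c *\<^sub>C uvmon u' v' i j) (c *\<^sub>C uvmon u v i j) (\<lambda>s t. c * cis (of_int i * s + of_int j * t))"
| add: "central x' x f \<Longrightarrow> central y' y g \<Longrightarrow> central (x' + y') (x + y) (\<lambda>s t. f s t + g s t)"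

text \<open>On vectors with small \<open>Q\<close> a central Laurent polynomial acts nearly as its
  value at the point. The bound is additive over monomials, with a constant uniform in the
  point.\<close>

lemma central_localise:
  assumes "central x' x f"
  shows "\<exists>C\<ge>0. \<forall>s t w. per w \<longrightarrow> nn (\<lambda>l. x' * w l - f s t *\<^sub>C w l) \<preceq> C *\<^sub>R Q u' v' s t w"
  using assms
proof induction
  case (uvmon i j c)
  show ?case by (rule nn_central_uvmon_bound[OF uv' uvmon])
next
  case (add x' x f y' y g)
  then obtain C D where C: "C \<ge> 0" "\<And>s t (w::int \<Rightarrow> 'a). per w \<Longrightarrow> nn (\<lambda>l. x' * w l - f s t *\<^sub>C w l) \<preceq> C *\<^sub>R Q u' v' s t w"
    and D: "D \<ge> 0" "\<And>s t (w::int \<Rightarrow> 'a). per w \<Longrightarrow> nn (\<lambda>l. y' * w l - g s t *\<^sub>C w l) \<preceq> D *\<^sub>R Q u' v' s t w"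
    by blast
  have "nn (\<lambda>l. (x' + y') * w l - (f s t + g s t) *\<^sub>C w l) \<preceq> (2 * C + 2 * D) *\<^sub>R Q u' v' s t w"
    if w: "per w" for s t and w :: "int \<Rightarrow> 'a"
  proof -
    have "nn (\<lambda>l. (x' + y') * w l - (f s t + g s t) *\<^sub>C w l) =
      nn (\<lambda>l. (x' * w l - f s t *\<^sub>C w l) + (y' * w l - g s t *\<^sub>C w l))"
      by (simp add: algebra_simps scaleC_add_left)
    also have "\<dots> \<preceq> 2 *\<^sub>R nn (\<lambda>l. x' * w l - f s t *\<^sub>C w l) + 2 *\<^sub>R nn (\<lambda>l. y' * w l - g s t *\<^sub>C w l)"
      by (rule nn_add_le)
    also have "\<dots> \<preceq> 2 *\<^sub>R C *\<^sub>R Q u' v' s t w + 2 *\<^sub>R D *\<^sub>R Q u' v' s t w"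
      using C D w by (intro cle_add_mono cle_scaleR_mono) auto
    finally show ?thesis by (simp add: scaleR_add_left)
  qed
  thus ?case using C(1) D(1) by (intro exI[of _ "2 * C + 2 * D"]) auto
qed

lemma central_bounded:
  assumes "central x' x f"
  shows "\<exists>F\<ge>0. \<forall>s t. cmod (f s t) \<le> F"
  using assms
proof induction
  case (uvmon i j c)
  show ?case by (intro exI[of _ "cmod c"]) (simp add: norm_mult)
next
  case (add x' x f y' y g)
  then obtain F G where "F \<ge> 0" "\<And>s t. cmod (f s t) \<le> F" "G \<ge> 0" "\<And>s t. cmod (g s t) \<le> G" by blast
  thus ?case
    by (intro exI[of _ "F + G"] conjI allI add_nonneg_nonneg norm_triangle_le add_mono)
qed

definition fejer_mean :: "(real \<Rightarrow> real \<Rightarrow> complex) \<Rightarrow> nat \<Rightarrow> 'b" where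
  "fejer_mean f N = (1 / (4 * real N ^ 4)) *\<^sub>R
    grid_sum N (\<lambda>s t. f s t *\<^sub>C nn (wave u v s t (index_box N)))"

text \<open>For large \<open>N\<close> the mean multiplies a monomial by Fejer's factor
  \<open>(1 - |i| / N) (1 - |j| / N)\<close>.\<close>

lemma fejer_mean_LIMSEQ:
  assumes "central x' x f"
  shows "fejer_mean f \<longlonglongrightarrow> x"
  using assms
proof induction
  case (uvmon i j c)
  let ?r = "\<lambda>N. (1 - real_of_int \<bar>i\<bar> / real N) * (1 - real_of_int \<bar>j\<bar> / real N)"
  have "?r \<longlonglongrightarrow> (1 - 0) * (1 - 0)" by (intro tendsto_intros lim_const_over_n)
  hence "(\<lambda>N. ?r N *\<^sub>R (c *\<^sub>C uvmon u v i j)) \<longlonglongrightarrow> 1 *\<^sub>R (c *\<^sub>C uvmon u v i j)"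
    by (intro tendsto_intros) simp
  moreover have "eventually (\<lambda>N. ?r N *\<^sub>R (c *\<^sub>C uvmon u v i j) =
      fejer_mean (\<lambda>s t. c * cis (of_int i * s + of_int j * t)) N) sequentially"
  proof (rule eventually_mono[OF eventually_gt_at_top[of "nat \<bar>i\<bar> + nat \<bar>j\<bar>"]])
    fix N assume N: "nat \<bar>i\<bar> + nat \<bar>j\<bar> < N"
    hence N0: "real N > 0" by simp
    have "grid_sum N (\<lambda>s t. (c * cis (of_int i * s + of_int j * t)) *\<^sub>C nn (wave u v s t (index_box N))) =
      c *\<^sub>C grid_sum N (\<lambda>s t. cis (of_int i * s + of_int j * t) *\<^sub>C nn (wave u v s t (index_box N)))"
      by (simp add: grid_sum_def scaleC_sum_right scaleC_scaleC)
    also have "\<dots> = ((2 * real N)\<^sup>2 * ((real N - real_of_int \<bar>i\<bar>) * (real N - real_of_int \<bar>j\<bar>))) *\<^sub>R (c *\<^sub>C uvmon u v i j)"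
      unfolding scaleC_scaleR[symmetric] by (subst grid_sum_box[OF uv]) (use uvmon N in auto)
    moreover have "1 / (4 * real N ^ 4) * ((2 * real N)\<^sup>2 * ((real N - real_of_int \<bar>i\<bar>) * (real N - real_of_int \<bar>j\<bar>))) = ?r N"
      using N0 by (simp add: field_simps power2_eq_square power4_eq_xxxx)
    ultimately show "?r N *\<^sub>R (c *\<^sub>C uvmon u v i j) = fejer_mean (\<lambda>s t. c * cis (of_int i * s + of_int j * t)) N"
      by (simp add: fejer_mean_def)
  qed
  ultimately show ?case by (simp add: Lim_transform_eventually)
next
  case (add x' x f y' y g)
  have "fejer_mean (\<lambda>s t. f s t + g s t) = (\<lambda>N. fejer_mean f N + fejer_mean g N)"
    by (auto simp: fejer_mean_def scaleC_add_left grid_sum_add scaleR_add_right)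
  thus ?case using add.IH by (auto intro: tendsto_add)
qed

text \<open>The square of \<open>x' - z\<close> expands to
  \<open>x'^2 - 2 (Re z) x' + |z|^2\<close>; here the middle term is positive and the last is at
  least \<open>d^2\<close>.\<close>

lemma gap_if_negative_symbol:
  assumes "pos x'" "Re z \<le> - d" "d > 0"
  shows "d\<^sup>2 *\<^sub>R nn w \<preceq> nn (\<lambda>l. x' * w l - z *\<^sub>C (w l :: 'a))"
proof -
  have sx: "star x' = x'" using assms(1) by (rule pos_selfadjoint)
  have "d\<^sup>2 *\<^sub>R 1 \<preceq> asq (x' - z *\<^sub>C 1)"
  proof -
    have "asq (x' - z *\<^sub>C 1) = x' * x' - (z + cnj z) *\<^sub>C x' + (z * cnj z) *\<^sub>C 1"
      by (simp add: asq_def star_simps sx algebra_simps mult_scaleC_left mult_scaleC_right scaleC_scaleC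
          scaleC_add_left scaleC_diff_right mult.commute)
    also have "\<dots> = x' * x' + (- 2 * Re z) *\<^sub>R x' + (cmod z)\<^sup>2 *\<^sub>R 1"
      unfolding complex_add_cnj complex_norm_square[symmetric] scaleR_scaleC[symmetric] by simp
    finally have eq: "asq (x' - z *\<^sub>C 1) - d\<^sup>2 *\<^sub>R 1 = x' * x' + (- 2 * Re z) *\<^sub>R x' + ((cmod z)\<^sup>2 - d\<^sup>2) *\<^sub>R 1"
      by (simp add: scaleR_diff_left)
    have "d \<le> \<bar>Re z\<bar>" using assms by simp
    hence "d \<le> cmod z" using abs_Re_le_cmod order_trans by blast
    hence "d\<^sup>2 \<le> (cmod z)\<^sup>2" using assms(3) by (intro power_mono) auto
    thus ?thesis unfolding cle_def eq using assms sx
      by (intro pos_add pos_square pos_scaleR) (auto simp: pos_of_real_iff)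
  qed
  from cle_conj[OF this] have "d\<^sup>2 *\<^sub>R asq y \<preceq> asq (x' * y - z *\<^sub>C y)" for y
    by (simp add: asq_def star_simps mult.assoc left_diff_distrib mult_scaleC_left)
       (simp add: algebra_simps mult_scaleC_left mult_scaleC_right)
  thus ?thesis unfolding nn_def scaleR_sum_right by (intro cle_sum_mono)
qed

text \<open>Where the symbol is at most \<open>- d\<close>, the form \<open>Q u' v'\<close>, hence \<open>Q u v\<close>, has a gap, and
  the Fejer kernel gives such points a total weight of order \<open>1 / N\<close>.\<close>

lemma central_pos:
  assumes c: "central x' x f" and x': "pos x'" and sx: "star x = x"
  shows "pos x"
proof -
  obtain C0 where C0: "C0 \<ge> 0" "\<And>s t (w::int\<Rightarrow>'a). per w \<Longrightarrow> nn (\<lambda>l. x' * w l - f s t *\<^sub>C w l) \<preceq> C0 *\<^sub>R Q u' v' s t w"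
    using central_localise[OF c] by blast
  \<comment> \<open>Adding 1 makes \<open>C\<close> positive, so that it can be divided by.\<close>
  define C where "C = C0 + 1"
  have C: "C > 0" "nn (\<lambda>l. x' * w l - f s t *\<^sub>C w l) \<preceq> C *\<^sub>R Q u' v' s t w" if "per w" for s t and w :: "int \<Rightarrow> 'a"
    using C0(1) cle_trans[OF C0(2)[OF that] cle_scaleR_pos[OF pos_Q, of C0 C]] by (auto simp: C_def)
  have C_pos: "C > 0" using C0(1) by (simp add: C_def)
  obtain F where F: "F \<ge> 0" "\<And>s t. cmod (f s t) \<le> F" using central_bounded[OF c] by blast
  have step: "pos (x + d *\<^sub>R 1)" if d: "d > 0" for d :: real
  proof -
    \<comment> \<open>Where the symbol has real part at most \<open>- d\<close>, localisation gives
      \<open>d^2 nn w <= C Q\<close>, so this is the size of the gap there.\<close>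
    define e where "e = d\<^sup>2 / C"
    have e: "e > 0" using d C_pos by (simp add: e_def)
    let ?W = "\<lambda>N s t. wave u v s t (index_box N)"
    \<comment> \<open>One inequality for all points: where the real part is at most
      \<open>- d\<close>, the gap lets \<open>(F / e) Q\<close> outweigh \<open>F nn w\<close>,
      hence the negative part; elsewhere the \<open>Q\<close> term only helps.\<close>
    have low: "(- d) *\<^sub>R nn w + (- (F / e)) *\<^sub>R Q u v s t w \<preceq> Re (f s t) *\<^sub>R nn w" if w: "per w" for s t w
    proof (cases "Re (f s t) \<le> - d")
      case True
      have gap: "e *\<^sub>R nn w' \<preceq> Q u' v' s t w'" if "per w'" for w' :: "int \<Rightarrow> 'a"
      proof -
        have "d\<^sup>2 *\<^sub>R nn w' \<preceq> C *\<^sub>R Q u' v' s t w'"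
          using gap_if_negative_symbol[OF x' True d] C(2)[OF that] cle_trans by blast
        hence "(1 / C) *\<^sub>R d\<^sup>2 *\<^sub>R nn w' \<preceq> (1 / C) *\<^sub>R C *\<^sub>R Q u' v' s t w'"
          using C_pos by (intro cle_scaleR_mono) auto
        thus ?thesis using C_pos by (simp add: e_def)
      qed
      have "pos (Q u v s t w - e *\<^sub>R nn w)" using transfer[OF e gap w] by (simp add: cle_def)
      moreover have "Re (f s t) + F \<ge> 0" using abs_Re_le_cmod[of "f s t"] F(2)[of s t] by linarith
      ultimately have "pos ((F / e) *\<^sub>R (Q u v s t w - e *\<^sub>R nn w) + (Re (f s t) + F) *\<^sub>R nn w + d *\<^sub>R nn w)"
        using e F(1) d by (intro pos_add pos_scaleR) auto
      thus ?thesis using e unfolding cle_def by (simp add: algebra_simps)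
    next
      case False
      hence "pos ((Re (f s t) + d) *\<^sub>R nn w + (F / e) *\<^sub>R Q u v s t w)"
        using F e by (intro pos_add pos_scaleR) auto
      thus ?thesis unfolding cle_def by (simp add: algebra_simps)
    qed
    \<comment> \<open>The error is \<open>(F / e) * 32 N^3\<close> divided by the mass
      \<open>4 N^4\<close>.\<close>
    have mean: "(- d - 8 * F / (e * real N)) *\<^sub>R 1 \<preceq>
      (1 / 2) *\<^sub>R (fejer_mean f N + star (fejer_mean f N))" if N: "N > 0" for N
    proof -
      have "(1 / 2) *\<^sub>R (fejer_mean f N + star (fejer_mean f N)) =
        (1 / (4 * real N ^ 4)) *\<^sub>R grid_sum N (\<lambda>s t. Re (f s t) *\<^sub>R nn (?W N s t))"
      proof -
        have "(1 / 2) *\<^sub>R (z *\<^sub>C y + star (z *\<^sub>C y)) = Re z *\<^sub>R y" if "pos y" for z and y :: 'b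
        proof -
          have "z *\<^sub>C y + star (z *\<^sub>C y) = (z + cnj z) *\<^sub>C y"
            using pos_selfadjoint[OF that] by (simp add: star_scaleC scaleC_add_left)
          also have "\<dots> = (2 * Re z) *\<^sub>R y" unfolding complex_add_cnj scaleR_scaleC ..
          finally show ?thesis by simp
        qed
        from this[OF pos_nn, symmetric] show ?thesis
          by (simp add: fejer_mean_def star_simps grid_sum_def scaleR_sum_right sum.distrib scaleR_add_right mult.commute)
      qed
      moreover have "(- d * (4 * real N ^ 4)) *\<^sub>R 1 + (- (F / e) * (32 * real N ^ 3)) *\<^sub>R 1 \<preceq>
        grid_sum N (\<lambda>s t. Re (f s t) *\<^sub>R nn (?W N s t))"
      proof -
        have "pos ((F / e) *\<^sub>R ((32 * real N ^ 3) *\<^sub>R 1 - grid_sum N (\<lambda>s t. Q u v s t (?W N s t))))"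
          using grid_sum_Q_le[OF uv N] F e by (intro pos_scaleR) (auto simp: cle_def)
        hence "(- (F / e) * (32 * real N ^ 3)) *\<^sub>R 1 \<preceq> (- (F / e)) *\<^sub>R grid_sum N (\<lambda>s t. Q u v s t (?W N s t))"
          unfolding cle_def by (simp add: algebra_simps)
        hence "(- d * (4 * real N ^ 4)) *\<^sub>R 1 + (- (F / e) * (32 * real N ^ 3)) *\<^sub>R 1 \<preceq>
          grid_sum N (\<lambda>s t. (- d) *\<^sub>R nn (?W N s t) + (- (F / e)) *\<^sub>R Q u v s t (?W N s t))"
          unfolding grid_sum_add grid_sum_scaleR grid_sum_nn_box[OF uv N]
          by (intro cle_add_mono) auto
        also have "\<dots> \<preceq> grid_sum N (\<lambda>s t. Re (f s t) *\<^sub>R nn (?W N s t))"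
          by (intro grid_sum_mono low per_wave)
        finally show ?thesis .
      qed
      hence "(1 / (4 * real N ^ 4)) *\<^sub>R ((- d * (4 * real N ^ 4)) *\<^sub>R 1 + (- (F / e) * (32 * real N ^ 3)) *\<^sub>R 1) \<preceq>
        (1 / (4 * real N ^ 4)) *\<^sub>R grid_sum N (\<lambda>s t. Re (f s t) *\<^sub>R nn (?W N s t))"
        by (intro cle_scaleR_mono) auto
      moreover have "1 / (4 * real N ^ 4) * (- d * (4 * real N ^ 4) + - (F / e) * (32 * real N ^ 3)) = - d - 8 * F / (e * real N)"
        using N e by (simp add: field_simps power4_eq_xxxx power3_eq_cube)
      ultimately show ?thesis unfolding scaleR_add_left[symmetric] scaleR_scaleR by (simp only:)
    qed
    \<comment> \<open>\<open>N\<close> goes to infinity for fixed \<open>d\<close>, because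
      \<open>e\<close> depends on \<open>d\<close>; letting \<open>d\<close> tend to 0 comes
      afterwards. Only real parts of the symbol were bounded, which suffices as \<open>x\<close> is
      self-adjoint.\<close>
    have L: "(\<lambda>N. (1 / 2) *\<^sub>R (fejer_mean f (Suc N) + star (fejer_mean f (Suc N)))) \<longlonglongrightarrow> (1 / 2) *\<^sub>R (x + star x)"
      by (intro tendsto_intros tendsto_star LIMSEQ_Suc fejer_mean_LIMSEQ[OF c])
    have "(\<lambda>N. (- d - (8 * F / e) / real (Suc N)) *\<^sub>R (1::'b)) \<longlonglongrightarrow> (- d - 0) *\<^sub>R 1"
      by (intro tendsto_intros LIMSEQ_Suc[OF lim_const_over_n])
    from cle_LIMSEQ[OF this L] have "(- d) *\<^sub>R 1 \<preceq> (1 / 2) *\<^sub>R (x + star x)"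
      using mean[OF zero_less_Suc] by simp
    thus ?thesis by (simp add: sx cle_def flip: scaleR_2)
  qed
  have "(\<lambda>N. x + (1 / real (Suc N)) *\<^sub>R 1) \<longlonglongrightarrow> x + 0 *\<^sub>R 1"
    by (intro tendsto_intros LIMSEQ_Suc[OF lim_1_over_n])
  from pos_LIMSEQ[OF this] show ?thesis using step by simp
qed

end

section \<open>The extension to the generated algebras\<close>

lemmas tendsto_scaleC = bounded_linear.tendsto[OF bounded_linear_scaleC_right]

lemma operator_system_scaleR: "operator_system S \<Longrightarrow> x \<in> S \<Longrightarrow> r *\<^sub>R x \<in> S"
  by (simp add: operator_system_def scaleR_scaleC)

lemma subalgebra_if_operator_system:
  "operator_system S \<Longrightarrow> (\<And>x y. x \<in> S \<Longrightarrow> y \<in> S \<Longrightarrow> x * y \<in> S) \<Longrightarrow> subalgebra S"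
  by (auto simp: subalgebra_def operator_system_scaleR) (auto simp: operator_system_def)

lemma operator_system_hull: "operator_system (operator_system hull S)"
  by (rule hull_in) (auto simp: operator_system_def)

lemma unital_cstar_subalgebra_closure:
  fixes S :: "'a::unital_cstar_algebra set"
  assumes S: "operator_system S" and mult: "\<And>x y. x \<in> S \<Longrightarrow> y \<in> S \<Longrightarrow> x * y \<in> S"
  shows "unital_cstar_subalgebra (closure S)"
proof -
  have sub: "subalgebra (closure S)"
    by (intro subalgebra_closure subalgebra_if_operator_system S mult)
  have "f x \<in> closure S" if f: "bounded_linear f" "\<And>y. y \<in> S \<Longrightarrow> f y \<in> S" and x: "x \<in> closure S"
    for f :: "'a \<Rightarrow> 'a" and x
  proof -
    obtain a where "\<And>k. a k \<in> S" "a \<longlonglongrightarrow> x" using x unfolding closure_sequential by blast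
    hence "\<And>k. f (a k) \<in> S" "(\<lambda>k. f (a k)) \<longlonglongrightarrow> f x"
      using f bounded_linear.tendsto[OF f(1)] by auto
    thus ?thesis unfolding closure_sequential by (metis (no_types, lifting))
  qed
  from this[OF bounded_linear_star] this[OF bounded_linear_scaleC_right] show ?thesis
    using S sub unfolding unital_cstar_subalgebra_def operator_system_def subalgebra_def by auto
qed

lemma unital_cstar_subalgebra_upow:
  assumes "unital_cstar_subalgebra S" "u \<in> S"
  shows "upow u i \<in> S"
proof -
  have pow: "x ^ k \<in> S" if "x \<in> S" for x k
    using that assms(1) by (induction k) (auto simp: unital_cstar_subalgebra_def operator_system_def)
  have "star u \<in> S" using assms by (simp add: unital_cstar_subalgebra_def operator_system_def)
  thus ?thesis using pow assms(2) by (simp add: upow_def)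
qed

context phase
begin

section \<open>Laurent polynomials and the correspondence between the two pairs\<close>

inductive_set laurent :: "'a::unital_cstar_algebra \<Rightarrow> 'a \<Rightarrow> 'a set" for u v where
  uvmon: "c *\<^sub>C uvmon u v i j \<in> laurent u v"
| add: "x \<in> laurent u v \<Longrightarrow> y \<in> laurent u v \<Longrightarrow> x + y \<in> laurent u v"

text \<open>Laurent polynomials with the same coefficients. This is a relation because an element
  may have several expansions; that they lead to the same partner is a consequence of
  \<open>graph_norm_le\<close>.\<close>

inductive graph :: "'a::unital_cstar_algebra \<Rightarrow> 'a \<Rightarrow> 'b::unital_cstar_algebra \<Rightarrow> 'b \<Rightarrow> 'a \<Rightarrow> 'b \<Rightarrow> bool"
  for u' v' u v where
  uvmon: "graph u' v' u v (c *\<^sub>C uvmon u' v' i j) (c *\<^sub>C uvmon u v i j)"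
| add: "graph u' v' u v x' x \<Longrightarrow> graph u' v' u v y' y \<Longrightarrow> graph u' v' u v (x' + y') (x + y)"

lemma graph_swap: "graph u' v' u v x' x \<Longrightarrow> graph u v u' v' x x'"
  by (induction rule: graph.induct) (auto intro: graph.intros)

lemma graph_laurent: "graph u' v' u v x' x \<Longrightarrow> x' \<in> laurent u' v'"
  by (induction rule: graph.induct) (auto intro: laurent.intros)

lemma laurent_graph: "x' \<in> laurent u' v' \<Longrightarrow> \<exists>x. graph u' v' u v x' x"
  by (induction rule: laurent.induct) (blast intro: graph.intros)+

lemma graph_scaleC: "graph u' v' u v x' x \<Longrightarrow> graph u' v' u v (c *\<^sub>C x') (c *\<^sub>C x)"
  by (induction rule: graph.induct) (auto simp: scaleC_scaleC scaleC_add_right intro: graph.intros)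

lemma graph_diff: "graph u' v' u v x' x \<Longrightarrow> graph u' v' u v y' y \<Longrightarrow> graph u' v' u v (x' - y') (x - y)"
  using graph.add[OF _ graph_scaleC[of u' v' u v y' y "- 1"]]
  by (simp add: scaleC_minus_left scaleC_one)

lemma graph_one: "graph u' v' u v 1 1"
  using graph.uvmon[of u' v' u v 1 0 0] by (simp add: uvmon_def scaleC_one)

lemma graph_left: "graph u' v' u v u' u"
  using graph.uvmon[of u' v' u v 1 1 0] by (simp add: uvmon_def scaleC_one)

lemma graph_right: "graph u' v' u v v' v"
  using graph.uvmon[of u' v' u v 1 0 1] by (simp add: uvmon_def scaleC_one)

lemma graph_star:
  assumes uv': "unitary u'" "unitary v'" "u' * v' = cis \<theta> *\<^sub>C (v' * u')"
    and uv: "unitary u" "unitary v" "u * v = cis \<theta> *\<^sub>C (v * u)"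
  shows "graph u' v' u v x' x \<Longrightarrow> graph u' v' u v (star x') (star x)"
proof (induction rule: graph.induct)
  case (uvmon c i j)
  show ?case unfolding star_scaleC star_uvmon[OF uv'] star_uvmon[OF uv] scaleC_scaleC
    by (rule graph.uvmon)
next
  case (add x' x y' y)
  show ?case unfolding star_add using add.IH by (rule graph.add)
qed

lemma graph_mult:
  assumes uv': "unitary u'" "unitary v'" "u' * v' = cis \<theta> *\<^sub>C (v' * u')"
    and uv: "unitary u" "unitary v" "u * v = cis \<theta> *\<^sub>C (v * u)"
    and x: "graph u' v' u v x' x" and y: "graph u' v' u v y' y"
  shows "graph u' v' u v (x' * y') (x * y)"
  using x
proof induction
  case (uvmon c i j)
  show ?case using y
    by induction (auto simp: mult_scaleC_left mult_scaleC_right uvmon_mult[OF uv'] uvmon_mult[OF uv]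
        scaleC_scaleC distrib_left scaleC_add_right intro: graph.intros)
qed (auto simp: distrib_right intro: graph.intros)

lemma laurent_operator_system:
  assumes uv: "unitary u" "unitary v" "u * v = cis \<theta> *\<^sub>C (v * u)"
  shows "operator_system (laurent u v)" "x \<in> laurent u v \<Longrightarrow> y \<in> laurent u v \<Longrightarrow> x * y \<in> laurent u v"
proof -
  \<comment> \<open>The correspondence of a pair with itself is the diagonal, so closure properties
    of Laurent polynomials can be read off from those of \<open>graph\<close>.\<close>
  have diag: "x = y" if "graph u v u v x y" for x y
    using that by induction auto
  hence gr: "graph u v u v x x" if "x \<in> laurent u v" for x
    using laurent_graph[OF that, of u v] by metis
  show "x \<in> laurent u v \<Longrightarrow> y \<in> laurent u v \<Longrightarrow> x * y \<in> laurent u v"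
    by (rule graph_laurent[OF graph_mult[OF uv uv gr gr]])
  show "operator_system (laurent u v)"
    unfolding operator_system_def
    using graph_laurent[OF graph_one] graph_laurent[OF graph_scaleC[OF gr]]
      graph_laurent[OF graph_star[OF uv uv gr]] by (auto intro: laurent.add)
qed

lemma cstar_gen_eq_closure:
  assumes uv: "unitary u" "unitary v" "u * v = cis \<theta> *\<^sub>C (v * u)"
  shows "cstar_gen u v = closure (laurent u v)"
  unfolding cstar_gen_def
proof (rule hull_unique)
  have "u \<in> laurent u v" "v \<in> laurent u v"
    by (rule graph_laurent[OF graph_left], rule graph_laurent[OF graph_right])
  thus "{u, v} \<subseteq> closure (laurent u v)" using closure_subset by blast
  show "unital_cstar_subalgebra (closure (laurent u v))"
    by (intro unital_cstar_subalgebra_closure laurent_operator_system uv)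
  fix T assume T: "{u, v} \<subseteq> T" "unital_cstar_subalgebra T"
  have "x \<in> T" if "x \<in> laurent u v" for x
    using that
  proof induction
    case (uvmon c i j)
    have "upow u i \<in> T" "upow v j \<in> T" using T by (auto intro: unital_cstar_subalgebra_upow)
    thus ?case using T(2) by (simp add: uvmon_def unital_cstar_subalgebra_def operator_system_def)
  next
    case (add x y)
    thus ?case using T(2) by (simp add: unital_cstar_subalgebra_def operator_system_def)
  qed
  thus "closure (laurent u v) \<subseteq> T"
    using T(2) by (intro closure_minimal) (auto simp: unital_cstar_subalgebra_def)
qed

end

section \<open>Positivity and norms of corresponding Laurent polynomials\<close>

context phase_transfer
begin

abbreviation gr :: "'a \<Rightarrow> 'b \<Rightarrow> bool" where "gr \<equiv> graph u' v' u v"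

lemmas gr_mult = graph_mult[OF uv' uv]
lemmas gr_star = graph_star[OF uv' uv]

lemma graph_avg_central:
  assumes "gr x' x"
  shows "\<exists>f. central (avg u' v' x') (avg u v x) f"
  using assms
proof induction
  case (uvmon c i j)
  show ?case
  proof (cases "int n dvd i \<and> int n dvd j")
    case True
    thus ?thesis unfolding avg_uvmon[OF uv'] avg_uvmon[OF uv] using central.uvmon by auto
  next
    case False
    \<comment> \<open>A vanishing average is represented by the zero multiple of the monomial with
      exponents 0.\<close>
    have "central (0 *\<^sub>C uvmon u' v' 0 0) (0 *\<^sub>C uvmon u v 0 0) (\<lambda>s t. 0 * cis (of_int 0 * s + of_int 0 * t))"
      by (rule central.uvmon) auto
    thus ?thesis unfolding avg_uvmon[OF uv'] avg_uvmon[OF uv] using False by auto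
  qed
next
  case (add x' x y' y)
  thus ?case unfolding avg_add using central.add by blast
qed

text \<open>For a Laurent polynomial \<open>x\<close> with partner \<open>x'\<close> the element
  \<open>star x' * g' * x'\<close> is positive, and its average has only exponents divisible by n,
  so \<open>central_pos\<close> applies. Continuity of \<open>avg\<close> extends this to the
  closure.\<close>

lemma avg_conj_pos:
  assumes "gr g' g" "pos g'" "star g = g" "r \<in> closure (laurent u v)"
  shows "pos (avg u v (star r * g * r))"
proof -
  obtain a where a: "\<And>k. a k \<in> laurent u v" "a \<longlonglongrightarrow> r"
    using assms(4) unfolding closure_sequential by blast
  have "pos (avg u v (star x * g * x))" if x: "x \<in> laurent u v" for x
  proof -
    obtain x' where "gr x' x" using laurent_graph[OF x] graph_swap by blast
    hence "gr (star x' * g' * x') (star x * g * x)" using assms(1) by (intro gr_mult gr_star)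
    then obtain f where f: "central (avg u' v' (star x' * g' * x')) (avg u v (star x * g * x)) f"
      using graph_avg_central by blast
    have "pos (avg u' v' (star x' * g' * x'))" by (intro pos_avg pos_conj assms(2))
    thus ?thesis by (rule central_pos[OF f]) (simp add: star_avg star_simps assms(3) mult.assoc)
  qed
  moreover have "(\<lambda>k. avg u v (star (a k) * g * a k)) \<longlonglongrightarrow> avg u v (star r * g * r)"
    by (intro tendsto_avg tendsto_intros tendsto_star a(2))
  ultimately show ?thesis using a(1) pos_LIMSEQ by blast
qed

text \<open>If \<open>r g r = - z\<^sup>2\<close>, then \<open>avg (z\<^sup>2) \<le> 0\<close>, whereas \<open>z\<^sup>2 \<le> avg (z\<^sup>2)\<close>.\<close>

lemma graph_pos:
  assumes gr: "gr g' g" and g': "pos g'" and sg: "star g = g"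
  shows "pos g"
proof (rule pos_if_no_negative_part[OF sg])
  fix r z
  assume r: "star r = r" and z: "star z = z" and rgr: "r * g * r = - (z * z)"
    and mem: "\<And>S. subalgebra S \<Longrightarrow> closed S \<Longrightarrow> g \<in> S \<Longrightarrow> r \<in> S"
  have "subalgebra (closure (laurent u v))"
    using laurent_operator_system[OF uv] by (auto intro: subalgebra_closure subalgebra_if_operator_system)
  moreover have "g \<in> closure (laurent u v)"
    using graph_laurent[OF graph_swap[OF gr]] closure_subset by blast
  ultimately have "r \<in> closure (laurent u v)" by (intro mem) auto
  from avg_conj_pos[OF gr g' sg this] have neg: "pos (- avg u v (z * z))"
    by (simp add: r rgr avg_minus)
  have pz: "pos (z * z)" by (rule pos_square[OF z])
  have "pos (- (z * z))"
    using pos_add[OF neg, of "avg u v (z * z) - z * z"] le_avg[OF pz, of u v] by (simp add: cle_def)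
  hence "z * z = 0" using pos_antisym[OF pz] by simp
  thus "z = 0" using cstar_identity[of z] z by simp
qed

text \<open>\<open>graph_pos\<close> is applied to \<open>(norm x')^2 - star x' * x'\<close>, which
  is positive and has the partner \<open>(norm x')^2 - star x * x\<close>.\<close>

lemma graph_norm_le:
  assumes "gr x' x"
  shows "norm x \<le> norm x'"
proof -
  let ?t = "(norm x')\<^sup>2"
  have "gr (complex_of_real ?t *\<^sub>C 1 - star x' * x') (complex_of_real ?t *\<^sub>C 1 - star x * x)"
    by (intro graph_diff graph_scaleC graph_one gr_mult gr_star assms)
  moreover have "pos (?t *\<^sub>R 1 - star x' * x')"
    using pos_norm_minus[of "star x' * x'"] by (simp add: star_simps cstar_identity)
  ultimately have "pos (?t *\<^sub>R 1 - star x * x)"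
    unfolding scaleR_scaleC by (rule graph_pos) (simp add: star_simps)
  hence "norm (star x * x) \<le> ?t" by (intro norm_le_if_pos_diff pos_star_mult)
  thus ?thesis by (simp add: cstar_identity power2_le_iff_abs_le)
qed

section \<open>The closed correspondence as a homomorphism of the generated algebras\<close>

definition limgraph :: "('a \<times> 'b) set" where
  "limgraph = closure {(x', x). gr x' x}"

lemma limgraph_iff:
  "(x', x) \<in> limgraph \<longleftrightarrow> (\<exists>a b. (\<forall>k. gr (a k) (b k)) \<and> a \<longlonglongrightarrow> x' \<and> b \<longlonglongrightarrow> x)"
proof
  assume "(x', x) \<in> limgraph"
  then obtain s where s: "\<And>k. s k \<in> {(x', x). gr x' x}" "s \<longlonglongrightarrow> (x', x)"
    unfolding limgraph_def closure_sequential by blast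
  have "(\<lambda>k. fst (s k)) \<longlonglongrightarrow> x'" "(\<lambda>k. snd (s k)) \<longlonglongrightarrow> x"
    using tendsto_fst[OF s(2)] tendsto_snd[OF s(2)] by auto
  thus "\<exists>a b. (\<forall>k. gr (a k) (b k)) \<and> a \<longlonglongrightarrow> x' \<and> b \<longlonglongrightarrow> x"
    using s(1) by (intro exI[of _ "\<lambda>k. fst (s k)"] exI[of _ "\<lambda>k. snd (s k)"]) (auto simp: case_prod_unfold)
next
  assume "\<exists>a b. (\<forall>k. gr (a k) (b k)) \<and> a \<longlonglongrightarrow> x' \<and> b \<longlonglongrightarrow> x"
  then obtain a b where "\<forall>k. gr (a k) (b k)" "a \<longlonglongrightarrow> x'" "b \<longlonglongrightarrow> x" by blast
  thus "(x', x) \<in> limgraph" unfolding limgraph_def closure_sequential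
    by (intro exI[of _ "\<lambda>k. (a k, b k)"]) (auto intro: tendsto_Pair)
qed

lemma limgraphI:
  "a \<longlonglongrightarrow> x' \<Longrightarrow> b \<longlonglongrightarrow> x \<Longrightarrow> (\<And>k. gr (a k) (b k)) \<Longrightarrow> (x', x) \<in> limgraph"
  unfolding limgraph_iff by (rule exI[of _ a], rule exI[of _ b]) simp

lemma limgraph_graph: "gr x' x \<Longrightarrow> (x', x) \<in> limgraph"
  by (rule limgraphI[OF tendsto_const tendsto_const])

lemma limgraph_add:
  assumes "(x', x) \<in> limgraph" "(y', y) \<in> limgraph"
  shows "(x' + y', x + y) \<in> limgraph"
proof -
  obtain a b c d where ab: "\<And>k. gr (a k) (b k)" "a \<longlonglongrightarrow> x'" "b \<longlonglongrightarrow> x"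
    and cd: "\<And>k. gr (c k) (d k)" "c \<longlonglongrightarrow> y'" "d \<longlonglongrightarrow> y"
    using assms unfolding limgraph_iff by blast
  show ?thesis
    by (rule limgraphI[OF tendsto_add[OF ab(2) cd(2)] tendsto_add[OF ab(3) cd(3)]])
       (rule graph.add[OF ab(1) cd(1)])
qed

lemma limgraph_mult:
  assumes "(x', x) \<in> limgraph" "(y', y) \<in> limgraph"
  shows "(x' * y', x * y) \<in> limgraph"
proof -
  obtain a b c d where ab: "\<And>k. gr (a k) (b k)" "a \<longlonglongrightarrow> x'" "b \<longlonglongrightarrow> x"
    and cd: "\<And>k. gr (c k) (d k)" "c \<longlonglongrightarrow> y'" "d \<longlonglongrightarrow> y"
    using assms unfolding limgraph_iff by blast
  show ?thesis
    by (rule limgraphI[OF tendsto_mult[OF ab(2) cd(2)] tendsto_mult[OF ab(3) cd(3)]])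
       (rule gr_mult[OF ab(1) cd(1)])
qed

lemma limgraph_scaleC:
  assumes "(x', x) \<in> limgraph"
  shows "(c *\<^sub>C x', c *\<^sub>C x) \<in> limgraph"
proof -
  obtain a b where ab: "\<And>k. gr (a k) (b k)" "a \<longlonglongrightarrow> x'" "b \<longlonglongrightarrow> x"
    using assms unfolding limgraph_iff by blast
  show ?thesis by (rule limgraphI[OF tendsto_scaleC[OF ab(2)] tendsto_scaleC[OF ab(3)]]) (rule graph_scaleC[OF ab(1)])
qed

lemma limgraph_star:
  assumes "(x', x) \<in> limgraph"
  shows "(star x', star x) \<in> limgraph"
proof -
  obtain a b where ab: "\<And>k. gr (a k) (b k)" "a \<longlonglongrightarrow> x'" "b \<longlonglongrightarrow> x"
    using assms unfolding limgraph_iff by blast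
  show ?thesis by (rule limgraphI[OF tendsto_star[OF ab(2)] tendsto_star[OF ab(3)]]) (rule gr_star[OF ab(1)])
qed

lemma limgraph_sum: "(\<And>i. i \<in> I \<Longrightarrow> (f i, g i) \<in> limgraph) \<Longrightarrow> (sum f I, sum g I) \<in> limgraph"
proof (induction I rule: infinite_finite_induct)
  case (insert i I)
  thus ?case by (auto intro: limgraph_add)
qed (use limgraph_scaleC[OF limgraph_graph[OF graph_one], of 0] in simp_all)

lemma limgraph_norm_le:
  assumes "(x', x) \<in> limgraph"
  shows "norm x \<le> norm x'"
proof -
  obtain a b where ab: "\<And>k. gr (a k) (b k)" "a \<longlonglongrightarrow> x'" "b \<longlonglongrightarrow> x"
    using assms unfolding limgraph_iff by blast
  show ?thesis
    by (rule LIMSEQ_le[OF tendsto_norm[OF ab(3)] tendsto_norm[OF ab(2)]])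
       (use graph_norm_le[OF ab(1)] in simp)
qed

text \<open>The norm bound for the difference, whose first component is 0, makes the closed relation
  the graph of a function.\<close>

lemma limgraph_unique:
  assumes "(x', x) \<in> limgraph" "(x', y) \<in> limgraph"
  shows "x = y"
  using limgraph_norm_le[OF limgraph_add[OF assms(1) limgraph_scaleC[OF assms(2), of "- 1"]]]
  by (simp add: scaleC_minus_left scaleC_one)

lemma limgraph_total:
  assumes "x' \<in> closure (laurent u' v')"
  shows "\<exists>x. (x', x) \<in> limgraph"
proof -
  obtain a where a: "\<And>k. a k \<in> laurent u' v'" "a \<longlonglongrightarrow> x'"
    using assms unfolding closure_sequential by blast
  have "\<forall>k. \<exists>x. gr (a k) x" using a(1) laurent_graph by blast
  then obtain b where b: "\<And>k. gr (a k) (b k)" using choice[of "\<lambda>k. gr (a k)"] by blast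
  have "norm (b k - b l) \<le> norm (a k - a l)" for k l by (intro graph_norm_le graph_diff b)
  hence "Cauchy b" using LIMSEQ_imp_Cauchy[OF a(2)] unfolding Cauchy_def dist_norm
    by (meson le_less_trans)
  then obtain x where "b \<longlonglongrightarrow> x" using Cauchy_convergent_iff convergent_def by blast
  thus ?thesis unfolding limgraph_iff using a b by blast
qed

lemma limgraph_range:
  assumes "(x', x) \<in> limgraph"
  shows "x' \<in> cstar_gen u' v' \<and> x \<in> cstar_gen u v"
proof -
  obtain a b where ab: "\<And>k. gr (a k) (b k)" "a \<longlonglongrightarrow> x'" "b \<longlonglongrightarrow> x"
    using assms unfolding limgraph_iff by blast
  have "a k \<in> laurent u' v'" "b k \<in> laurent u v" for k
    using graph_laurent[OF ab(1)] graph_laurent[OF graph_swap[OF ab(1)]] by auto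
  thus ?thesis using ab(2,3)
    unfolding cstar_gen_eq_closure[OF uv'] cstar_gen_eq_closure[OF uv] closure_sequential by blast
qed

definition extension :: "'a \<Rightarrow> 'b" where
  "extension x' = (THE x. (x', x) \<in> limgraph)"

lemma extension_eq: assumes "(x', x) \<in> limgraph" shows "extension x' = x"
  unfolding extension_def by (intro the_equality assms limgraph_unique[OF _ assms])

lemma limgraph_extension:
  assumes "x' \<in> cstar_gen u' v'"
  shows "(x', extension x') \<in> limgraph"
proof -
  obtain x where "(x', x) \<in> limgraph"
    using limgraph_total assms unfolding cstar_gen_eq_closure[OF uv'] by blast
  thus ?thesis by (simp add: extension_eq)
qed

text \<open>The factor supplied by \<open>positive_matrix\<close> may have entries anywhere in the
  ambient algebra, while \<open>extension\<close> is meaningful only on the generated one; the root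
  replaces it by a factor with entries there.\<close>

lemma completely_positive_if_limgraph:
  assumes S: "\<And>x. x \<in> S \<Longrightarrow> (x, f x) \<in> limgraph"
  shows "completely_positive_on S f"
  unfolding completely_positive_on_def n_positive_on_def
proof (intro allI impI, elim conjE)
  fix m X assume X: "\<forall>i<m. \<forall>j<m. X i j \<in> S" "positive_matrix m X"
  have sub: "subalgebra (cstar_gen u' v')" "closed (cstar_gen u' v')"
    unfolding cstar_gen_eq_closure[OF uv'] using laurent_operator_system[OF uv']
    by (auto intro: subalgebra_closure subalgebra_if_operator_system)
  have XA: "X i j \<in> cstar_gen u' v'" if "i < m" "j < m" for i j
    using limgraph_range[OF S] X(1) that by blast
  obtain R where R: "\<And>i j. i < m \<Longrightarrow> j < m \<Longrightarrow> R i j \<in> cstar_gen u' v'"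
    "\<And>i j. i < m \<Longrightarrow> j < m \<Longrightarrow> X i j = (\<Sum>l<m. star (R l i) * R l j)"
    using positive_matrix_root[OF star_positive_matrix[OF X(2)] pos_qform_positive_matrix[OF X(2)] sub XA]
    by blast
  have "f (X i j) = (\<Sum>l<m. star (extension (R l i)) * extension (R l j))" if ij: "i < m" "j < m" for i j
  proof -
    have "(\<Sum>l<m. star (R l i) * R l j, \<Sum>l<m. star (extension (R l i)) * extension (R l j)) \<in> limgraph"
      using R(1) ij by (intro limgraph_sum limgraph_mult limgraph_star limgraph_extension) auto
    moreover have "(X i j, f (X i j)) \<in> limgraph" using X(1) ij by (intro S) blast
    ultimately show ?thesis unfolding R(2)[OF ij] using limgraph_unique by blast
  qed
  thus "positive_matrix m (\<lambda>i j. f (X i j))" unfolding positive_matrix_def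
    by (intro exI[of _ "\<lambda>i j. extension (R i j)"]) blast
qed

text \<open>The reversed inequality makes the extension isometric, hence injective. It also makes
  the partners of an approximating sequence in the target Cauchy, which gives surjectivity.\<close>

lemma star_isomorphism_extension:
  assumes inv: "\<And>x' x. gr x' x \<Longrightarrow> norm x' \<le> norm x"
  shows "star_isomorphism (cstar_gen u' v') (cstar_gen u v) extension"
proof -
  let ?A = "cstar_gen u' v'" and ?B = "cstar_gen u v"
  have inv_lim: "norm x' \<le> norm x" if lim: "(x', x) \<in> limgraph" for x' x
  proof -
    obtain a b where ab: "\<And>k. gr (a k) (b k)" "a \<longlonglongrightarrow> x'" "b \<longlonglongrightarrow> x"
      using lim unfolding limgraph_iff by blast
    show ?thesis
      by (rule LIMSEQ_le[OF tendsto_norm[OF ab(2)] tendsto_norm[OF ab(3)]])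
         (use inv[OF ab(1)] in simp)
  qed
  have "inj_on extension ?A"
  proof (rule inj_onI)
    fix x y assume xy: "x \<in> ?A" "y \<in> ?A" "extension x = extension y"
    have "(x + (- 1) *\<^sub>C y, extension x + (- 1) *\<^sub>C extension y) \<in> limgraph"
      by (intro limgraph_add limgraph_scaleC limgraph_extension xy)
    from inv_lim[OF this] xy(3) show "x = y" by (simp add: scaleC_minus_left scaleC_one)
  qed
  moreover have "extension ` ?A = ?B"
  proof (intro equalityI subsetI)
    fix y assume "y \<in> extension ` ?A"
    thus "y \<in> ?B" using limgraph_extension limgraph_range by blast
  next
    fix y assume "y \<in> ?B"
    then obtain b where b: "\<And>k. b k \<in> laurent u v" "b \<longlonglongrightarrow> y"
      unfolding cstar_gen_eq_closure[OF uv] closure_sequential by blast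
    have "\<forall>k. \<exists>x. gr x (b k)" using b(1) laurent_graph graph_swap by blast
    then obtain a where a: "\<And>k. gr (a k) (b k)" using choice[of "\<lambda>k x. gr x (b k)"] by blast
    have "norm (a k - a l) \<le> norm (b k - b l)" for k l by (intro inv graph_diff a)
    hence "Cauchy a" using LIMSEQ_imp_Cauchy[OF b(2)] unfolding Cauchy_def dist_norm
      by (meson le_less_trans)
    then obtain x where "a \<longlonglongrightarrow> x" using Cauchy_convergent_iff convergent_def by blast
    hence "(x, y) \<in> limgraph" by (rule limgraphI[OF _ b(2) a])
    hence "extension x = y" "x \<in> ?A" using extension_eq limgraph_range by blast+
    thus "y \<in> extension ` ?A" by blast
  qed
  moreover have "extension (x + y) = extension x + extension y" "extension (x * y) = extension x * extension y"
    if "x \<in> ?A" "y \<in> ?A" for x y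
    using that by (auto intro!: extension_eq limgraph_add limgraph_mult limgraph_extension)
  moreover have "extension (c *\<^sub>C x) = c *\<^sub>C extension x" "extension (star x) = star (extension x)"
    if "x \<in> ?A" for c x
    using that by (auto intro!: extension_eq limgraph_scaleC limgraph_star limgraph_extension)
  ultimately show ?thesis
    unfolding star_isomorphism_def linear_map_on_def bij_betw_def by blast
qed

end

text \<open>Positive elements have self-adjoint images; a self-adjoint \<open>h\<close> is
  \<open>norm h + h\<close> minus a scalar, and a general element is treated through its real and
  imaginary parts.\<close>

lemma linear_map_on_star:
  fixes \<phi> :: "'a::unital_cstar_algebra \<Rightarrow> 'b::unital_cstar_algebra"
  assumes S: "operator_system S" and lin: "linear_map_on S \<phi>" and one: "\<phi> 1 = 1"
    and npos: "n_positive_on n S \<phi>" and n: "n \<ge> 1" and x: "x \<in> S"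
  shows "\<phi> (star x) = star (\<phi> x)"
proof -
  have add: "a + b \<in> S" "\<phi> (a + b) = \<phi> a + \<phi> b" if "a \<in> S" "b \<in> S" for a b
    using that S lin by (auto simp: operator_system_def linear_map_on_def)
  have scale: "c *\<^sub>C a \<in> S" "\<phi> (c *\<^sub>C a) = c *\<^sub>C \<phi> a" if "a \<in> S" for a c
    using that S lin by (auto simp: operator_system_def linear_map_on_def)
  have mem: "1 \<in> S" "star x \<in> S" using S x by (auto simp: operator_system_def)
  have zero: "0 \<in> S" using scale(1)[OF mem(1), of 0] by simp
  have sa_pos: "star (\<phi> p) = \<phi> p" if p: "pos p" "p \<in> S" for p
  proof -
    \<comment> \<open>Placing \<open>p\<close> in the corner of a zero matrix lets n-positivity act
      on single elements; the corner exists since n is at least 1.\<close>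
    let ?X = "\<lambda>i j::nat. if i = 0 \<and> j = 0 then p else 0"
    have "positive_matrix n ?X"
      unfolding positive_matrix_def
    proof (intro exI[of _ "\<lambda>i j. if i = 0 \<and> j = 0 then psqrt p else 0"] allI impI)
      fix i j assume "i < n" "j < n"
      have "(\<Sum>l<n. star (if l = 0 \<and> i = 0 then psqrt p else 0) * (if l = 0 \<and> j = 0 then psqrt p else 0)) =
        (\<Sum>l<n. if l = 0 then (if i = 0 \<and> j = 0 then psqrt p * psqrt p else 0) else 0)"
        using pos_psqrt[OF p(1)] by (intro sum.cong) (auto simp: pos_selfadjoint)
      thus "?X i j = (\<Sum>l<n. star (if l = 0 \<and> i = 0 then psqrt p else 0) * (if l = 0 \<and> j = 0 then psqrt p else 0))"
        using n psqrt_square[OF p(1)] by auto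
    qed
    hence "positive_matrix n (\<lambda>i j. \<phi> (?X i j))"
      using npos zero p(2) unfolding n_positive_on_def by auto
    from star_positive_matrix[OF this, of 0 0] n show ?thesis by simp
  qed
  have sa: "star (\<phi> h) = \<phi> h" if h: "star h = h" "h \<in> S" for h
  proof -
    have p: "pos (norm h *\<^sub>R 1 + h)" using pos_norm_minus[of "- h"] h by (simp add: star_minus)
    have N: "norm h *\<^sub>R 1 \<in> S" "\<phi> (norm h *\<^sub>R 1) = norm h *\<^sub>R 1"
      using scale[OF mem(1), of "norm h"] one by (simp_all add: scaleR_scaleC)
    have "star (\<phi> (norm h *\<^sub>R 1 + h)) = \<phi> (norm h *\<^sub>R 1 + h)"
      by (intro sa_pos p add N h)
    thus ?thesis using N h by (simp add: add star_simps)
  qed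
  define h k where "h = (1 / 2) *\<^sub>C (x + star x)" and "k = (\<i> / 2) *\<^sub>C (star x + (- 1) *\<^sub>C x)"
  have hkS: "h \<in> S" "k \<in> S" unfolding h_def k_def by (intro scale add x mem)+
  have hk: "star h = h" "star k = k"
    by (simp_all add: h_def k_def star_simps scaleC_add_right scaleC_diff_right scaleC_scaleC
        scaleC_minus_left scaleC_one add.commute)
  have xhk: "x = h + \<i> *\<^sub>C k" "star x = h + (- \<i>) *\<^sub>C k"
    using scaleC_add_left[of "1 / 2" "1 / 2" x] scaleC_add_left[of "1 / 2" "1 / 2" "star x"]
    by (simp_all add: h_def k_def scaleC_add_right scaleC_diff_right scaleC_scaleC scaleC_minus_left
        scaleC_one)
  have "\<phi> (star x) = \<phi> h + (- \<i>) *\<^sub>C \<phi> k" unfolding xhk(2) using hkS by (simp add: add scale)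
  moreover have "\<phi> x = \<phi> h + \<i> *\<^sub>C \<phi> k"
    using hkS by (subst xhk(1)) (simp add: add scale)
  ultimately show ?thesis using sa[OF hk(1) hkS(1)] sa[OF hk(2) hkS(2)] by (simp add: star_simps)
qed

lemma opsys_gen_props:
  "operator_system (opsys_gen u v)" "u \<in> opsys_gen u v" "v \<in> opsys_gen u v"
  unfolding opsys_gen_def using operator_system_hull[of "{u, v}"] hull_subset[of "{u, v}" operator_system]
  by auto

section \<open>From n-positivity to the transfer of gaps\<close>

context phase
begin

lemma gap_transfer:
  fixes u' v' :: "'a::unital_cstar_algebra" and u v :: "'b::unital_cstar_algebra"
  assumes unitary: "unitary u'" "unitary v'" "unitary u" "unitary v"
    and lin: "linear_map_on (opsys_gen u' v') \<phi>" and \<phi>: "\<phi> u' = u" "\<phi> v' = v" "\<phi> 1 = 1"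
    and npos: "n_positive_on n (opsys_gen u' v') \<phi>"
    and gap: "\<And>w. per w \<Longrightarrow> e *\<^sub>R nn w \<preceq> Q u' v' s t w" and w: "per w"
  shows "e *\<^sub>R nn w \<preceq> Q u v s t w"
proof -
  let ?S = "opsys_gen u' v'"
  note S = opsys_gen_props[where u = u' and v = v']
  have add: "a + b \<in> ?S \<and> \<phi> (a + b) = \<phi> a + \<phi> b" if "a \<in> ?S" "b \<in> ?S" for a b
    using that S(1) lin by (auto simp: operator_system_def linear_map_on_def)
  have scale: "c *\<^sub>C a \<in> ?S \<and> \<phi> (c *\<^sub>C a) = c *\<^sub>C \<phi> a" if "a \<in> ?S" for a c
    using that S(1) lin by (auto simp: operator_system_def linear_map_on_def)
  have diff: "a - b \<in> ?S \<and> \<phi> (a - b) = \<phi> a - \<phi> b" if "a \<in> ?S" "b \<in> ?S" for a b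
    using add[of a "(- 1) *\<^sub>C b"] scale[of b "- 1"] that by (simp add: scaleC_minus_left scaleC_one)
  have one: "1 \<in> ?S" using S(1) by (simp add: operator_system_def)
  have zero: "0 \<in> ?S \<and> \<phi> 0 = 0" using scale[OF one, of 0] by simp
  have scaleR: "r *\<^sub>R 1 \<in> ?S \<and> \<phi> (r *\<^sub>R 1) = r *\<^sub>R 1" for r
    using scale[OF one, of r] \<phi>(3) by (simp add: scaleR_scaleC)
  have star: "star a \<in> ?S \<and> \<phi> (star a) = star (\<phi> a)" if "a \<in> ?S" for a
    using linear_map_on_star[OF S(1) lin \<phi>(3) npos n_pos that] that S(1) by (simp add: operator_system_def)
  \<comment> \<open>Membership and value are bundled in one relation that respects every operation
    occurring in \<open>gap_matrix\<close>, so its entries are handled by structural rules.\<close>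
  define R where "R x y \<longleftrightarrow> x \<in> ?S \<and> \<phi> x = y" for x y
  have R_if: "R (if P then a else b) (if P then a' else b')" if "R a a'" "R b b'" for P a b a' b'
    using that by simp
  have R_rules: "R a a' \<Longrightarrow> R b b' \<Longrightarrow> R (a - b) (a' - b')"
      "R a a' \<Longrightarrow> R b b' \<Longrightarrow> R (a + b) (a' + b')" "R a a' \<Longrightarrow> R (c *\<^sub>C a) (c *\<^sub>C a')"
      "R a a' \<Longrightarrow> R (star a) (star a')" "R (r *\<^sub>R 1) (r *\<^sub>R 1)" "R 0 0" "R u' u" "R v' v"
    for a b a' b' c r
    using add diff scale star scaleR zero S \<phi> unfolding R_def by auto
  have "R (gap_matrix u' v' s t e i j) (gap_matrix u v s t e i j)" for i j
    unfolding gap_matrix_def by (intro R_if R_rules)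
  hence mem: "\<And>i j. gap_matrix u' v' s t e i j \<in> ?S"
    and eq: "\<And>i j. \<phi> (gap_matrix u' v' s t e i j) = gap_matrix u v s t e i j"
    unfolding R_def by auto
  have "positive_matrix n (gap_matrix u' v' s t e)"
    using gap by (simp add: positive_gap_matrix_iff unitary)
  hence "positive_matrix n (\<lambda>i j. \<phi> (gap_matrix u' v' s t e i j))"
    using npos mem unfolding n_positive_on_def by blast
  hence "positive_matrix n (gap_matrix u v s t e)" by (simp add: eq)
  thus ?thesis using w by (simp add: positive_gap_matrix_iff unitary)
qed

end

theorem theorem5p6:
  fixes k n :: nat
    and q :: complex
    and u v :: "'b::unital_cstar_algebra"
    and u' v' :: "'a::unital_cstar_algebra"
    and \<phi> :: "'a \<Rightarrow> 'b"
  assumes "n \<ge> 1" and "coprime k n"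
    and "unitary u" and "unitary v"
    and "u * v = exp (2 * of_real pi * \<i> * of_nat k / of_nat n) *\<^sub>C (v * u)"
    and "cmod q = 1"
    and "unitary u'" and "unitary v'"
    and "u' * v' = q *\<^sub>C (v' * u')"
    and "linear_map_on (opsys_gen u' v') \<phi>"
    and "\<phi> ` opsys_gen u' v' \<subseteq> opsys_gen u v"
    and "\<phi> u' = u" and "\<phi> v' = v"
    and "\<phi> 1 = 1"
    and "n_positive_on n (opsys_gen u' v') \<phi>"
  shows "q = exp (2 * of_real pi * \<i> * of_nat k / of_nat n)
    \<and> completely_positive_on (opsys_gen u' v') \<phi>
    \<and> (n_order_isomorphism n (opsys_gen u' v') (opsys_gen u v) \<phi> \<longrightarrow>
        (\<exists>\<Phi>. star_isomorphism (cstar_gen u' v') (cstar_gen u v) \<Phi>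
           \<and> (\<forall>x\<in>opsys_gen u' v'. \<Phi> x = \<phi> x)))"
proof -
  define \<theta> where "\<theta> = 2 * pi * real k / real n"
  have om: "exp (2 * of_real pi * \<i> * of_nat k / of_nat n) = cis \<theta>"
    by (simp add: cis_conv_exp \<theta>_def mult_ac)
  interpret phase n \<theta>
  proof
    fix m :: int
    have "cis (of_int m * \<theta>) = cis (2 * pi * of_int (m * int k) / real n)"
      by (simp add: \<theta>_def mult_ac)
    also have "\<dots> = 1 \<longleftrightarrow> int n dvd m * int k"
      using assms(1) by (intro cis_root_eq_1_iff) simp
    also have "\<dots> \<longleftrightarrow> int n dvd m"
      using assms(2) by (simp add: coprime_dvd_mult_left_iff coprime_commute)
    finally show "cis (of_int m * \<theta>) = 1 \<longleftrightarrow> int n dvd m" .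
  qed (rule assms(1))
  let ?S = "opsys_gen u' v'" and ?T = "opsys_gen u v"
  note S = opsys_gen_props[where u = u' and v = v'] and T = opsys_gen_props[where u = u and v = v]
  have rel: "u * v = cis \<theta> *\<^sub>C (v * u)" using assms(5) by (simp only: om)
  note transfer = gap_transfer[OF assms(7,8,3,4,10,12,13,14,15)]
  have q: "q = cis \<theta>"
  proof (rule ccontr)
    assume "q \<noteq> cis \<theta>"
    then obtain e where e: "e > 0" "\<And>s t (w :: int \<Rightarrow> 'a). per w \<Longrightarrow> e *\<^sub>R nn w \<preceq> Q u' v' s t w"
      using Q_lower_bound_if_wrong_phase[OF assms(7,8,9)] by blast
    have "e \<le> 0"
      by (rule no_uniform_gap[OF assms(3,4) rel]) (rule transfer[OF e(2)])
    with e(1) show False by simp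
  qed
  have rel': "u' * v' = cis \<theta> *\<^sub>C (v' * u')" using assms(9) by (simp only: q)
  interpret F: phase_transfer n \<theta> u' v' u v
    by unfold_locales (fact assms rel rel' | rule transfer)+
  have lim: "(x, \<phi> x) \<in> F.limgraph" if "x \<in> ?S" for x
  proof -
    \<comment> \<open>The points where the map agrees with the closed correspondence form an
      operator system containing both generators.\<close>
    have "?S \<subseteq> {x \<in> ?S. (x, \<phi> x) \<in> F.limgraph}"
      unfolding opsys_gen_def
    proof (rule hull_minimal, fold opsys_gen_def)
      show "{u', v'} \<subseteq> {x \<in> ?S. (x, \<phi> x) \<in> F.limgraph}"
        using S assms(12,13) F.limgraph_graph[OF graph_left] F.limgraph_graph[OF graph_right] by simp
      show "operator_system {x \<in> ?S. (x, \<phi> x) \<in> F.limgraph}"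
        using S(1) assms(10,14) F.limgraph_graph[OF graph_one] F.limgraph_add F.limgraph_scaleC F.limgraph_star
          linear_map_on_star[OF S(1) assms(10,14,15,1)]
        unfolding operator_system_def linear_map_on_def by simp
    qed
    thus ?thesis using that by blast
  qed
  have cp: "completely_positive_on ?S \<phi>" by (rule F.completely_positive_if_limgraph[OF lim])
  have iso: "\<exists>\<Phi>. star_isomorphism (cstar_gen u' v') (cstar_gen u v) \<Phi> \<and> (\<forall>x\<in>?S. \<Phi> x = \<phi> x)"
    if oi: "n_order_isomorphism n ?S ?T \<phi>"
  proof -
    define \<psi> where "\<psi> = inv_into ?S \<phi>"
    have bij: "bij_betw \<phi> ?S ?T" and npos: "n_positive_on n ?T \<psi>"
      using oi by (simp_all add: n_order_isomorphism_def \<psi>_def)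
    have \<psi>\<phi>: "\<psi> (\<phi> x) = x" if "x \<in> ?S" for x
      unfolding \<psi>_def using bij that by (simp add: bij_betw_def)
    have \<phi>\<psi>: "\<psi> y \<in> ?S" "\<phi> (\<psi> y) = y" if "y \<in> ?T" for y
      unfolding \<psi>_def using bij that by (auto simp: bij_betw_def inv_into_into f_inv_into_f)
    have one: "1 \<in> ?S" using S(1) by (simp add: operator_system_def)
    have lin: "linear_map_on ?T \<psi>"
      unfolding linear_map_on_def
    proof (intro conjI ballI allI)
      fix x y assume xy: "x \<in> ?T" "y \<in> ?T"
      have "\<psi> x + \<psi> y \<in> ?S" using S(1) \<phi>\<psi>(1) xy by (simp add: operator_system_def)
      moreover have "\<phi> (\<psi> x + \<psi> y) = x + y"
        using assms(10) \<phi>\<psi> xy by (simp add: linear_map_on_def)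
      ultimately show "\<psi> (x + y) = \<psi> x + \<psi> y" using \<psi>\<phi> by metis
    next
      fix c x assume x: "x \<in> ?T"
      have "c *\<^sub>C \<psi> x \<in> ?S" using S(1) \<phi>\<psi>(1) x by (simp add: operator_system_def)
      moreover have "\<phi> (c *\<^sub>C \<psi> x) = c *\<^sub>C x"
        using assms(10) \<phi>\<psi> x by (simp add: linear_map_on_def)
      ultimately show "\<psi> (c *\<^sub>C x) = c *\<^sub>C \<psi> x" using \<psi>\<phi> by metis
    qed
    have \<psi>: "\<psi> u = u'" "\<psi> v = v'" "\<psi> 1 = 1"
      using \<psi>\<phi>[OF S(2)] \<psi>\<phi>[OF S(3)] \<psi>\<phi>[OF one] assms(12-14) by simp_all
    \<comment> \<open>The inverse map transfers gaps from \<open>(u, v)\<close> back to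
      \<open>(u', v')\<close>; this gives the reversed norm inequality.\<close>
    interpret B: phase_transfer n \<theta> u v u' v'
      by unfold_locales (fact assms rel rel' | rule gap_transfer[OF assms(3,4,7,8) lin \<psi> npos])+
    have "norm x' \<le> norm x" if "graph u' v' u v x' x" for x' x
      by (rule B.graph_norm_le[OF graph_swap[OF that]])
    hence "star_isomorphism (cstar_gen u' v') (cstar_gen u v) F.extension"
      by (rule F.star_isomorphism_extension)
    moreover have "\<forall>x\<in>?S. F.extension x = \<phi> x" using F.extension_eq[OF lim] by blast
    ultimately show ?thesis by blast
  qed
  show ?thesis unfolding om using q cp iso by blast
qed

end
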